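(* Let $R(z)$ be given by the stable representation $$R(z)=\delta+z\gamma_+(I_{\mathcal X_+}-z\alpha_+)^{-1}\beta_++\gamma_-(zI_{\mathcal X_-}-\alpha_-)^{-1}\beta_-$$ with $\alpha_-$ invertible, so that $R(z)$ is analytic at zero, and with $R(0)=\delta-\gamma_-\alpha_-^{-1}\beta_-$ invertible. Assume that $R(z)$ admits a right canonical Wiener-Hopf factorization. Let $Q\in\mathcal B(\mathcal X_+,\mathcal X_-)$ be the stabilizing solution to the Riccati equation $$Q=\alpha_-Q\alpha_++(\beta_--\alpha_-Q\beta_+)(\delta-\gamma_-Q\beta_+)^{-1}(\gamma_+-\gamma_-Q\alpha_+),$$ and let $Z\in\mathcal B(\mathcal X_-,\mathcal X_+)$ be the unique solution of the Lyapunov equation $$Z(\alpha_-^\circ)^{-1}-\alpha_+^\circ Z=-\beta_+R(0)^{-1}\gamma_-\alpha_-^{-1}.$$ Then $R(z)$ admits a left canonical Wiener-Hopf factorization if and only if $I-QZ$ is invertible.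
   Context: $\mathbb D$ is the open unit disc, $\mathbb T$ the unit circle. $\mathcal B(\mathcal X,\mathcal Y)$ denotes bounded linear operators between Hilbert spaces; "invertible" means boundedly invertible. An operator $T$ is exponentially stable if $\sigma(T)\subset\mathbb D$. A stable representation of a $\mathcal B(\mathcal U)$-valued function $R$ is a formula as displayed in the claim, where $\mathcal U,\mathcal X_+,\mathcal X_-$ are complex Hilbert spaces, $\delta\in\mathcal B(\mathcal U)$, $\alpha_\pm\in\mathcal B(\mathcal X_\pm)$, $\beta_\pm\in\mathcal B(\mathcal U,\mathcal X_\pm)$, $\gamma_\pm\in\mathcal B(\mathcal X_\pm,\mathcal U)$, and $\alpha_+$, $\alpha_-$ are exponentially stable. A right (respectively left) canonical Wiener-Hopf factorization of $R$ is a factorization $R(z)=V_-(z)V_+(z)$ (respectively $R(z)=W_+(z)W_-(z)$) for $z\in\mathbb T$, with $\mathcal B(\mathcal U)$-valued factors, such that $V_+$ (respectively $W_+$) is analytic with invertible values on (a neighborhood of) $\overline{\mathbb D}$, with inverse also analytic there, and $V_-$ (respectively $W_-$) is analytic with invertible values on (a neighborhood of) $(\mathbb C\setminus\mathbb D)\cup\{\infty\}$, with inverse also analytic there. A solution $Q$ of the Riccati equation (for which $\delta-\gamma_-Q\beta_+$ is required to be invertible) is stabilizing if the operators $$\alpha_+^\circ:=\alpha_+-\beta_+(\delta-\gamma_-Q\beta_+)^{-1}(\gamma_+-\gamma_-Q\alpha_+),\qquad\alpha_-^\circ:=\alpha_--(\beta_--\alpha_-Q\beta_+)(\delta-\gamma_-Q\beta_+)^{-1}\gamma_-$$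 are exponentially stable. Under the hypotheses of the theorem the stabilizing solution $Q$ exists and is unique, $\alpha_-^\circ$ (formed with this $Q$) is invertible, and, since $\sigma((\alpha_-^\circ)^{-1})\cap\sigma(\alpha_+^\circ)=\emptyset$, the Lyapunov equation has a unique solution $Z$; in the Lyapunov equation $\alpha_\pm^\circ$ are formed with the stabilizing solution $Q$. *)

theory Defs
  imports "HOL-Analysis.Analysis"
begin

class complex_vector = real_vector +
  fixes scaleC :: "complex \<Rightarrow> 'a \<Rightarrow> 'a" (infixr "*\<^sub>C" 75)
  assumes scaleR_scaleC: "r *\<^sub>R x = complex_of_real r *\<^sub>C x"
    and scaleC_add_right: "c *\<^sub>C (x + y) = c *\<^sub>C x + c *\<^sub>C y"
    and scaleC_add_left: "(c + d) *\<^sub>C x = c *\<^sub>C x + d *\<^sub>C x"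
    and scaleC_scaleC: "c *\<^sub>C d *\<^sub>C x = (c * d) *\<^sub>C x"

class complex_normed_vector = complex_vector + real_normed_vector +
  assumes norm_scaleC: "norm (c *\<^sub>C x) = cmod c * norm x"

text \<open>The inner product is linear in the first argument. Positive definiteness is a consequence
  of the axiom that relates it to the norm.\<close>

class complex_hilbert = complex_vector + banach +
  fixes cinner :: "'a \<Rightarrow> 'a \<Rightarrow> complex"
  assumes cinner_commute: "cinner x y = cnj (cinner y x)"
    and cinner_add_left: "cinner (x + y) z = cinner x z + cinner y z"
    and cinner_scaleC_left: "cinner (c *\<^sub>C x) y = c * cinner x y"
    and cinner_self: "cinner x x = complex_of_real ((norm x)\<^sup>2)"
begin

subclass complex_normed_vector
proof
  fix c :: complex and x :: 'a
  have "cinner (c *\<^sub>C x) (c *\<^sub>C x) = c * cnj c * cinner x x"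
    by (metis (no_types, lifting) cinner_commute cinner_scaleC_left complex_cnj_mult mult.assoc)
  then have "complex_of_real ((norm (c *\<^sub>C x))\<^sup>2) = complex_of_real ((cmod c * norm x)\<^sup>2)"
    by (simp add: cinner_self complex_norm_square[symmetric] power_mult_distrib)
  then have "(norm (c *\<^sub>C x))\<^sup>2 = (cmod c * norm x)\<^sup>2"
    using of_real_eq_iff by blast
  then show "norm (c *\<^sub>C x) = cmod c * norm x"
    by simp
qed

end

instantiation complex :: complex_hilbert
begin
definition "scaleC_complex (c :: complex) (x :: complex) = c * x"
definition "cinner_complex (x :: complex) (y :: complex) = x * cnj y"
instance
proof
  fix r :: real and c d x y z :: complex
  show "r *\<^sub>R x = complex_of_real r *\<^sub>C x"
    by (simp add: scaleC_complex_def scaleR_conv_of_real)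
  show "c *\<^sub>C (x + y) = c *\<^sub>C x + c *\<^sub>C y" "(c + d) *\<^sub>C x = c *\<^sub>C x + d *\<^sub>C x"
    by (simp_all add: scaleC_complex_def distrib_left distrib_right)
  show "c *\<^sub>C d *\<^sub>C x = (c * d) *\<^sub>C x"
    by (simp add: scaleC_complex_def mult.assoc)
  show "cinner x y = cnj (cinner y x)"
    by (simp add: cinner_complex_def mult.commute)
  show "cinner (x + y) z = cinner x z + cinner y z" "cinner (c *\<^sub>C x) y = c * cinner x y"
    by (simp_all add: scaleC_complex_def cinner_complex_def distrib_right mult.assoc)
  show "cinner x x = complex_of_real ((norm x)\<^sup>2)"
    unfolding cinner_complex_def by (rule complex_norm_square[symmetric])
qed
end

lemma scaleC_zero_right [simp]: "c *\<^sub>C (0 :: 'a :: complex_vector) = 0"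
  using scaleC_add_right[of c "0 :: 'a" 0] by simp

lemma scaleC_minus_right: "c *\<^sub>C (- x :: 'a :: complex_vector) = - (c *\<^sub>C x)"
  using scaleC_add_right[of c x "- x"] by (simp add: eq_neg_iff_add_eq_0 add.commute)

lemma scaleC_diff_right: "c *\<^sub>C (x - y :: 'a :: complex_vector) = c *\<^sub>C x - c *\<^sub>C y"
  using scaleC_add_right[of c x "- y"] by (simp add: scaleC_minus_right)

lemma bounded_linear_scaleC: "bounded_linear (\<lambda>x :: 'a :: complex_normed_vector. c *\<^sub>C x)"
proof (rule bounded_linear_intro[where K = "cmod c"])
  fix x y :: 'a and r :: real
  show "c *\<^sub>C (x + y) = c *\<^sub>C x + c *\<^sub>C y" by (rule scaleC_add_right)
  show "c *\<^sub>C r *\<^sub>R x = r *\<^sub>R c *\<^sub>C x" by (simp add: scaleR_scaleC scaleC_scaleC mult.commute)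
  show "norm (c *\<^sub>C x) \<le> norm x * cmod c" by (simp add: norm_scaleC mult.commute)
qed

lift_definition blinfun_scaleC ::
    "complex \<Rightarrow> 'a :: real_normed_vector \<Rightarrow>\<^sub>L 'b :: complex_normed_vector \<Rightarrow> 'a \<Rightarrow>\<^sub>L 'b"
  is "\<lambda>c f x. c *\<^sub>C f x"
  by (rule bounded_linear_compose[OF bounded_linear_scaleC])

text \<open>Bounded complex-linear operators with the operator norm, as a subtype of the bounded
  real-linear operators of the library.\<close>

typedef (overloaded) ('a :: complex_normed_vector, 'b :: complex_normed_vector) cblinfun
    ("(_ \<Rightarrow>\<^sub>C\<^sub>L /_)" [22, 21] 21) =
  "{f :: 'a \<Rightarrow>\<^sub>L 'b. \<forall>c x. blinfun_apply f (c *\<^sub>C x) = c *\<^sub>C blinfun_apply f x}"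
  by (rule exI[of _ 0]) simp

setup_lifting type_definition_cblinfun

lift_definition cblinfun_apply ::
    "'a :: complex_normed_vector \<Rightarrow>\<^sub>C\<^sub>L 'b :: complex_normed_vector \<Rightarrow> 'a \<Rightarrow> 'b"
  is blinfun_apply .

instantiation cblinfun :: (complex_normed_vector, complex_normed_vector) complex_normed_vector
begin

lift_definition zero_cblinfun :: "'a \<Rightarrow>\<^sub>C\<^sub>L 'b" is 0 by simp
lift_definition plus_cblinfun :: "'a \<Rightarrow>\<^sub>C\<^sub>L 'b \<Rightarrow> 'a \<Rightarrow>\<^sub>C\<^sub>L 'b \<Rightarrow> 'a \<Rightarrow>\<^sub>C\<^sub>L 'b" is "(+)"
  by (simp add: plus_blinfun.rep_eq scaleC_add_right)
lift_definition uminus_cblinfun :: "'a \<Rightarrow>\<^sub>C\<^sub>L 'b \<Rightarrow> 'a \<Rightarrow>\<^sub>C\<^sub>L 'b" is uminus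
  by (simp add: uminus_blinfun.rep_eq scaleC_minus_right)
lift_definition minus_cblinfun :: "'a \<Rightarrow>\<^sub>C\<^sub>L 'b \<Rightarrow> 'a \<Rightarrow>\<^sub>C\<^sub>L 'b \<Rightarrow> 'a \<Rightarrow>\<^sub>C\<^sub>L 'b" is "(-)"
  by (simp add: minus_blinfun.rep_eq scaleC_diff_right)
lift_definition scaleR_cblinfun :: "real \<Rightarrow> 'a \<Rightarrow>\<^sub>C\<^sub>L 'b \<Rightarrow> 'a \<Rightarrow>\<^sub>C\<^sub>L 'b" is "(*\<^sub>R)"
  by (simp add: scaleR_blinfun.rep_eq scaleR_scaleC scaleC_scaleC mult.commute)
lift_definition scaleC_cblinfun :: "complex \<Rightarrow> 'a \<Rightarrow>\<^sub>C\<^sub>L 'b \<Rightarrow> 'a \<Rightarrow>\<^sub>C\<^sub>L 'b"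
  is blinfun_scaleC
  by (simp add: blinfun_scaleC.rep_eq scaleC_scaleC mult.commute)
lift_definition norm_cblinfun :: "'a \<Rightarrow>\<^sub>C\<^sub>L 'b \<Rightarrow> real" is norm .
definition dist_cblinfun :: "'a \<Rightarrow>\<^sub>C\<^sub>L 'b \<Rightarrow> 'a \<Rightarrow>\<^sub>C\<^sub>L 'b \<Rightarrow> real"
  where "dist_cblinfun f g = norm (f - g)"
definition sgn_cblinfun :: "'a \<Rightarrow>\<^sub>C\<^sub>L 'b \<Rightarrow> 'a \<Rightarrow>\<^sub>C\<^sub>L 'b"
  where "sgn_cblinfun f = inverse (norm f) *\<^sub>R f"
definition uniformity_cblinfun :: "(('a \<Rightarrow>\<^sub>C\<^sub>L 'b) \<times> ('a \<Rightarrow>\<^sub>C\<^sub>L 'b)) filter"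
  where "uniformity_cblinfun = (INF e\<in>{0<..}. principal {(f, g). dist f g < e})"
definition open_cblinfun :: "('a \<Rightarrow>\<^sub>C\<^sub>L 'b) set \<Rightarrow> bool"
  where "open_cblinfun S = (\<forall>f\<in>S. \<forall>\<^sub>F (f', g) in uniformity. f' = f \<longrightarrow> g \<in> S)"

instance
proof
  fix f g h :: "'a \<Rightarrow>\<^sub>C\<^sub>L 'b" and r s :: real and c d :: complex
  show "f + g + h = f + (g + h)" by transfer (simp add: add.assoc)
  show "f + g = g + f" by transfer (simp add: add.commute)
  show "0 + f = f" by transfer simp
  show "- f + f = 0" by transfer simp
  show "f - g = f + - g" by transfer simp
  show "r *\<^sub>R (f + g) = r *\<^sub>R f + r *\<^sub>R g" by transfer (simp add: scaleR_add_right)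
  show "(r + s) *\<^sub>R f = r *\<^sub>R f + s *\<^sub>R f" by transfer (simp add: scaleR_add_left)
  show "r *\<^sub>R s *\<^sub>R f = (r * s) *\<^sub>R f" by transfer simp
  show "1 *\<^sub>R f = f" by transfer simp
  show "r *\<^sub>R f = complex_of_real r *\<^sub>C f"
    by transfer (rule blinfun_eqI, simp add: scaleR_scaleC scaleR_blinfun.rep_eq blinfun_scaleC.rep_eq)
  show "c *\<^sub>C (f + g) = c *\<^sub>C f + c *\<^sub>C g"
    by transfer (rule blinfun_eqI, simp add: plus_blinfun.rep_eq blinfun_scaleC.rep_eq scaleC_add_right)
  show "(c + d) *\<^sub>C f = c *\<^sub>C f + d *\<^sub>C f"
    by transfer (rule blinfun_eqI, simp add: plus_blinfun.rep_eq blinfun_scaleC.rep_eq scaleC_add_left)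
  show "c *\<^sub>C d *\<^sub>C f = (c * d) *\<^sub>C f"
    by transfer (rule blinfun_eqI, simp add: blinfun_scaleC.rep_eq scaleC_scaleC)
  show "norm f = 0 \<longleftrightarrow> f = 0" by transfer simp
  show "norm (f + g) \<le> norm f + norm g" by transfer (rule norm_triangle_ineq)
  show "norm (r *\<^sub>R f) = \<bar>r\<bar> * norm f" by transfer simp
  show "norm (c *\<^sub>C f) = cmod c * norm f"
  proof transfer
    fix c :: complex and f :: "'a \<Rightarrow>\<^sub>L 'b"
    have *: "norm (blinfun_scaleC c f) \<le> cmod c * norm f" for c and f :: "'a \<Rightarrow>\<^sub>L 'b"
      by (rule norm_blinfun_bound)
        (simp_all add: blinfun_scaleC.rep_eq norm_scaleC mult.assoc mult_left_mono norm_blinfun)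
    show "norm (blinfun_scaleC c f) = cmod c * norm f"
    proof (cases "c = 0")
      case True
      then show ?thesis using *[of c f] by simp
    next
      case False
      let ?g = "blinfun_scaleC c f"
      have "f = blinfun_scaleC (inverse c) ?g"
        by (rule blinfun_eqI)
          (use False in \<open>simp add: blinfun_scaleC.rep_eq scaleC_scaleC scaleR_scaleC[of 1, simplified, symmetric]\<close>)
      then have "norm f \<le> cmod (inverse c) * norm ?g"
        using *[of "inverse c" ?g] by simp
      then have "cmod c * norm f \<le> norm ?g"
        using False by (simp add: norm_divide field_simps)
      then show ?thesis using *[of c f] by simp
    qed
  qed
qed (simp_all add: dist_cblinfun_def sgn_cblinfun_def uniformity_cblinfun_def open_cblinfun_def)

end

lift_definition id_cblinfun :: "'a :: complex_normed_vector \<Rightarrow>\<^sub>C\<^sub>L 'a" is id_blinfun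
  by simp

lift_definition cblinfun_compose :: "'b :: complex_normed_vector \<Rightarrow>\<^sub>C\<^sub>L 'c :: complex_normed_vector
    \<Rightarrow> 'a :: complex_normed_vector \<Rightarrow>\<^sub>C\<^sub>L 'b \<Rightarrow> 'a \<Rightarrow>\<^sub>C\<^sub>L 'c" (infixl "o\<^sub>C\<^sub>L" 67)
  is blinfun_compose
  by simp

definition cblinfun_invertible ::
    "'a :: complex_normed_vector \<Rightarrow>\<^sub>C\<^sub>L 'b :: complex_normed_vector \<Rightarrow> bool" where
  "cblinfun_invertible A \<longleftrightarrow> (\<exists>B. A o\<^sub>C\<^sub>L B = id_cblinfun \<and> B o\<^sub>C\<^sub>L A = id_cblinfun)"

text \<open>Unspecified if the operator is not invertible.\<close>

definition cblinfun_inv ::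
    "'a :: complex_normed_vector \<Rightarrow>\<^sub>C\<^sub>L 'b :: complex_normed_vector \<Rightarrow> 'b \<Rightarrow>\<^sub>C\<^sub>L 'a" where
  "cblinfun_inv A = (THE B. A o\<^sub>C\<^sub>L B = id_cblinfun \<and> B o\<^sub>C\<^sub>L A = id_cblinfun)"

lemma cblinfun_inv_unique:
  assumes "A o\<^sub>C\<^sub>L B = id_cblinfun" "B o\<^sub>C\<^sub>L A = id_cblinfun"
  shows "cblinfun_inv A = B"
  unfolding cblinfun_inv_def
proof (rule the_equality)
  fix C assume C: "A o\<^sub>C\<^sub>L C = id_cblinfun \<and> C o\<^sub>C\<^sub>L A = id_cblinfun"
  have "C o\<^sub>C\<^sub>L (A o\<^sub>C\<^sub>L B) = (C o\<^sub>C\<^sub>L A) o\<^sub>C\<^sub>L B"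
    by transfer (rule blinfun_eqI, simp)
  moreover have "C o\<^sub>C\<^sub>L id_cblinfun = C" "id_cblinfun o\<^sub>C\<^sub>L B = B"
    by (transfer, rule blinfun_eqI, simp)+
  ultimately show "C = B" using assms C by simp
qed (use assms in simp)

definition spectrum :: "'a :: complex_normed_vector \<Rightarrow>\<^sub>C\<^sub>L 'a \<Rightarrow> complex set" where
  "spectrum T = {z. \<not> cblinfun_invertible (z *\<^sub>C id_cblinfun - T)}"

definition exponentially_stable :: "'a :: complex_normed_vector \<Rightarrow>\<^sub>C\<^sub>L 'a \<Rightarrow> bool" where
  "exponentially_stable T \<longleftrightarrow> spectrum T \<subseteq> ball 0 1"

text \<open>The formula for \<open>R\<close> is imposed at every point where both resolvents exist. By exponential
  stability these points include the unit circle; 0 is one of them iff \<open>\<alpha>\<^sub>-\<close> is invertible.\<close>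

definition stable_representation ::
    "(complex \<Rightarrow> 'u :: complex_hilbert \<Rightarrow>\<^sub>C\<^sub>L 'u) \<Rightarrow> 'u \<Rightarrow>\<^sub>C\<^sub>L 'u \<Rightarrow>
     'p :: complex_hilbert \<Rightarrow>\<^sub>C\<^sub>L 'p \<Rightarrow> 'u \<Rightarrow>\<^sub>C\<^sub>L 'p \<Rightarrow> 'p \<Rightarrow>\<^sub>C\<^sub>L 'u \<Rightarrow>
     'm :: complex_hilbert \<Rightarrow>\<^sub>C\<^sub>L 'm \<Rightarrow> 'u \<Rightarrow>\<^sub>C\<^sub>L 'm \<Rightarrow> 'm \<Rightarrow>\<^sub>C\<^sub>L 'u \<Rightarrow> bool" where
  "stable_representation R \<delta> \<alpha>\<^sub>p \<beta>\<^sub>p \<gamma>\<^sub>p \<alpha>\<^sub>m \<beta>\<^sub>m \<gamma>\<^sub>m \<longleftrightarrow>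
     exponentially_stable \<alpha>\<^sub>p \<and> exponentially_stable \<alpha>\<^sub>m \<and>
     (\<forall>z. cblinfun_invertible (id_cblinfun - z *\<^sub>C \<alpha>\<^sub>p) \<and>
          cblinfun_invertible (z *\<^sub>C id_cblinfun - \<alpha>\<^sub>m) \<longrightarrow>
        R z = \<delta>
          + z *\<^sub>C (\<gamma>\<^sub>p o\<^sub>C\<^sub>L cblinfun_inv (id_cblinfun - z *\<^sub>C \<alpha>\<^sub>p) o\<^sub>C\<^sub>L \<beta>\<^sub>p)
          + \<gamma>\<^sub>m o\<^sub>C\<^sub>L cblinfun_inv (z *\<^sub>C id_cblinfun - \<alpha>\<^sub>m) o\<^sub>C\<^sub>L \<beta>\<^sub>m)"

lemma stable_representation_at_0:
  assumes "stable_representation R \<delta> \<alpha>\<^sub>p \<beta>\<^sub>p \<gamma>\<^sub>p \<alpha>\<^sub>m \<beta>\<^sub>m \<gamma>\<^sub>m" and "cblinfun_invertible \<alpha>\<^sub>m"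
  shows "R 0 = \<delta> - \<gamma>\<^sub>m o\<^sub>C\<^sub>L cblinfun_inv \<alpha>\<^sub>m o\<^sub>C\<^sub>L \<beta>\<^sub>m"
proof -
  have scale0 [simp]: "0 *\<^sub>C x = 0" for x :: "'x :: complex_vector"
    using scaleC_add_left[of 0 0 x] by simp
  obtain B where B: "\<alpha>\<^sub>m o\<^sub>C\<^sub>L B = id_cblinfun" "B o\<^sub>C\<^sub>L \<alpha>\<^sub>m = id_cblinfun"
    using assms(2) by (auto simp: cblinfun_invertible_def)
  have neg: "- \<alpha>\<^sub>m o\<^sub>C\<^sub>L - B = \<alpha>\<^sub>m o\<^sub>C\<^sub>L B" "- B o\<^sub>C\<^sub>L - \<alpha>\<^sub>m = B o\<^sub>C\<^sub>L \<alpha>\<^sub>m"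
    by (transfer, rule blinfun_eqI, simp add: uminus_blinfun.rep_eq blinfun.minus_right)+
  have inv: "cblinfun_inv (- \<alpha>\<^sub>m) = - B" "cblinfun_invertible (- \<alpha>\<^sub>m)"
    using B neg by (auto intro!: cblinfun_inv_unique simp: cblinfun_invertible_def)
  have one: "id_cblinfun o\<^sub>C\<^sub>L id_cblinfun = (id_cblinfun :: 'b \<Rightarrow>\<^sub>C\<^sub>L 'b)"
    by transfer (rule blinfun_eqI, simp)
  have "cblinfun_invertible (id_cblinfun - 0 *\<^sub>C \<alpha>\<^sub>p)"
    unfolding cblinfun_invertible_def using one by (intro exI[of _ id_cblinfun]) simp
  moreover have "cblinfun_invertible (0 *\<^sub>C id_cblinfun - \<alpha>\<^sub>m)"
    using inv by simp
  ultimately have "R 0 = \<delta> + \<gamma>\<^sub>m o\<^sub>C\<^sub>L - B o\<^sub>C\<^sub>L \<beta>\<^sub>m"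
    using assms(1) inv unfolding stable_representation_def by auto
  also have "\<dots> = \<delta> - \<gamma>\<^sub>m o\<^sub>C\<^sub>L B o\<^sub>C\<^sub>L \<beta>\<^sub>m"
    by transfer (rule blinfun_eqI,
      simp add: uminus_blinfun.rep_eq plus_blinfun.rep_eq minus_blinfun.rep_eq blinfun.minus_right)
  finally show ?thesis using cblinfun_inv_unique[OF B] by simp
qed

definition op_holomorphic_on ::
    "(complex \<Rightarrow> 'a :: complex_normed_vector \<Rightarrow>\<^sub>C\<^sub>L 'b :: complex_normed_vector) \<Rightarrow> complex set \<Rightarrow> bool"
    (infixl "op'_holomorphic'_on" 50) where
  "F op_holomorphic_on S \<longleftrightarrow> (\<forall>z\<in>S. \<exists>D. (F has_derivative (\<lambda>h. h *\<^sub>C D)) (at z within S))"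

definition invertibly_analytic_near ::
    "(complex \<Rightarrow> 'u :: complex_hilbert \<Rightarrow>\<^sub>C\<^sub>L 'u) \<Rightarrow> complex set \<Rightarrow> bool" where
  "invertibly_analytic_near V K \<longleftrightarrow>
     (\<exists>N. open N \<and> K \<subseteq> N \<and> V op_holomorphic_on N \<and> (\<forall>z\<in>N. cblinfun_invertible (V z)) \<and>
       (\<lambda>z. cblinfun_inv (V z)) op_holomorphic_on N)"

definition plus_factor :: "(complex \<Rightarrow> 'u :: complex_hilbert \<Rightarrow>\<^sub>C\<^sub>L 'u) \<Rightarrow> bool" where
  "plus_factor V \<longleftrightarrow> invertibly_analytic_near V (cball 0 1)"

text \<open>Analyticity at \<open>\<infinity>\<close> is expressed in the chart \<open>w = 1/z\<close>; \<open>L\<close> is the value at \<open>\<infinity>\<close>.\<close>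

definition minus_factor :: "(complex \<Rightarrow> 'u :: complex_hilbert \<Rightarrow>\<^sub>C\<^sub>L 'u) \<Rightarrow> bool" where
  "minus_factor V \<longleftrightarrow> invertibly_analytic_near V (- ball 0 1) \<and>
     (\<exists>L. invertibly_analytic_near (\<lambda>w. if w = 0 then L else V (inverse w)) {0})"

definition right_canonical_WH :: "(complex \<Rightarrow> 'u :: complex_hilbert \<Rightarrow>\<^sub>C\<^sub>L 'u) \<Rightarrow> bool" where
  "right_canonical_WH R \<longleftrightarrow>
     (\<exists>V\<^sub>m V\<^sub>p. minus_factor V\<^sub>m \<and> plus_factor V\<^sub>p \<and> (\<forall>z\<in>sphere 0 1. R z = V\<^sub>m z o\<^sub>C\<^sub>L V\<^sub>p z))"

definition left_canonical_WH :: "(complex \<Rightarrow> 'u :: complex_hilbert \<Rightarrow>\<^sub>C\<^sub>L 'u) \<Rightarrow> bool" where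
  "left_canonical_WH R \<longleftrightarrow>
     (\<exists>W\<^sub>p W\<^sub>m. plus_factor W\<^sub>p \<and> minus_factor W\<^sub>m \<and> (\<forall>z\<in>sphere 0 1. R z = W\<^sub>p z o\<^sub>C\<^sub>L W\<^sub>m z))"

definition riccati_solution ::
    "'u :: complex_hilbert \<Rightarrow>\<^sub>C\<^sub>L 'u \<Rightarrow>
     'p :: complex_hilbert \<Rightarrow>\<^sub>C\<^sub>L 'p \<Rightarrow> 'u \<Rightarrow>\<^sub>C\<^sub>L 'p \<Rightarrow> 'p \<Rightarrow>\<^sub>C\<^sub>L 'u \<Rightarrow>
     'm :: complex_hilbert \<Rightarrow>\<^sub>C\<^sub>L 'm \<Rightarrow> 'u \<Rightarrow>\<^sub>C\<^sub>L 'm \<Rightarrow> 'm \<Rightarrow>\<^sub>C\<^sub>L 'u \<Rightarrow>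
     'p \<Rightarrow>\<^sub>C\<^sub>L 'm \<Rightarrow> bool" where
  "riccati_solution \<delta> \<alpha>\<^sub>p \<beta>\<^sub>p \<gamma>\<^sub>p \<alpha>\<^sub>m \<beta>\<^sub>m \<gamma>\<^sub>m Q \<longleftrightarrow>
     cblinfun_invertible (\<delta> - \<gamma>\<^sub>m o\<^sub>C\<^sub>L Q o\<^sub>C\<^sub>L \<beta>\<^sub>p) \<and>
     Q = \<alpha>\<^sub>m o\<^sub>C\<^sub>L Q o\<^sub>C\<^sub>L \<alpha>\<^sub>p
       + (\<beta>\<^sub>m - \<alpha>\<^sub>m o\<^sub>C\<^sub>L Q o\<^sub>C\<^sub>L \<beta>\<^sub>p) o\<^sub>C\<^sub>L cblinfun_inv (\<delta> - \<gamma>\<^sub>m o\<^sub>C\<^sub>L Q o\<^sub>C\<^sub>L \<beta>\<^sub>p)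
           o\<^sub>C\<^sub>L (\<gamma>\<^sub>p - \<gamma>\<^sub>m o\<^sub>C\<^sub>L Q o\<^sub>C\<^sub>L \<alpha>\<^sub>p)"

definition alpha_plus_circ ::
    "'u :: complex_hilbert \<Rightarrow>\<^sub>C\<^sub>L 'u \<Rightarrow>
     'p :: complex_hilbert \<Rightarrow>\<^sub>C\<^sub>L 'p \<Rightarrow> 'u \<Rightarrow>\<^sub>C\<^sub>L 'p \<Rightarrow> 'p \<Rightarrow>\<^sub>C\<^sub>L 'u \<Rightarrow>
     'm :: complex_hilbert \<Rightarrow>\<^sub>C\<^sub>L 'u \<Rightarrow> 'p \<Rightarrow>\<^sub>C\<^sub>L 'm \<Rightarrow> 'p \<Rightarrow>\<^sub>C\<^sub>L 'p" where
  "alpha_plus_circ \<delta> \<alpha>\<^sub>p \<beta>\<^sub>p \<gamma>\<^sub>p \<gamma>\<^sub>m Q =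
     \<alpha>\<^sub>p - \<beta>\<^sub>p o\<^sub>C\<^sub>L cblinfun_inv (\<delta> - \<gamma>\<^sub>m o\<^sub>C\<^sub>L Q o\<^sub>C\<^sub>L \<beta>\<^sub>p) o\<^sub>C\<^sub>L (\<gamma>\<^sub>p - \<gamma>\<^sub>m o\<^sub>C\<^sub>L Q o\<^sub>C\<^sub>L \<alpha>\<^sub>p)"

definition alpha_minus_circ ::
    "'u :: complex_hilbert \<Rightarrow>\<^sub>C\<^sub>L 'u \<Rightarrow> 'u \<Rightarrow>\<^sub>C\<^sub>L 'p :: complex_hilbert \<Rightarrow>
     'm :: complex_hilbert \<Rightarrow>\<^sub>C\<^sub>L 'm \<Rightarrow> 'u \<Rightarrow>\<^sub>C\<^sub>L 'm \<Rightarrow> 'm \<Rightarrow>\<^sub>C\<^sub>L 'u \<Rightarrow>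
     'p \<Rightarrow>\<^sub>C\<^sub>L 'm \<Rightarrow> 'm \<Rightarrow>\<^sub>C\<^sub>L 'm" where
  "alpha_minus_circ \<delta> \<beta>\<^sub>p \<alpha>\<^sub>m \<beta>\<^sub>m \<gamma>\<^sub>m Q =
     \<alpha>\<^sub>m - (\<beta>\<^sub>m - \<alpha>\<^sub>m o\<^sub>C\<^sub>L Q o\<^sub>C\<^sub>L \<beta>\<^sub>p) o\<^sub>C\<^sub>L cblinfun_inv (\<delta> - \<gamma>\<^sub>m o\<^sub>C\<^sub>L Q o\<^sub>C\<^sub>L \<beta>\<^sub>p) o\<^sub>C\<^sub>L \<gamma>\<^sub>m"

definition stabilizing_solution ::
    "'u :: complex_hilbert \<Rightarrow>\<^sub>C\<^sub>L 'u \<Rightarrow>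
     'p :: complex_hilbert \<Rightarrow>\<^sub>C\<^sub>L 'p \<Rightarrow> 'u \<Rightarrow>\<^sub>C\<^sub>L 'p \<Rightarrow> 'p \<Rightarrow>\<^sub>C\<^sub>L 'u \<Rightarrow>
     'm :: complex_hilbert \<Rightarrow>\<^sub>C\<^sub>L 'm \<Rightarrow> 'u \<Rightarrow>\<^sub>C\<^sub>L 'm \<Rightarrow> 'm \<Rightarrow>\<^sub>C\<^sub>L 'u \<Rightarrow>
     'p \<Rightarrow>\<^sub>C\<^sub>L 'm \<Rightarrow> bool" where
  "stabilizing_solution \<delta> \<alpha>\<^sub>p \<beta>\<^sub>p \<gamma>\<^sub>p \<alpha>\<^sub>m \<beta>\<^sub>m \<gamma>\<^sub>m Q \<longleftrightarrow>
     riccati_solution \<delta> \<alpha>\<^sub>p \<beta>\<^sub>p \<gamma>\<^sub>p \<alpha>\<^sub>m \<beta>\<^sub>m \<gamma>\<^sub>m Q \<and>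
     exponentially_stable (alpha_plus_circ \<delta> \<alpha>\<^sub>p \<beta>\<^sub>p \<gamma>\<^sub>p \<gamma>\<^sub>m Q) \<and>
     exponentially_stable (alpha_minus_circ \<delta> \<beta>\<^sub>p \<alpha>\<^sub>m \<beta>\<^sub>m \<gamma>\<^sub>m Q)"

end

theory Submission
  imports Defs "HOL-Complex_Analysis.Cauchy_Integral_Formula"
begin

text \<open>On the unit circle put \<open>w = 1/z\<close>. Write \<open>a\<close> and \<open>b\<close> for the closed-loop operators
  \<open>\<alpha>\<^sub>p\<^sup>\<circ>\<close> and \<open>\<alpha>\<^sub>m\<^sup>\<circ>\<close>, \<open>E\<close> for the inverse of \<open>\<delta> - \<gamma>\<^sub>m Q \<beta>\<^sub>p\<close>, and \<open>M = I - Q Z\<close>, \<open>N = I - Z Q\<close>. Since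
  \<open>R(0)\<close> is invertible, the Lyapunov equation is equivalent to the Stein equation
  \<open>Z = a Z b - \<beta>\<^sub>p E \<gamma>\<^sub>m\<close> (\<open>stein_from_lyapunov\<close>). Together with the Riccati equation this yields
  operators \<open>\<beta>'\<close>, \<open>\<gamma>'\<close> with
  \<open>M b = \<alpha>\<^sub>m M + \<beta>\<^sub>m \<gamma>'\<close> and \<open>a N = N \<alpha>\<^sub>p - \<beta>' \<gamma>\<^sub>p\<close> (\<open>M_b\<close>, \<open>a_N\<close>), and a few companions.

  A product \<open>(D\<^sub>p + z \<gamma>\<^sub>p (I - z \<alpha>\<^sub>p)\<^sup>-\<^sup>1 G) (D\<^sub>m + w H (I - w \<alpha>\<^sub>m)\<^sup>-\<^sup>1 \<beta>\<^sub>m)\<close> equals \<open>R\<close> as soon as some operator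
  \<open>P\<close> satisfies \<open>P - \<alpha>\<^sub>p P \<alpha>\<^sub>m = G H\<close>, \<open>\<beta>\<^sub>p = G D\<^sub>m + \<alpha>\<^sub>p P \<beta>\<^sub>m\<close>, \<open>\<gamma>\<^sub>m = D\<^sub>p H + \<gamma>\<^sub>p P \<alpha>\<^sub>m\<close> and
  \<open>\<delta> = D\<^sub>p D\<^sub>m + \<gamma>\<^sub>p P \<beta>\<^sub>m\<close> (\<open>product_of_realizations\<close>).

  If \<open>M\<close> is invertible, then so is \<open>N\<close>, and \<open>P = - Z M\<^sup>-\<^sup>1\<close>, \<open>G = N\<^sup>-\<^sup>1 \<beta>'\<close>, \<open>D\<^sub>p = I\<close>,
  \<open>D\<^sub>m = \<delta> - \<gamma>\<^sub>p P \<beta>\<^sub>m\<close>, \<open>H = - D\<^sub>m \<gamma>' M\<^sup>-\<^sup>1\<close> satisfy these equations. The intertwining relations show that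
  the inverses of the two factors have state operators similar to \<open>a\<close> and \<open>b\<close>, so stability of \<open>a\<close>
  and \<open>b\<close> makes the factors invertible where they have to be (\<open>left_factorization\<close>). The
  right factorization enters only through the invertibility of \<open>R\<close> on the circle, which gives the
  invertibility of \<open>D\<^sub>m\<close>.

  Conversely, let \<open>R = W\<^sub>p W\<^sub>m\<close> be a left factorization. Splitting \<open>W\<^sub>p\<^sup>-\<^sup>1 \<gamma>\<^sub>m (I - w \<alpha>\<^sub>m)\<^sup>-\<^sup>1\<close> and
  \<open>(I - z \<alpha>\<^sub>p)\<^sup>-\<^sup>1 \<beta>\<^sub>p W\<^sub>m\<^sup>-\<^sup>1\<close> into parts analytic inside and outside the disc (\<open>split_right\<close>,
  \<open>split_left\<close>, from a Cauchy transform) produces \<open>H\<close> and \<open>G\<close>, and Liouville's theorem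
  (\<open>disc_analytic_Liouville\<close>) shows that the factors have the form displayed above and that the four
  equations hold for some \<open>P\<close>. The differences \<open>N P + Z\<close> and \<open>P M + Z\<close> then solve
  homogeneous Stein equations \<open>X = a X c\<close> and \<open>X = d X b\<close>, where \<open>c\<close> and \<open>d\<close> are the state operators of
  \<open>W\<^sub>m\<^sup>-\<^sup>1\<close> and \<open>W\<^sub>p\<^sup>-\<^sup>1\<close>. All four are stable, so both differences vanish (\<open>stein_unique\<close>), and
  \<open>I - Q P\<close> is a two-sided inverse of \<open>M\<close> (\<open>M_invertible\<close>).\<close>

section \<open>The Banach space of bounded operators\<close>

lemma cblinfun_eqI: "(\<And>x. cblinfun_apply A x = cblinfun_apply B x) \<Longrightarrow> A = B"
  by transfer (rule blinfun_eqI)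

lemma cblinfun_apply_compose [simp]:
  "cblinfun_apply (A o\<^sub>C\<^sub>L B) x = cblinfun_apply A (cblinfun_apply B x)"
  by transfer simp

lemma cblinfun_apply_id [simp]: "cblinfun_apply id_cblinfun x = x"
  by transfer simp

lemma cblinfun_apply_scaleC: "cblinfun_apply A (c *\<^sub>C x) = c *\<^sub>C cblinfun_apply A x"
  by transfer simp

lemma cblinfun_apply_ops [simp]:
  "cblinfun_apply (A + B) x = cblinfun_apply A x + cblinfun_apply B x"
  "cblinfun_apply (A - B) x = cblinfun_apply A x - cblinfun_apply B x"
  "cblinfun_apply (- A) x = - cblinfun_apply A x"
  "cblinfun_apply 0 x = 0"
  "cblinfun_apply (r *\<^sub>R A) x = r *\<^sub>R cblinfun_apply A x"
  "cblinfun_apply (c *\<^sub>C A) x = c *\<^sub>C cblinfun_apply A x"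
  by (transfer, simp add: plus_blinfun.rep_eq minus_blinfun.rep_eq uminus_blinfun.rep_eq
      scaleR_blinfun.rep_eq blinfun_scaleC.rep_eq)+

lemma cblinfun_apply_linear [simp]:
  "cblinfun_apply A (x + y) = cblinfun_apply A x + cblinfun_apply A y"
  "cblinfun_apply A (x - y) = cblinfun_apply A x - cblinfun_apply A y"
  "cblinfun_apply A (- x) = - cblinfun_apply A x"
  "cblinfun_apply A 0 = 0"
  "cblinfun_apply A (r *\<^sub>R x) = r *\<^sub>R cblinfun_apply A x"
  by (transfer, simp add: blinfun.bilinear_simps)+

lemma norm_cblinfun_apply: "norm (cblinfun_apply A x) \<le> norm A * norm x"
  by transfer (rule norm_blinfun)

lemma norm_cblinfun_compose: "norm (A o\<^sub>C\<^sub>L B) \<le> norm A * norm B"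
  by transfer (rule norm_blinfun_compose)

lemma bounded_bilinear_cblinfun_compose:
  "bounded_bilinear ((o\<^sub>C\<^sub>L) :: 'b :: complex_normed_vector \<Rightarrow>\<^sub>C\<^sub>L 'c :: complex_normed_vector
    \<Rightarrow> 'a :: complex_normed_vector \<Rightarrow>\<^sub>C\<^sub>L 'b \<Rightarrow> 'a \<Rightarrow>\<^sub>C\<^sub>L 'c)"
proof
  fix A A' :: "'b \<Rightarrow>\<^sub>C\<^sub>L 'c" and B B' :: "'a \<Rightarrow>\<^sub>C\<^sub>L 'b" and r
  show "(A + A') o\<^sub>C\<^sub>L B = (A o\<^sub>C\<^sub>L B) + (A' o\<^sub>C\<^sub>L B)" by (rule cblinfun_eqI) simp
  show "A o\<^sub>C\<^sub>L (B + B') = (A o\<^sub>C\<^sub>L B) + (A o\<^sub>C\<^sub>L B')" by (rule cblinfun_eqI) simp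
  show "(r *\<^sub>R A) o\<^sub>C\<^sub>L B = r *\<^sub>R (A o\<^sub>C\<^sub>L B)" by (rule cblinfun_eqI) simp
  show "A o\<^sub>C\<^sub>L (r *\<^sub>R B) = r *\<^sub>R (A o\<^sub>C\<^sub>L B)" by (rule cblinfun_eqI) simp
  show "\<exists>K. \<forall>(A :: 'b \<Rightarrow>\<^sub>C\<^sub>L 'c) (B :: 'a \<Rightarrow>\<^sub>C\<^sub>L 'b). norm (A o\<^sub>C\<^sub>L B) \<le> norm A * norm B * K"
    by (rule exI[of _ 1]) (simp add: norm_cblinfun_compose)
qed

interpretation compose: bounded_bilinear "(o\<^sub>C\<^sub>L)"
  by (rule bounded_bilinear_cblinfun_compose)

lemma compose_assoc: "A o\<^sub>C\<^sub>L B o\<^sub>C\<^sub>L C = A o\<^sub>C\<^sub>L (B o\<^sub>C\<^sub>L C)"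
  by (rule cblinfun_eqI) simp

lemma compose_id [simp]: "A o\<^sub>C\<^sub>L id_cblinfun = A" "id_cblinfun o\<^sub>C\<^sub>L A = A"
  by (rule cblinfun_eqI, simp)+

lemma compose_scaleC: "(c *\<^sub>C A) o\<^sub>C\<^sub>L B = c *\<^sub>C (A o\<^sub>C\<^sub>L B)" "A o\<^sub>C\<^sub>L (c *\<^sub>C B) = c *\<^sub>C (A o\<^sub>C\<^sub>L B)"
  by (rule cblinfun_eqI, simp add: cblinfun_apply_scaleC)+

text \<open>Used as a simp set, these equations write any expression in composition, addition and
  multiplication by complex numbers as a sum of scalar multiples of right-associated words.\<close>

lemmas compose_expand = compose_assoc compose.add_left compose.add_right compose.diff_left compose.diff_right
  compose.minus_left compose.minus_right compose.zero_left compose.zero_right compose_scaleC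
  scaleC_add_right scaleC_diff_right scaleC_minus_right scaleC_scaleC

lemma scaleC_one [simp]: "1 *\<^sub>C (x :: 'a :: complex_vector) = x"
  using scaleR_scaleC[of 1 x] by simp

lemma scaleC_zero_left [simp]: "0 *\<^sub>C (x :: 'a :: complex_vector) = 0"
  using scaleR_scaleC[of 0 x] by simp

lemma bounded_bilinear_scaleC:
  "bounded_bilinear ((*\<^sub>C) :: complex \<Rightarrow> 'a :: complex_normed_vector \<Rightarrow> 'a)"
proof
  fix c d :: complex and x y :: 'a and r
  show "(c + d) *\<^sub>C x = c *\<^sub>C x + d *\<^sub>C x" by (rule scaleC_add_left)
  show "c *\<^sub>C (x + y) = c *\<^sub>C x + c *\<^sub>C y" by (rule scaleC_add_right)
  show "(r *\<^sub>R c) *\<^sub>C x = r *\<^sub>R c *\<^sub>C x" 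
    by (simp add: scaleR_scaleC[of r "c *\<^sub>C x"] scaleC_scaleC scaleR_conv_of_real)
  show "c *\<^sub>C r *\<^sub>R x = r *\<^sub>R c *\<^sub>C x"
    by (simp add: scaleR_scaleC scaleC_scaleC mult.commute)
  show "\<exists>K. \<forall>c (x :: 'a). norm (c *\<^sub>C x) \<le> norm c * norm x * K"
    by (rule exI[of _ 1]) (simp add: norm_scaleC)
qed

interpretation scaleC: bounded_bilinear "(*\<^sub>C) :: complex \<Rightarrow> 'a :: complex_normed_vector \<Rightarrow> 'a"
  by (rule bounded_bilinear_scaleC)

text \<open>A limit of complex-linear operators in the real operator space is again complex-linear, so the
  complex-linear operators into a Banach space form a Banach space.\<close>

instance cblinfun :: (complex_normed_vector, "{complex_normed_vector, banach}") banach
proof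
  fix X :: "nat \<Rightarrow> 'a \<Rightarrow>\<^sub>C\<^sub>L 'b"
  assume X: "Cauchy X"
  have dist: "dist (Rep_cblinfun A) (Rep_cblinfun B) = dist A B" for A B :: "'a \<Rightarrow>\<^sub>C\<^sub>L 'b"
    by (simp add: dist_norm norm_cblinfun.rep_eq minus_cblinfun.rep_eq)
  have "Cauchy (\<lambda>n. Rep_cblinfun (X n))"
    using X by (simp add: Cauchy_def dist)
  then obtain f where f: "(\<lambda>n. Rep_cblinfun (X n)) \<longlonglongrightarrow> f"
    by (meson Cauchy_convergent convergent_def)
  have "blinfun_apply f (c *\<^sub>C x) = c *\<^sub>C blinfun_apply f x" for c x
  proof (rule LIMSEQ_unique)
    show "(\<lambda>n. blinfun_apply (Rep_cblinfun (X n)) (c *\<^sub>C x)) \<longlonglongrightarrow> blinfun_apply f (c *\<^sub>C x)"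
      by (intro tendsto_intros f)
    have "(\<lambda>n. c *\<^sub>C blinfun_apply (Rep_cblinfun (X n)) x) \<longlonglongrightarrow> c *\<^sub>C blinfun_apply f x"
      by (intro tendsto_intros f scaleC.tendsto)
    then show "(\<lambda>n. blinfun_apply (Rep_cblinfun (X n)) (c *\<^sub>C x)) \<longlonglongrightarrow> c *\<^sub>C blinfun_apply f x"
      using Rep_cblinfun by (simp add: cblinfun_apply.rep_eq[symmetric] cblinfun_apply_scaleC)
  qed
  then have "Rep_cblinfun (Abs_cblinfun f) = f"
    by (simp add: Abs_cblinfun_inverse)
  then have "X \<longlonglongrightarrow> Abs_cblinfun f"
    using f by (simp add: lim_sequentially flip: dist)
  then show "convergent X" by (auto simp: convergent_def)
qed

section \<open>Invertible operators\<close>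

lemma cblinfun_inv_works:
  assumes "cblinfun_invertible A"
  shows "A o\<^sub>C\<^sub>L cblinfun_inv A = id_cblinfun" "cblinfun_inv A o\<^sub>C\<^sub>L A = id_cblinfun"
  using assms cblinfun_inv_unique unfolding cblinfun_invertible_def by metis+

lemma invertibleI:
  "A o\<^sub>C\<^sub>L B = id_cblinfun \<Longrightarrow> B o\<^sub>C\<^sub>L A = id_cblinfun \<Longrightarrow> cblinfun_invertible A"
  unfolding cblinfun_invertible_def by blast

lemma inv_cancel:
  assumes "cblinfun_invertible A"
  shows "A o\<^sub>C\<^sub>L (cblinfun_inv A o\<^sub>C\<^sub>L B) = B" "cblinfun_inv A o\<^sub>C\<^sub>L (A o\<^sub>C\<^sub>L C) = C"
  using cblinfun_inv_works[OF assms] by (simp_all flip: compose_assoc)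

lemma invertible_inv: "cblinfun_invertible A \<Longrightarrow> cblinfun_invertible (cblinfun_inv A)"
  using cblinfun_inv_works invertibleI by blast

lemma invertible_id: "cblinfun_invertible id_cblinfun"
  by (rule invertibleI[of _ id_cblinfun]) simp_all

lemma invertible_comp:
  assumes "cblinfun_invertible A" "cblinfun_invertible B"
  shows "cblinfun_invertible (A o\<^sub>C\<^sub>L B)"
  by (rule invertibleI[of _ "cblinfun_inv B o\<^sub>C\<^sub>L cblinfun_inv A"])
    (simp_all add: compose_assoc inv_cancel assms cblinfun_inv_works)

lemma invertible_scaleC:
  assumes "cblinfun_invertible A" "c \<noteq> 0"
  shows "cblinfun_invertible (c *\<^sub>C A)"
  by (rule invertibleI[of _ "inverse c *\<^sub>C cblinfun_inv A"])
    (simp_all add: compose_expand assms cblinfun_inv_works)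

lemma left_right_inverse:
  assumes "A o\<^sub>C\<^sub>L B = id_cblinfun" "C o\<^sub>C\<^sub>L A = id_cblinfun"
  shows "cblinfun_invertible A"
proof -
  have "C = C o\<^sub>C\<^sub>L (A o\<^sub>C\<^sub>L B)" using assms by simp
  also have "\<dots> = C o\<^sub>C\<^sub>L A o\<^sub>C\<^sub>L B" by (simp add: compose_assoc)
  finally have "C = B" using assms by simp
  then show ?thesis using assms by (auto intro: invertibleI)
qed

text \<open>The Neumann series in fixed-point form: the two one-sided inverses of \<open>I - T\<close> are the fixed
  points of the contractions \<open>X \<mapsto> I + TX\<close> and \<open>Y \<mapsto> I + YT\<close>.\<close>

lemma invertible_id_minus:
  fixes T :: "'a :: {complex_normed_vector, banach} \<Rightarrow>\<^sub>C\<^sub>L 'a"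
  assumes "norm T < 1"
  shows "cblinfun_invertible (id_cblinfun - T)"
proof -
  have "\<exists>!X. id_cblinfun + T o\<^sub>C\<^sub>L X = X"
  proof (rule banach_fix_type[of "norm T"]; (intro allI)?)
    fix X Y :: "'a \<Rightarrow>\<^sub>C\<^sub>L 'a"
    show "dist (id_cblinfun + (T o\<^sub>C\<^sub>L X)) (id_cblinfun + (T o\<^sub>C\<^sub>L Y)) \<le> norm T * dist X Y"
      using norm_cblinfun_compose by (simp add: dist_norm flip: compose.diff_right)
  qed (use assms in auto)
  then obtain X where X: "id_cblinfun + T o\<^sub>C\<^sub>L X = X" by auto
  have "\<exists>!Y. id_cblinfun + Y o\<^sub>C\<^sub>L T = Y"
  proof (rule banach_fix_type[of "norm T"]; (intro allI)?)
    fix X Y :: "'a \<Rightarrow>\<^sub>C\<^sub>L 'a"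
    have "norm ((X - Y) o\<^sub>C\<^sub>L T) \<le> norm T * norm (X - Y)"
      using norm_cblinfun_compose[of "X - Y" T] by (simp add: mult.commute)
    then show "dist (id_cblinfun + (X o\<^sub>C\<^sub>L T)) (id_cblinfun + (Y o\<^sub>C\<^sub>L T)) \<le> norm T * dist X Y"
      by (simp add: dist_norm compose.diff_left)
  qed (use assms in auto)
  then obtain Y where Y: "id_cblinfun + Y o\<^sub>C\<^sub>L T = Y" by auto
  show ?thesis
  proof (rule left_right_inverse)
    show "(id_cblinfun - T) o\<^sub>C\<^sub>L X = id_cblinfun"
      unfolding compose.diff_left compose_id using X by (metis add_diff_cancel_right')
    show "Y o\<^sub>C\<^sub>L (id_cblinfun - T) = id_cblinfun"
      unfolding compose.diff_right compose_id using Y by (metis add_diff_cancel_right')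
  qed
qed

text \<open>For invertible \<open>A\<close> and \<open>D\<close>, the two Schur complements of the block operator with rows
  \<open>(A, - B)\<close> and \<open>(C, D)\<close> are invertible together. This is how zeros of a realized function are read off from its state
  operators.\<close>

lemma invertible_woodbury:
  fixes A :: "'x :: complex_normed_vector \<Rightarrow>\<^sub>C\<^sub>L 'x" and D :: "'u :: complex_normed_vector \<Rightarrow>\<^sub>C\<^sub>L 'u"
  assumes A: "cblinfun_invertible A" and D: "cblinfun_invertible D"
    and S: "cblinfun_invertible (D + C o\<^sub>C\<^sub>L cblinfun_inv A o\<^sub>C\<^sub>L B)"
  shows "cblinfun_invertible (A + B o\<^sub>C\<^sub>L cblinfun_inv D o\<^sub>C\<^sub>L C)"
proof -
  define S where "S = D + C o\<^sub>C\<^sub>L cblinfun_inv A o\<^sub>C\<^sub>L B"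
  define T where "T = cblinfun_inv S"
  have inv: "S o\<^sub>C\<^sub>L T = id_cblinfun" "T o\<^sub>C\<^sub>L S = id_cblinfun"
    using cblinfun_inv_works assms(3) by (simp_all add: S_def T_def)
  have CAB: "C o\<^sub>C\<^sub>L (cblinfun_inv A o\<^sub>C\<^sub>L B) = S - D"
    by (simp add: S_def compose_assoc)
  have CAB': "C o\<^sub>C\<^sub>L (cblinfun_inv A o\<^sub>C\<^sub>L (B o\<^sub>C\<^sub>L X)) = (S - D) o\<^sub>C\<^sub>L X" for X :: "'y :: complex_normed_vector \<Rightarrow>\<^sub>C\<^sub>L 'u"
    by (simp add: CAB[symmetric] compose_assoc)
  have inv': "S o\<^sub>C\<^sub>L (T o\<^sub>C\<^sub>L X) = X" "T o\<^sub>C\<^sub>L (S o\<^sub>C\<^sub>L X) = X" for X :: "'y :: complex_normed_vector \<Rightarrow>\<^sub>C\<^sub>L 'u"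
    using inv by (simp_all flip: compose_assoc)
  show ?thesis
    by (rule invertibleI[of _ "cblinfun_inv A - cblinfun_inv A o\<^sub>C\<^sub>L B o\<^sub>C\<^sub>L T o\<^sub>C\<^sub>L C o\<^sub>C\<^sub>L cblinfun_inv A"])
      (simp_all add: compose_expand CAB CAB' inv' inv_cancel cblinfun_inv_works A D)
qed

text \<open>Invertibility is stable under small perturbations, with a bound on the inverse that is uniform
  in the perturbation.\<close>

lemma invertible_near:
  fixes A B :: "'a :: {complex_normed_vector, banach} \<Rightarrow>\<^sub>C\<^sub>L 'a"
  assumes A: "cblinfun_invertible A" and near: "norm (B - A) * norm (cblinfun_inv A) \<le> 1/2"
  shows "cblinfun_invertible B" "norm (cblinfun_inv B) \<le> 2 * norm (cblinfun_inv A)"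
proof -
  have "norm (cblinfun_inv A o\<^sub>C\<^sub>L (A - B)) < 1"
    using norm_cblinfun_compose[of "cblinfun_inv A" "A - B"] near
    by (simp add: mult.commute norm_minus_commute)
  then have "cblinfun_invertible (A o\<^sub>C\<^sub>L (id_cblinfun - cblinfun_inv A o\<^sub>C\<^sub>L (A - B)))"
    by (intro invertible_comp A invertible_id_minus)
  then show B: "cblinfun_invertible B"
    by (simp add: compose_expand inv_cancel A)
  have "cblinfun_inv B = cblinfun_inv A - cblinfun_inv B o\<^sub>C\<^sub>L (B - A) o\<^sub>C\<^sub>L cblinfun_inv A"
    by (simp add: compose_expand inv_cancel cblinfun_inv_works A B)
  then have "norm (cblinfun_inv B) \<le> norm (cblinfun_inv A) + norm (cblinfun_inv B o\<^sub>C\<^sub>L (B - A) o\<^sub>C\<^sub>L cblinfun_inv A)"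
    by (metis norm_triangle_ineq4)
  also have "norm (cblinfun_inv B o\<^sub>C\<^sub>L (B - A) o\<^sub>C\<^sub>L cblinfun_inv A)
      \<le> norm (cblinfun_inv B) * (norm (B - A) * norm (cblinfun_inv A))"
    unfolding compose_assoc
    by (intro order_trans[OF norm_cblinfun_compose] mult_left_mono norm_cblinfun_compose norm_ge_zero)
  also have "\<dots> \<le> norm (cblinfun_inv B) * (1/2)"
    by (intro mult_left_mono near norm_ge_zero)
  finally show "norm (cblinfun_inv B) \<le> 2 * norm (cblinfun_inv A)" by simp
qed

lemma mult_le_half:
  fixes a x :: real
  assumes "0 \<le> a" "0 \<le> x" "x < 1 / (2 * (a + 1))"
  shows "x * a \<le> 1/2"
proof -
  have "x * (2 * (a + 1)) < 1"
    using assms(1,3) by (subst (asm) pos_less_divide_eq) auto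
  moreover have "x * (2 * (a + 1)) = 2 * (x * a) + 2 * x" by (simp add: algebra_simps)
  ultimately show ?thesis using assms by linarith
qed

lemma has_derivative_cblinfun_inv:
  fixes A :: "'a :: {complex_normed_vector, banach} \<Rightarrow>\<^sub>C\<^sub>L 'a"
  assumes A: "cblinfun_invertible A"
  shows "(cblinfun_inv has_derivative (\<lambda>H. - (cblinfun_inv A o\<^sub>C\<^sub>L H o\<^sub>C\<^sub>L cblinfun_inv A))) (at A)"
proof -
  define e where "e = 1 / (2 * (norm (cblinfun_inv A) + 1))"
  have e: "e > 0" by (simp add: e_def add_nonneg_pos)
  show ?thesis
  proof (rule has_derivativeI_sandwich[OF e, where H = "\<lambda>B. 2 * norm (cblinfun_inv A) ^ 3 * norm (B - A)"])
    show "bounded_linear (\<lambda>H. - (cblinfun_inv A o\<^sub>C\<^sub>L H o\<^sub>C\<^sub>L cblinfun_inv A))"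
      by (intro bounded_linear_minus bounded_linear_compose[OF compose.bounded_linear_left]
          compose.bounded_linear_right)
    fix B assume B: "B \<noteq> A" "dist B A < e"
    have near: "norm (B - A) * norm (cblinfun_inv A) \<le> 1/2"
      using B by (intro mult_le_half) (simp_all add: dist_norm e_def)
    note B' = invertible_near[OF A near]
    let ?Y = "(B - A) o\<^sub>C\<^sub>L cblinfun_inv A"
    have "cblinfun_inv B - cblinfun_inv A - - (cblinfun_inv A o\<^sub>C\<^sub>L (B - A) o\<^sub>C\<^sub>L cblinfun_inv A)
      = cblinfun_inv B o\<^sub>C\<^sub>L (?Y o\<^sub>C\<^sub>L ?Y)"
      by (simp add: compose_expand inv_cancel cblinfun_inv_works A B')
    also have "norm \<dots> \<le> norm (cblinfun_inv B) * ((norm (B - A) * norm (cblinfun_inv A)) * (norm (B - A) * norm (cblinfun_inv A)))"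
      by (intro order_trans[OF norm_cblinfun_compose] mult_left_mono norm_ge_zero mult_mono
          norm_cblinfun_compose mult_nonneg_nonneg)
    also have "\<dots> \<le> (2 * norm (cblinfun_inv A)) * ((norm (B - A) * norm (cblinfun_inv A)) * (norm (B - A) * norm (cblinfun_inv A)))"
      using B' by (intro mult_right_mono) auto
    also have "\<dots> = 2 * norm (cblinfun_inv A) ^ 3 * norm (B - A) * norm (B - A)"
      by (simp add: power3_eq_cube algebra_simps)
    finally show "norm (cblinfun_inv B - cblinfun_inv A - - (cblinfun_inv A o\<^sub>C\<^sub>L (B - A) o\<^sub>C\<^sub>L cblinfun_inv A)) / norm (B - A)
        \<le> 2 * norm (cblinfun_inv A) ^ 3 * norm (B - A)"
      using B by (simp add: divide_le_eq)
  next
    show "((\<lambda>B. 2 * norm (cblinfun_inv A) ^ 3 * norm (B - A)) \<longlongrightarrow> 0) (at A)"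
      by (auto intro!: tendsto_eq_intros)
  qed
qed

lemma open_invertible: "open {A :: 'a :: {complex_normed_vector, banach} \<Rightarrow>\<^sub>C\<^sub>L 'a. cblinfun_invertible A}"
  unfolding open_dist
proof safe
  fix A :: "'a \<Rightarrow>\<^sub>C\<^sub>L 'a" assume A: "cblinfun_invertible A"
  define e where "e = 1 / (2 * (norm (cblinfun_inv A) + 1))"
  have e: "e > 0" by (simp add: e_def add_nonneg_pos)
  have "cblinfun_invertible B" if B: "dist B A < e" for B
    using B by (intro invertible_near(1)[OF A] mult_le_half) (simp_all add: dist_norm e_def)
  then show "\<exists>e>0. \<forall>B. dist B A < e \<longrightarrow> B \<in> Collect cblinfun_invertible"
    using e by auto
qed

section \<open>Operator-valued analytic functions\<close>

lemma op_holomorphic_on_subset: "F op_holomorphic_on S \<Longrightarrow> T \<subseteq> S \<Longrightarrow> F op_holomorphic_on T"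
  unfolding op_holomorphic_on_def by (meson has_derivative_subset subset_iff)

lemma op_holomorphic_on_imp_continuous_on: "F op_holomorphic_on S \<Longrightarrow> continuous_on S F"
  unfolding op_holomorphic_on_def continuous_on_eq_continuous_within
  using has_derivative_continuous by blast

lemma op_holomorphic_on_const: "(\<lambda>z. A) op_holomorphic_on S"
  unfolding op_holomorphic_on_def by (auto intro!: exI[of _ 0])

lemma op_holomorphic_on_add:
  assumes "F op_holomorphic_on S" "G op_holomorphic_on S"
  shows "(\<lambda>z. F z + G z) op_holomorphic_on S"
  unfolding op_holomorphic_on_def
proof
  fix z assume z: "z \<in> S"
  then obtain D E where "(F has_derivative (\<lambda>h. h *\<^sub>C D)) (at z within S)"
    "(G has_derivative (\<lambda>h. h *\<^sub>C E)) (at z within S)"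
    using assms unfolding op_holomorphic_on_def by blast
  then have "((\<lambda>z. F z + G z) has_derivative (\<lambda>h. h *\<^sub>C (D + E))) (at z within S)"
    by (auto intro!: derivative_eq_intros simp: scaleC_add_right)
  then show "\<exists>D. ((\<lambda>z. F z + G z) has_derivative (\<lambda>h. h *\<^sub>C D)) (at z within S)" by blast
qed

lemma op_holomorphic_on_compose:
  assumes "F op_holomorphic_on S" "G op_holomorphic_on S"
  shows "(\<lambda>z. F z o\<^sub>C\<^sub>L G z) op_holomorphic_on S"
  unfolding op_holomorphic_on_def
proof
  fix z assume z: "z \<in> S"
  then obtain D E where "(F has_derivative (\<lambda>h. h *\<^sub>C D)) (at z within S)"
    "(G has_derivative (\<lambda>h. h *\<^sub>C E)) (at z within S)"
    using assms unfolding op_holomorphic_on_def by blast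
  from compose.FDERIV[OF this]
  have "((\<lambda>z. F z o\<^sub>C\<^sub>L G z) has_derivative (\<lambda>h. h *\<^sub>C (F z o\<^sub>C\<^sub>L E + D o\<^sub>C\<^sub>L G z))) (at z within S)"
    by (simp add: compose_expand)
  then show "\<exists>D. ((\<lambda>z. F z o\<^sub>C\<^sub>L G z) has_derivative (\<lambda>h. h *\<^sub>C D)) (at z within S)" by blast
qed

lemma op_holomorphic_on_scaleC:
  assumes f: "f holomorphic_on S" and F: "F op_holomorphic_on S"
  shows "(\<lambda>z. f z *\<^sub>C F z) op_holomorphic_on S"
  unfolding op_holomorphic_on_def
proof
  fix z assume z: "z \<in> S"
  obtain D where D: "(F has_derivative (\<lambda>h. h *\<^sub>C D)) (at z within S)"
    using F z unfolding op_holomorphic_on_def by blast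
  obtain d where d: "(f has_derivative ((*) d)) (at z within S)"
    using f z unfolding holomorphic_on_def field_differentiable_def has_field_derivative_def by blast
  from scaleC.FDERIV[OF d D]
  have "((\<lambda>z. f z *\<^sub>C F z) has_derivative (\<lambda>h. h *\<^sub>C (f z *\<^sub>C D + d *\<^sub>C F z))) (at z within S)"
    by (simp add: compose_expand mult.commute)
  then show "\<exists>D. ((\<lambda>z. f z *\<^sub>C F z) has_derivative (\<lambda>h. h *\<^sub>C D)) (at z within S)" by blast
qed

lemma op_holomorphic_on_inv:
  fixes F :: "complex \<Rightarrow> 'a :: {complex_normed_vector, banach} \<Rightarrow>\<^sub>C\<^sub>L 'a"
  assumes "F op_holomorphic_on S" "\<And>z. z \<in> S \<Longrightarrow> cblinfun_invertible (F z)"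
  shows "(\<lambda>z. cblinfun_inv (F z)) op_holomorphic_on S"
  unfolding op_holomorphic_on_def
proof
  fix z assume z: "z \<in> S"
  then obtain D where D: "(F has_derivative (\<lambda>h. h *\<^sub>C D)) (at z within S)"
    using assms unfolding op_holomorphic_on_def by blast
  from has_derivative_compose[OF this has_derivative_cblinfun_inv] z assms
  have "((\<lambda>z. cblinfun_inv (F z)) has_derivative
      (\<lambda>h. h *\<^sub>C - (cblinfun_inv (F z) o\<^sub>C\<^sub>L D o\<^sub>C\<^sub>L cblinfun_inv (F z)))) (at z within S)"
    by (simp add: compose_expand)
  then show "\<exists>D. ((\<lambda>z. cblinfun_inv (F z)) has_derivative (\<lambda>h. h *\<^sub>C D)) (at z within S)" by blast
qed

lemma op_holomorphic_on_holomorphic_compose: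
  assumes f: "f holomorphic_on S" and F: "F op_holomorphic_on T" and "f ` S \<subseteq> T"
  shows "(\<lambda>z. F (f z)) op_holomorphic_on S"
  unfolding op_holomorphic_on_def
proof
  fix z assume z: "z \<in> S"
  obtain d where d: "(f has_derivative ((*) d)) (at z within S)"
    using f z unfolding holomorphic_on_def field_differentiable_def has_field_derivative_def by blast
  obtain D where D: "(F has_derivative (\<lambda>h. h *\<^sub>C D)) (at (f z) within T)"
    using F z assms(3) unfolding op_holomorphic_on_def by blast
  from has_derivative_in_compose[OF d has_derivative_subset[OF D assms(3)]]
  have "((\<lambda>z. F (f z)) has_derivative (\<lambda>h. h *\<^sub>C (d *\<^sub>C D))) (at z within S)"
    by (simp add: compose_expand mult.commute)
  then show "\<exists>D. ((\<lambda>z. F (f z)) has_derivative (\<lambda>h. h *\<^sub>C D)) (at z within S)" by blast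
qed

lemma op_holomorphic_on_Un:
  assumes "F op_holomorphic_on S" "F op_holomorphic_on T" "open S" "open T"
  shows "F op_holomorphic_on (S \<union> T)"
  unfolding op_holomorphic_on_def
proof
  fix z assume z: "z \<in> S \<union> T"
  have "\<exists>D. (F has_derivative (\<lambda>h. h *\<^sub>C D)) (at z)"
    using z assms at_within_open[of z S] at_within_open[of z T]
    unfolding op_holomorphic_on_def by (metis Un_iff)
  then show "\<exists>D. (F has_derivative (\<lambda>h. h *\<^sub>C D)) (at z within S \<union> T)"
    using has_derivative_at_withinI by blast
qed

section \<open>Matrix coefficients\<close>

lemma cinner_zero_left [simp]: "cinner 0 y = 0"
  using cinner_add_left[of 0 0 y] by simp

lemma cinner_diff_left: "cinner (x - y) z = cinner x z - cinner y z"
  using cinner_add_left[of "x - y" y z] by (simp add: algebra_simps)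

lemma cinner_scaleC_right: "cinner x (c *\<^sub>C y) = cnj c * cinner x y"
  by (metis cinner_commute cinner_scaleC_left complex_cnj_mult)

lemma cinner_diff_right: "cinner x (y - z) = cinner x y - cinner x z"
  by (metis cinner_commute cinner_diff_left complex_cnj_diff)

text \<open>The Cauchy--Schwarz inequality.\<close>

lemma norm_cinner_le: "norm (cinner x y) \<le> norm x * norm y"
proof (cases "y = 0")
  case True
  then show ?thesis using cinner_commute[of x 0] by simp
next
  case False
  \<comment> \<open>\<open>c *\<^sub>C y\<close> is the orthogonal projection of \<open>x\<close> onto
    the span of \<open>y\<close>.\<close>
  define c where "c = cinner x y / (norm y)\<^sup>2"
  have "complex_of_real ((norm (x - c *\<^sub>C y))\<^sup>2) = cinner (x - c *\<^sub>C y) (x - c *\<^sub>C y)"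
    by (rule cinner_self[symmetric])
  also have "\<dots> = cinner x x - cnj c * cinner x y - c * cinner y x + c * cnj c * cinner y y"
    by (simp add: cinner_diff_left cinner_diff_right cinner_scaleC_left
        cinner_scaleC_right algebra_simps)
  also have "\<dots> = complex_of_real ((norm x)\<^sup>2 - (norm (cinner x y))\<^sup>2 / (norm y)\<^sup>2)"
  proof -
    have yx: "cinner y x = cnj (cinner x y)" by (rule cinner_commute)
    have "cinner x y * cnj (cinner x y) = complex_of_real ((norm (cinner x y))\<^sup>2)"
      by (rule complex_norm_square[symmetric])
    then show ?thesis
      using False unfolding cinner_self yx c_def
      by (simp add: field_simps power2_eq_square)
  qed
  finally have "(norm (x - c *\<^sub>C y))\<^sup>2 = (norm x)\<^sup>2 - (norm (cinner x y))\<^sup>2 / (norm y)\<^sup>2"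
    using of_real_eq_iff by blast
  then have "(norm (cinner x y))\<^sup>2 / (norm y)\<^sup>2 \<le> (norm x)\<^sup>2"
    by (metis diff_ge_0_iff_ge zero_le_power2)
  then have "(norm (cinner x y))\<^sup>2 \<le> (norm x * norm y)\<^sup>2"
    using False by (simp add: divide_le_eq power_mult_distrib)
  then show ?thesis by (rule power2_le_imp_le) simp
qed

text \<open>The matrix coefficient \<open>\<langle>A x, y\<rangle>\<close> of an operator. These functionals are bounded and
  complex-linear in \<open>A\<close> and separate operators, so identities for operator-valued analytic
  functions reduce to the scalar Cauchy theory.\<close>

definition matrix_coeff :: "'a :: complex_normed_vector \<Rightarrow> 'b :: complex_hilbert \<Rightarrow> ('a \<Rightarrow>\<^sub>C\<^sub>L 'b) \<Rightarrow> complex"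
  where "matrix_coeff x y A = cinner (cblinfun_apply A x) y"

lemma bounded_linear_matrix_coeff: "bounded_linear (matrix_coeff x y)"
proof (rule bounded_linear_intro[where K = "norm x * norm y"])
  fix A B :: "'a \<Rightarrow>\<^sub>C\<^sub>L 'b" and r
  show "matrix_coeff x y (A + B) = matrix_coeff x y A + matrix_coeff x y B"
    by (simp add: matrix_coeff_def cinner_add_left)
  show "matrix_coeff x y (r *\<^sub>R A) = r *\<^sub>R matrix_coeff x y A"
    unfolding matrix_coeff_def cblinfun_apply_ops
    by (simp add: scaleR_scaleC[of r "cblinfun_apply A x"] cinner_scaleC_left scaleR_conv_of_real)
  have "norm (matrix_coeff x y A) \<le> norm (cblinfun_apply A x) * norm y"
    unfolding matrix_coeff_def by (rule norm_cinner_le)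
  also have "\<dots> \<le> (norm A * norm x) * norm y"
    by (intro mult_right_mono norm_cblinfun_apply norm_ge_zero)
  finally show "norm (matrix_coeff x y A) \<le> norm A * (norm x * norm y)"
    by (simp add: mult.assoc)
qed

lemma matrix_coeff_scaleC: "matrix_coeff x y (c *\<^sub>C A) = c * matrix_coeff x y A"
  by (simp add: matrix_coeff_def cinner_scaleC_left)

lemma matrix_coeff_eqI:
  assumes "\<And>x y. matrix_coeff x y A = matrix_coeff x y B"
  shows "A = B"
proof (rule cblinfun_eqI)
  fix x
  let ?d = "cblinfun_apply A x - cblinfun_apply B x"
  have "cinner ?d ?d = 0"
    using assms[of x ?d] by (simp add: matrix_coeff_def cinner_diff_left)
  then show "cblinfun_apply A x = cblinfun_apply B x"
    by (simp add: cinner_self)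
qed

lemma matrix_coeff_holomorphic:
  assumes "F op_holomorphic_on S"
  shows "(\<lambda>z. matrix_coeff x y (F z)) holomorphic_on S"
  unfolding holomorphic_on_def field_differentiable_def has_field_derivative_def
proof
  fix z assume "z \<in> S"
  then obtain D where "(F has_derivative (\<lambda>h. h *\<^sub>C D)) (at z within S)"
    using assms unfolding op_holomorphic_on_def by blast
  from bounded_linear.has_derivative[OF bounded_linear_matrix_coeff this]
  have "((\<lambda>z. matrix_coeff x y (F z)) has_derivative (\<lambda>h. h * matrix_coeff x y D)) (at z within S)"
    by (simp add: matrix_coeff_scaleC)
  then have "((\<lambda>z. matrix_coeff x y (F z)) has_derivative (*) (matrix_coeff x y D)) (at z within S)"
    by (rule has_derivative_eq_rhs) (simp add: fun_eq_iff mult.commute)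
  then show "\<exists>d. ((\<lambda>z. matrix_coeff x y (F z)) has_derivative (*) d) (at z within S)" by blast
qed

section \<open>Circle integrals\<close>

lemma circlepath_norm [simp]: "0 < r \<Longrightarrow> norm (circlepath 0 r t) = r"
  by (simp add: circlepath norm_mult)

text \<open>Cauchy's integral formula in terms of the normalized arc length of the circle. The factor \<open>\<zeta>\<close>
  in the numerator comes from \<open>d\<zeta> = 2 \<pi> \<i> \<zeta> dt\<close>.\<close>

lemma has_integral_cauchy:
  assumes f: "f holomorphic_on cball 0 r" and z: "norm z < r"
  shows "((\<lambda>t. circlepath 0 r t / (circlepath 0 r t - z) * f (circlepath 0 r t)) has_integral f z) {0..1}"
proof -
  define k where "k = 2 * of_real pi * \<i>"
  have k: "k \<noteq> 0" by (simp add: k_def)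
  \<comment> \<open>The speed of the parametrization is \<open>k\<close> times the position.\<close>
  have vd: "vector_derivative (circlepath 0 r) (at t within {0..1}) = k * circlepath 0 r t"
    if "t \<in> {0..1}" for t
    using that vector_derivative_circlepath01[of t 0 r] by (simp add: k_def fun_cong[OF circlepath, of 0 r t])
  have "((\<lambda>u. f u / (u - z)) has_contour_integral (k * f z)) (circlepath 0 r)"
    using Cauchy_integral_circlepath_simple[OF f, of z] z by (simp add: k_def)
  then have "((\<lambda>t. f (circlepath 0 r t) / (circlepath 0 r t - z)
      * vector_derivative (circlepath 0 r) (at t within {0..1})) has_integral k * f z) {0..1}"
    by (simp add: has_contour_integral_def)
  from has_integral_mult_right[OF this, of "inverse k"]
  have "((\<lambda>t. inverse k * (f (circlepath 0 r t) / (circlepath 0 r t - z)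
      * vector_derivative (circlepath 0 r) (at t within {0..1}))) has_integral f z) {0..1}"
    using k by (simp flip: mult.assoc)
  then show ?thesis
    by (rule has_integral_eq[rotated]) (simp add: vd k)
qed

lemma open_cball_enlarge:
  assumes "open N" "cball (0 :: complex) 1 \<subseteq> N"
  obtains r where "r > 1" "cball 0 r \<subseteq> N"
proof -
  obtain e where e: "e > 0" "(\<Union>x\<in>cball (0 :: complex) 1. ball x e) \<subseteq> N"
    using compact_subset_open_imp_ball_epsilon_subset[of "cball (0 :: complex) 1" N] assms by auto
  have "cball 0 (1 + e/2) \<subseteq> N"
  proof
    fix y :: complex assume y: "y \<in> cball 0 (1 + e/2)"
    show "y \<in> N"
    proof (cases "norm y \<le> 1")
      case True
      then show ?thesis using assms by auto
    next
      case False
      then have ny: "inverse (norm y) * norm y = 1" by (intro left_inverse) auto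
      have "inverse (norm y) \<le> 1" using False by (simp add: inverse_le_1_iff)
      then have abs_le: "\<bar>inverse (norm y) - 1\<bar> = 1 - inverse (norm y)" by linarith
      have "dist (y /\<^sub>R norm y) y = norm (y /\<^sub>R norm y - y)" by (simp add: dist_norm)
      also have "y /\<^sub>R norm y - y = (inverse (norm y) - 1) *\<^sub>R y" by (simp add: algebra_simps)
      also have "norm \<dots> = (1 - inverse (norm y)) * norm y"
        unfolding norm_scaleR abs_le ..
      also have "\<dots> = norm y - 1" by (simp only: left_diff_distrib ny mult_1)
      also have "\<dots> < e" using y e by auto
      finally have "y \<in> ball (y /\<^sub>R norm y) e" by simp
      moreover have "y /\<^sub>R norm y \<in> cball 0 1" by (simp add: norm_sgn flip: sgn_div_norm)
      ultimately show ?thesis using e by blast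
    qed
  qed
  then show ?thesis using that[of "1 + e/2"] e by simp
qed

text \<open>Liouville's theorem on the Riemann sphere, in two charts: \<open>f\<close> is the function inside the
  disc, and \<open>g\<close> is the function outside in the coordinate \<open>w = 1/z\<close>. Both sides are the integral of
  the same function over the circle: Cauchy's formula at \<open>z\<close> for \<open>f\<close>, and the mean value
  property at \<open>w = 0\<close> for \<open>g w / (1 - z w)\<close>.\<close>

lemma holomorphic_Liouville_sphere:
  assumes f: "f holomorphic_on N" "open N" "cball 0 1 \<subseteq> N"
    and g: "g holomorphic_on M" "open M" "cball 0 1 \<subseteq> M"
    and eq: "\<And>z. norm z = 1 \<Longrightarrow> f z = g (inverse z)" and z: "norm z < 1"
  shows "f z = g 0"
proof -
  let ?e = "circlepath 0 1"
  have e: "?e t \<noteq> 0" "?e (1 - t) = inverse (?e t)" "?e t \<noteq> z" for t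
  proof -
    show "?e t \<noteq> 0" by (simp add: circlepath)
    show "?e (1 - t) = inverse (?e t)"
      by (simp add: circlepath exp_diff exp_minus algebra_simps) (simp add: inverse_eq_divide)
    show "?e t \<noteq> z" using z circlepath_norm[of 1 t] by auto
  qed
  have 1: "((\<lambda>t. ?e t / (?e t - z) * f (?e t)) has_integral f z) {0..1}"
    using f z by (intro has_integral_cauchy) (auto intro: holomorphic_on_subset)
  have nz: "1 - z * w \<noteq> 0" if "norm w \<le> 1" for w
  proof
    assume "1 - z * w = 0"
    then have "norm z * norm w = 1" by (metis eq_iff_diff_eq_0 norm_mult norm_one)
    moreover have "norm z * norm w \<le> norm z * 1" using that by (intro mult_left_mono) auto
    ultimately show False using z by simp
  qed
  have "((\<lambda>t. ?e t / (?e t - 0) * (g (?e t) / (1 - z * ?e t))) has_integral g 0 / (1 - z * 0)) {0..1}"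
    using g nz by (intro has_integral_cauchy) (auto intro!: holomorphic_intros intro: holomorphic_on_subset)
  then have "((\<lambda>t. g (?e t) / (1 - z * ?e t)) has_integral g 0) (cbox 0 1)"
    using e by simp
  from has_integral_affinity[OF this, of "-1" 1]
  have "((\<lambda>t. g (?e (1 - t)) / (1 - z * ?e (1 - t))) has_integral g 0) {0..1}"
    by simp
  moreover have "g (?e (1 - t)) / (1 - z * ?e (1 - t)) = ?e t / (?e t - z) * f (?e t)" for t
  proof -
    have "1 - z * inverse (?e t) = (?e t - z) / ?e t" using e by (simp add: field_simps)
    then show ?thesis unfolding e(2) using eq[of "?e t"] by simp
  qed
  ultimately have "((\<lambda>t. ?e t / (?e t - z) * f (?e t)) has_integral g 0) {0..1}"
    by simp
  with 1 show ?thesis by (rule has_integral_unique)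
qed

lemma has_integral_op_cauchy:
  fixes F :: "complex \<Rightarrow> 'a :: complex_normed_vector \<Rightarrow>\<^sub>C\<^sub>L 'b :: complex_hilbert"
  assumes F: "F op_holomorphic_on cball 0 r" and z: "norm z < r"
  shows "((\<lambda>t. (circlepath 0 r t / (circlepath 0 r t - z)) *\<^sub>C F (circlepath 0 r t)) has_integral F z) {0..1}"
proof -
  let ?e = "circlepath 0 r"
  let ?f = "\<lambda>t. (?e t / (?e t - z)) *\<^sub>C F (?e t)"
  have r: "r > 0" using z norm_ge_zero[of z] by linarith
  have nz: "?e t \<noteq> z" for t using z r circlepath_norm[of r t] by auto
  have e: "continuous_on {0..1} ?e"
    unfolding circlepath by (intro continuous_intros)
  have "continuous_on {0..1} (\<lambda>t. F (?e t))"
    by (rule continuous_on_compose2[OF op_holomorphic_on_imp_continuous_on[OF F] e]) (use r in auto)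
  then have "continuous_on {0..1} ?f"
    using nz by (intro continuous_intros scaleC.continuous_on e) auto
  then have int: "?f integrable_on {0..1}"
    by (rule integrable_continuous_real)
  have "integral {0..1} ?f = F z"
  proof (rule matrix_coeff_eqI)
    fix x y
    have "matrix_coeff x y (integral {0..1} ?f) = integral {0..1} (matrix_coeff x y \<circ> ?f)"
      by (rule integral_linear[OF int bounded_linear_matrix_coeff, symmetric])
    also have "\<dots> = matrix_coeff x y (F z)"
      using has_integral_cauchy[OF matrix_coeff_holomorphic[OF F] z, of x y]
      by (intro integral_unique) (simp add: o_def matrix_coeff_scaleC)
    finally show "matrix_coeff x y (integral {0..1} ?f) = matrix_coeff x y (F z)" .
  qed
  then show ?thesis using int by (simp add: has_integral_integrable_integral)
qed

text \<open>The Cauchy transform of a continuous function on a circle is analytic inside. The difference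
  quotient is estimated directly from
  \<open>1/(\<zeta> - y) - 1/(\<zeta> - z) - (y - z)/(\<zeta> - z)\<^sup>2 = (y - z)\<^sup>2/((\<zeta> - y)(\<zeta> - z)\<^sup>2)\<close>.\<close>

lemma op_holomorphic_cauchy_transform:
  fixes \<Phi> :: "complex \<Rightarrow> 'a :: complex_normed_vector \<Rightarrow>\<^sub>C\<^sub>L 'b :: complex_hilbert"
  assumes r: "r > 0" and \<Phi>: "continuous_on (sphere 0 r) \<Phi>"
  shows "(\<lambda>z. integral {0..1} (\<lambda>t. (circlepath 0 r t / (circlepath 0 r t - z)) *\<^sub>C \<Phi> (circlepath 0 r t)))
    op_holomorphic_on ball 0 r"
  unfolding op_holomorphic_on_def
proof
  let ?e = "circlepath 0 r"
  let ?K = "\<lambda>z. integral {0..1} (\<lambda>t. (?e t / (?e t - z)) *\<^sub>C \<Phi> (?e t))"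
  fix z :: complex assume z: "z \<in> ball 0 r"
  have e: "continuous_on {0..1} ?e"
    unfolding circlepath by (intro continuous_intros)
  have cont: "continuous_on {0..1} (\<lambda>t. \<Phi> (?e t))"
    by (rule continuous_on_compose2[OF \<Phi> e]) (use r in auto)
  have "bounded (\<Phi> ` sphere 0 r)"
    by (intro compact_imp_bounded compact_continuous_image \<Phi> compact_sphere)
  then obtain b where b: "b > 0" "\<And>\<zeta>. norm \<zeta> = r \<Longrightarrow> norm (\<Phi> \<zeta>) \<le> b"
    unfolding bounded_pos by auto
  have ne: "?e t \<noteq> y" if "norm y < r" for y :: complex and t using that r circlepath_norm[of r t] by auto
  have int: "(\<lambda>t. f (?e t) *\<^sub>C \<Phi> (?e t)) integrable_on {0..1}" if "continuous_on (sphere 0 r) f" for f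
    by (intro integrable_continuous_real scaleC.continuous_on cont continuous_on_compose2[OF that e])
      (use r in auto)
  have cf: "continuous_on (sphere 0 r) (\<lambda>\<zeta>. \<zeta> / (\<zeta> - y))" if "norm y < r" for y :: complex
    using that by (auto intro!: continuous_intros)
  have cf2: "continuous_on (sphere 0 r) (\<lambda>\<zeta>. \<zeta> / (\<zeta> - z)\<^sup>2)"
    using z by (auto intro!: continuous_intros)
  define D where "D = integral {0..1} (\<lambda>t. (?e t / (?e t - z)\<^sup>2) *\<^sub>C \<Phi> (?e t))"
  define d where "d = r - norm z"
  have d: "d > 0" using z by (simp add: d_def)
  define c where "c = r * (2 / d ^ 3) * b"
  have "(?K has_derivative (\<lambda>h. h *\<^sub>C D)) (at z within ball 0 r)"
  proof (rule has_derivativeI_sandwich[where e = "d / 2" and H = "\<lambda>y. c * norm (y - z)"])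
    fix y assume y: "y \<in> ball 0 r" "y \<noteq> z" "dist y z < d / 2"
    define g where "g = (\<lambda>\<zeta>. \<zeta> / (\<zeta> - y) - \<zeta> / (\<zeta> - z) - (y - z) * (\<zeta> / (\<zeta> - z)\<^sup>2))"
    have cg: "continuous_on (sphere 0 r) g"
      unfolding g_def using y z by (intro continuous_intros cf cf2) auto
    have "?K y - ?K z - (y - z) *\<^sub>C D = integral {0..1} (\<lambda>t. g (?e t) *\<^sub>C \<Phi> (?e t))"
    proof -
      have "(y - z) *\<^sub>C D = integral {0..1} (\<lambda>t. (y - z) *\<^sub>C ((?e t / (?e t - z)\<^sup>2) *\<^sub>C \<Phi> (?e t)))"
        unfolding D_def using integral_linear[OF int[OF cf2] bounded_linear_scaleC[of "y - z"]]
        by (simp add: o_def)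
      moreover have "(\<lambda>t. (y - z) *\<^sub>C ((?e t / (?e t - z)\<^sup>2) *\<^sub>C \<Phi> (?e t))) integrable_on {0..1}"
        using integrable_linear[OF int[OF cf2] bounded_linear_scaleC[of "y - z"]] by (simp add: o_def)
      ultimately show ?thesis
        using int[OF cf, of y] int[OF cf, of z] y z
        by (simp add: g_def scaleC.diff_left scaleC_scaleC integrable_diff
            flip: Henstock_Kurzweil_Integration.integral_diff)
    qed
    also have "norm \<dots> \<le> c * norm (y - z) ^ 2 * (1 - 0)"
    proof (rule integral_bound)
      show "continuous_on {0..1} (\<lambda>t. g (?e t) *\<^sub>C \<Phi> (?e t))"
        by (intro scaleC.continuous_on cont continuous_on_compose2[OF cg e]) (use r in auto)
      fix t
      let ?w = "?e t"
      have w: "norm ?w = r" using r by simp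
      have w1: "d \<le> norm (?w - z)" using norm_triangle_ineq2[of ?w z] w by (simp add: d_def)
      have w2: "d / 2 \<le> norm (?w - y)"
        using norm_triangle_ineq[of "?w - y" "y - z"] w1 y by (simp add: dist_norm)
      have "?w - y \<noteq> 0" "?w - z \<noteq> 0" using ne y z by auto
      then have "g ?w = ?w * (y - z)\<^sup>2 / ((?w - y) * (?w - z)\<^sup>2)"
        by (simp add: g_def divide_simps) (simp add: power2_eq_square algebra_simps)
      then have "norm (g ?w) = r * (norm (y - z))\<^sup>2 / (norm (?w - y) * (norm (?w - z))\<^sup>2)"
        by (simp add: norm_mult norm_divide norm_power w)
      also have "\<dots> \<le> r * (norm (y - z))\<^sup>2 / ((d / 2) * d\<^sup>2)"
        using d r w1 w2 by (intro frac_le mult_mono power_mono mult_nonneg_nonneg) auto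
      also have "\<dots> = r * (2 / d ^ 3) * (norm (y - z))\<^sup>2"
        by (simp add: power3_eq_cube power2_eq_square mult_ac)
      finally have "norm (g ?w) * norm (\<Phi> ?w) \<le> r * (2 / d ^ 3) * (norm (y - z))\<^sup>2 * b"
        using b(2)[OF w] d r by (intro mult_mono) auto
      then show "norm (g ?w *\<^sub>C \<Phi> ?w) \<le> c * norm (y - z) ^ 2"
        by (simp add: norm_scaleC c_def mult_ac)
    qed simp
    finally show "norm (?K y - ?K z - (y - z) *\<^sub>C D) / norm (y - z) \<le> c * norm (y - z)"
      using y by (simp add: divide_le_eq power2_eq_square mult.assoc)
  next
    show "((\<lambda>y. c * norm (y - z)) \<longlongrightarrow> 0) (at z within ball 0 r)"
      by (auto intro!: tendsto_eq_intros)
  qed (use d scaleC.bounded_linear_left in auto)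
  then show "\<exists>D. (?K has_derivative (\<lambda>h. h *\<^sub>C D)) (at z within ball 0 r)" by blast
qed

text \<open>Think of \<open>T\<close> as composition with an operator \<open>\<alpha>\<close>, from the left or from the right, so that on
  the circle \<open>\<Phi>\<close> is the composition of \<open>F\<close> with the resolvent of \<open>\<alpha>\<close>. The Cauchy transform
  \<open>K\<close> of \<open>\<Phi>\<close> is its part analytic inside the circle, and it differs from \<open>\<Phi>\<close> by a constant
  composed with the resolvent, because \<open>(z - T) \<Phi> \<zeta> = F \<zeta> - (\<zeta> - z) \<Phi> \<zeta>\<close>.\<close>

lemma cauchy_split:
  fixes F :: "complex \<Rightarrow> 'a :: complex_normed_vector \<Rightarrow>\<^sub>C\<^sub>L 'b :: complex_hilbert"
  assumes F: "F op_holomorphic_on cball 0 r" and r: "r > 0"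
    and \<Phi>: "continuous_on (sphere 0 r) \<Phi>"
    and T: "bounded_linear T" "\<And>c A. T (c *\<^sub>C A) = c *\<^sub>C T A"
    and eq: "\<And>\<zeta>. norm \<zeta> = r \<Longrightarrow> T (\<Phi> \<zeta>) = \<zeta> *\<^sub>C \<Phi> \<zeta> - F \<zeta>"
  obtains H K where "K op_holomorphic_on ball 0 r"
    "\<And>z. norm z < r \<Longrightarrow> z *\<^sub>C K z - T (K z) = F z - H"
proof -
  let ?e = "circlepath 0 r"
  define H where "H = integral {0..1} (\<lambda>t. ?e t *\<^sub>C \<Phi> (?e t))"
  define K where "K = (\<lambda>z. integral {0..1} (\<lambda>t. (?e t / (?e t - z)) *\<^sub>C \<Phi> (?e t)))"
  have e: "continuous_on {0..1} ?e"
    unfolding circlepath by (intro continuous_intros)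
  have cont: "continuous_on {0..1} (\<lambda>t. \<Phi> (?e t))"
    by (rule continuous_on_compose2[OF \<Phi> e]) (use r in auto)
  have H: "((\<lambda>t. ?e t *\<^sub>C \<Phi> (?e t)) has_integral H) {0..1}"
    unfolding H_def by (intro integrable_integral integrable_continuous_real scaleC.continuous_on e cont)
  show ?thesis
  proof (rule that)
    show "K op_holomorphic_on ball 0 r"
      unfolding K_def by (rule op_holomorphic_cauchy_transform[OF r \<Phi>])
    fix z :: complex assume z: "norm z < r"
    have ne: "?e t \<noteq> z" for t using z r circlepath_norm[of r t] by auto
    have K: "((\<lambda>t. (?e t / (?e t - z)) *\<^sub>C \<Phi> (?e t)) has_integral K z) {0..1}"
      unfolding K_def using ne
      by (intro integrable_integral integrable_continuous_real scaleC.continuous_on cont continuous_intros e) auto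
    \<comment> \<open>Applied under the integral, \<open>?L\<close> produces the Cauchy formula for
      \<open>F\<close> and the constant \<open>H\<close>.\<close>
    let ?L = "\<lambda>A. z *\<^sub>C A - T A"
    have "bounded_linear ?L"
      by (intro bounded_linear_sub bounded_linear_scaleC T)
    from has_integral_linear[OF K this]
    have "((\<lambda>t. ?L ((?e t / (?e t - z)) *\<^sub>C \<Phi> (?e t))) has_integral ?L (K z)) {0..1}"
      by (simp add: o_def)
    moreover have "?L ((?e t / (?e t - z)) *\<^sub>C \<Phi> (?e t))
        = (?e t / (?e t - z)) *\<^sub>C F (?e t) - ?e t *\<^sub>C \<Phi> (?e t)" for t
    proof -
      let ?a = "?e t / (?e t - z)"
      have "?L (?a *\<^sub>C \<Phi> (?e t)) = ?a *\<^sub>C F (?e t) + (z * ?a - ?a * ?e t) *\<^sub>C \<Phi> (?e t)"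
        using eq[of "?e t"] r by (simp add: T(2) scaleC_diff_right scaleC_scaleC scaleC.diff_left)
      also have "z * ?a - ?a * ?e t = - ?e t"
        using ne[of t] by (simp add: divide_simps) (simp add: algebra_simps)
      finally show ?thesis by (simp add: scaleC.minus_left)
    qed
    moreover have "((\<lambda>t. (?e t / (?e t - z)) *\<^sub>C F (?e t) - ?e t *\<^sub>C \<Phi> (?e t)) has_integral F z - H) {0..1}"
      by (intro has_integral_diff has_integral_op_cauchy F z H)
    ultimately show "?L (K z) = F z - H"
      by (simp add: has_integral_unique)
  qed
qed

section \<open>Functions analytic near the closed disc and Wiener-Hopf factors\<close>

text \<open>Analyticity on some neighbourhood of the closed unit disc. Functions analytic outside the disc,
  including \<open>\<infinity>\<close>, are represented by such functions of \<open>w = 1/z\<close>.\<close>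

definition disc_analytic :: "(complex \<Rightarrow> 'a :: complex_normed_vector \<Rightarrow>\<^sub>C\<^sub>L 'b :: complex_normed_vector) \<Rightarrow> bool"
  where "disc_analytic F \<longleftrightarrow> (\<exists>N. open N \<and> cball 0 1 \<subseteq> N \<and> F op_holomorphic_on N)"

lemma disc_analytic_const: "disc_analytic (\<lambda>z. A)"
  unfolding disc_analytic_def using op_holomorphic_on_const open_UNIV by blast

lemma disc_analytic_binary:
  assumes "disc_analytic F" "disc_analytic G"
    and "\<And>N. F op_holomorphic_on N \<Longrightarrow> G op_holomorphic_on N \<Longrightarrow> H op_holomorphic_on N"
  shows "disc_analytic H"
proof -
  obtain N M where "open N" "cball 0 1 \<subseteq> N" "F op_holomorphic_on N"
    "open M" "cball 0 1 \<subseteq> M" "G op_holomorphic_on M"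
    using assms(1,2) unfolding disc_analytic_def by blast
  then have "open (N \<inter> M)" "cball 0 1 \<subseteq> N \<inter> M" "H op_holomorphic_on (N \<inter> M)"
    using assms(3)[of "N \<inter> M"] by (auto intro: op_holomorphic_on_subset)
  then show ?thesis unfolding disc_analytic_def by blast
qed

lemma disc_analytic_add:
  "disc_analytic F \<Longrightarrow> disc_analytic G \<Longrightarrow> disc_analytic (\<lambda>z. F z + G z)"
  by (erule (1) disc_analytic_binary) (rule op_holomorphic_on_add)

lemma disc_analytic_compose:
  "disc_analytic F \<Longrightarrow> disc_analytic G \<Longrightarrow> disc_analytic (\<lambda>z. F z o\<^sub>C\<^sub>L G z)"
  by (erule (1) disc_analytic_binary) (rule op_holomorphic_on_compose)

lemma disc_analytic_times_z: "disc_analytic F \<Longrightarrow> disc_analytic (\<lambda>z. z *\<^sub>C F z)"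
  by (rule disc_analytic_binary[of F F]) (auto intro!: op_holomorphic_on_scaleC holomorphic_intros)

lemma disc_analytic_diff:
  assumes "disc_analytic F" "disc_analytic G"
  shows "disc_analytic (\<lambda>z. F z - G z)"
  using disc_analytic_add[OF assms(1) disc_analytic_compose[OF disc_analytic_const[of "- id_cblinfun"] assms(2)]]
  by (simp add: compose_expand)

lemmas disc_analytic_intros = disc_analytic_const disc_analytic_add disc_analytic_diff
  disc_analytic_compose disc_analytic_times_z

lemma disc_analytic_Liouville:
  fixes F :: "complex \<Rightarrow> 'a :: complex_normed_vector \<Rightarrow>\<^sub>C\<^sub>L 'b :: complex_hilbert"
  assumes F: "disc_analytic F" and G: "disc_analytic G"
    and eq: "\<And>z w. norm z = 1 \<Longrightarrow> z * w = 1 \<Longrightarrow> F z = G w" and z: "norm z \<le> 1"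
  shows "F z = G 0"
proof -
  obtain N where N: "open N" "cball 0 1 \<subseteq> N" "F op_holomorphic_on N"
    using F unfolding disc_analytic_def by blast
  obtain M where M: "open M" "cball 0 1 \<subseteq> M" "G op_holomorphic_on M"
    using G unfolding disc_analytic_def by blast
  have eq': "F z = G (inverse z)" if "norm z = 1" for z
    using that by (intro eq right_inverse) auto
  have ball: "F z = G 0" if "z \<in> ball 0 1" for z
  proof (rule matrix_coeff_eqI)
    fix x y
    show "matrix_coeff x y (F z) = matrix_coeff x y (G 0)"
      by (rule holomorphic_Liouville_sphere[OF matrix_coeff_holomorphic[OF N(3)] N(1,2) matrix_coeff_holomorphic[OF M(3)] M(1,2)])
        (use eq' that in auto)
  qed
  have "continuous_on (closure (ball 0 1)) F"
    using op_holomorphic_on_imp_continuous_on[OF N(3)] N(2) by (auto intro: continuous_on_subset)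
  from continuous_constant_on_closure[OF this ball] show ?thesis
    using z by simp
qed

text \<open>For a function analytic near the closed disc, invertibility on the closed disc is enough: the
  invertible operators form an open set, on which inversion is differentiable.\<close>

lemma plus_factorI:
  assumes V: "disc_analytic V" and inv: "\<And>z. norm z \<le> 1 \<Longrightarrow> cblinfun_invertible (V z)"
  shows "plus_factor V"
proof -
  obtain N where N: "open N" "cball 0 1 \<subseteq> N" "V op_holomorphic_on N"
    using V unfolding disc_analytic_def by blast
  let ?N = "V -` {A. cblinfun_invertible A} \<inter> N"
  have "open ?N"
    using op_holomorphic_on_imp_continuous_on[OF N(3)] N(1) open_invertible
    by (metis continuous_on_open_vimage)
  moreover have "cball 0 1 \<subseteq> ?N" using N inv by auto
  moreover have V': "V op_holomorphic_on ?N" using N(3) by (rule op_holomorphic_on_subset) auto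
  moreover have "(\<lambda>z. cblinfun_inv (V z)) op_holomorphic_on ?N"
    by (rule op_holomorphic_on_inv[OF V']) auto
  ultimately show ?thesis
    unfolding plus_factor_def invertibly_analytic_near_def by (intro exI[of _ ?N]) auto
qed

lemma plus_factorD:
  assumes "plus_factor V"
  shows "disc_analytic V" "disc_analytic (\<lambda>z. cblinfun_inv (V z))"
    "norm z \<le> 1 \<Longrightarrow> cblinfun_invertible (V z)"
  using assms unfolding plus_factor_def invertibly_analytic_near_def disc_analytic_def
  by (blast, blast, auto)

lemma op_holomorphic_on_transform:
  assumes "F op_holomorphic_on S" "\<And>z. z \<in> S \<Longrightarrow> G z = F z"
  shows "G op_holomorphic_on S"
  unfolding op_holomorphic_on_def
proof
  fix z assume z: "z \<in> S"
  then obtain D where "(F has_derivative (\<lambda>h. h *\<^sub>C D)) (at z within S)"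
    using assms(1) unfolding op_holomorphic_on_def by blast
  then have "(G has_derivative (\<lambda>h. h *\<^sub>C D)) (at z within S)"
    by (rule has_derivative_transform[OF z, rotated]) (rule assms(2))
  then show "\<exists>D. (G has_derivative (\<lambda>h. h *\<^sub>C D)) (at z within S)" by blast
qed

lemma invertibly_analytic_near_Un:
  assumes "invertibly_analytic_near V K" "invertibly_analytic_near V L"
  shows "invertibly_analytic_near V (K \<union> L)"
proof -
  obtain N M where N: "open N" "K \<subseteq> N" "V op_holomorphic_on N" "\<forall>z\<in>N. cblinfun_invertible (V z)"
      "(\<lambda>z. cblinfun_inv (V z)) op_holomorphic_on N"
    and M: "open M" "L \<subseteq> M" "V op_holomorphic_on M" "\<forall>z\<in>M. cblinfun_invertible (V z)"
      "(\<lambda>z. cblinfun_inv (V z)) op_holomorphic_on M"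
    using assms unfolding invertibly_analytic_near_def by blast
  show ?thesis
    unfolding invertibly_analytic_near_def
    by (rule exI[of _ "N \<union> M"]) (use N M in \<open>auto intro!: op_holomorphic_on_Un\<close>)
qed

lemma invertibly_analytic_near_inverse:
  assumes "invertibly_analytic_near V K" and K: "0 \<notin> inverse ` K' " "inverse ` K' \<subseteq> K"
    and W: "\<And>w. w \<noteq> 0 \<Longrightarrow> W w = V (inverse w)"
  shows "invertibly_analytic_near W K'"
proof -
  obtain N where N: "open N" "K \<subseteq> N" "V op_holomorphic_on N" "\<forall>z\<in>N. cblinfun_invertible (V z)"
      "(\<lambda>z. cblinfun_inv (V z)) op_holomorphic_on N"
    using assms(1) unfolding invertibly_analytic_near_def by blast
  let ?N = "- {0 :: complex} \<inter> inverse -` N"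
  have ho: "inverse holomorphic_on ?N" by (auto intro!: holomorphic_intros)
  have "open ?N"
    using N(1) by (intro continuous_open_preimage) (auto intro!: continuous_intros)
  moreover have "K' \<subseteq> ?N"
    using K N(2) by auto
  moreover have eq: "G op_holomorphic_on ?N" if "H op_holomorphic_on N" "\<And>w. w \<noteq> 0 \<Longrightarrow> G w = H (inverse w)"
    for G H :: "complex \<Rightarrow> 'a \<Rightarrow>\<^sub>C\<^sub>L 'a"
  proof -
    have "(\<lambda>w. H (inverse w)) op_holomorphic_on ?N"
      by (rule op_holomorphic_on_holomorphic_compose[OF ho that(1)]) auto
    then show ?thesis
      by (rule op_holomorphic_on_transform) (use that(2) in auto)
  qed
  ultimately show ?thesis
    unfolding invertibly_analytic_near_def using N W
    by (intro exI[of _ ?N] conjI eq[OF N(3)] eq[OF N(5)]) auto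
qed

lemma invertibly_analytic_near_subset:
  "invertibly_analytic_near V K \<Longrightarrow> L \<subseteq> K \<Longrightarrow> invertibly_analytic_near V L"
  unfolding invertibly_analytic_near_def by blast

text \<open>In the chart \<open>w = 1/z\<close> a minus factor is the same thing as a plus factor.\<close>

lemma minus_factor_iff:
  "minus_factor V \<longleftrightarrow> (\<exists>L. plus_factor (\<lambda>w. if w = 0 then L else V (inverse w)))"
proof safe
  assume "minus_factor V"
  then obtain L where V: "invertibly_analytic_near V (- ball 0 1)"
    and L: "invertibly_analytic_near (\<lambda>w. if w = 0 then L else V (inverse w)) {0}"
    unfolding minus_factor_def by blast
  have "invertibly_analytic_near (\<lambda>w. if w = 0 then L else V (inverse w)) (cball 0 1 - {0})"
    by (rule invertibly_analytic_near_inverse[OF V])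
      (auto simp: norm_inverse inverse_less_1_iff)
  from invertibly_analytic_near_Un[OF this L]
  show "\<exists>L. plus_factor (\<lambda>w. if w = 0 then L else V (inverse w))"
    unfolding plus_factor_def by (intro exI[of _ L]) (auto simp: insert_absorb)
next
  fix L assume "plus_factor (\<lambda>w. if w = 0 then L else V (inverse w))"
  then have L: "invertibly_analytic_near (\<lambda>w. if w = 0 then L else V (inverse w)) (cball 0 1)"
    unfolding plus_factor_def .
  have "invertibly_analytic_near V (- ball 0 1)"
    by (rule invertibly_analytic_near_inverse[OF L])
      (auto simp: norm_inverse inverse_le_1_iff)
  with invertibly_analytic_near_subset[OF L, of "{0}"] show "minus_factor V"
    unfolding minus_factor_def by auto
qed

lemma exponentially_stable_invertible:
  assumes "exponentially_stable T" "norm z \<le> 1"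
  shows "cblinfun_invertible (id_cblinfun - z *\<^sub>C T)"
proof (cases "z = 0")
  case False
  have "inverse z \<notin> spectrum T"
  proof
    assume "inverse z \<in> spectrum T"
    then have "norm (inverse z) < 1" using assms(1) unfolding exponentially_stable_def by auto
    then show False using assms(2) False by (simp add: norm_inverse inverse_less_1_iff)
  qed
  then have "cblinfun_invertible (z *\<^sub>C (inverse z *\<^sub>C id_cblinfun - T))"
    using False by (intro invertible_scaleC) (auto simp: spectrum_def)
  then show ?thesis using False by (simp add: compose_expand)
qed (simp add: invertible_id)

section \<open>Resolvents and splitting\<close>

text \<open>The resolvent in the form \<open>(I - z T)\<^sup>-\<^sup>1\<close>. With \<open>w = 1/z\<close> it also covers
  \<open>(z I - T)\<^sup>-\<^sup>1 = w (I - w T)\<^sup>-\<^sup>1\<close>.\<close>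

definition resolvent :: "('a :: complex_normed_vector \<Rightarrow>\<^sub>C\<^sub>L 'a) \<Rightarrow> complex \<Rightarrow> 'a \<Rightarrow>\<^sub>C\<^sub>L 'a"
  where "resolvent T z = cblinfun_inv (id_cblinfun - z *\<^sub>C T)"

text \<open>Exponential stability in the form in which it is used.\<close>

definition disc_stable :: "('a :: complex_normed_vector \<Rightarrow>\<^sub>C\<^sub>L 'a) \<Rightarrow> bool"
  where "disc_stable T \<longleftrightarrow> (\<forall>z. norm z \<le> 1 \<longrightarrow> cblinfun_invertible (id_cblinfun - z *\<^sub>C T))"

lemma disc_analytic_resolvent:
  fixes T :: "'a :: complex_hilbert \<Rightarrow>\<^sub>C\<^sub>L 'a"
  assumes "disc_stable T"
  shows "disc_analytic (resolvent T)"
  unfolding resolvent_def[abs_def]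
  by (intro plus_factorD(2) plus_factorI disc_analytic_intros)
    (use assms in \<open>auto simp: disc_stable_def\<close>)

lemma resolvent_works:
  assumes "disc_stable T" "norm z \<le> 1"
  shows "(id_cblinfun - z *\<^sub>C T) o\<^sub>C\<^sub>L resolvent T z = id_cblinfun"
    "resolvent T z o\<^sub>C\<^sub>L (id_cblinfun - z *\<^sub>C T) = id_cblinfun"
  using assms cblinfun_inv_works unfolding resolvent_def disc_stable_def by blast+

lemma resolvent_0 [simp]: "resolvent T 0 = id_cblinfun"
  unfolding resolvent_def by (rule cblinfun_inv_unique) simp_all

lemma resolvent_shift:
  assumes T: "disc_stable T" and zw: "norm z = 1" "z * w = 1"
  shows "resolvent T z o\<^sub>C\<^sub>L T = w *\<^sub>C (resolvent T z - id_cblinfun)"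
    "T o\<^sub>C\<^sub>L resolvent T z = w *\<^sub>C (resolvent T z - id_cblinfun)"
proof -
  have 1: "resolvent T z - z *\<^sub>C (resolvent T z o\<^sub>C\<^sub>L T) = id_cblinfun"
    "resolvent T z - z *\<^sub>C (T o\<^sub>C\<^sub>L resolvent T z) = id_cblinfun"
    using resolvent_works[OF T, of z] zw by (simp_all add: compose_expand)
  have "resolvent T z - id_cblinfun = z *\<^sub>C (resolvent T z o\<^sub>C\<^sub>L T)"
    "resolvent T z - id_cblinfun = z *\<^sub>C (T o\<^sub>C\<^sub>L resolvent T z)"
    by (subst 1[symmetric], simp)+
  moreover have "A = w *\<^sub>C B" if "B = z *\<^sub>C A" for A B :: "'a \<Rightarrow>\<^sub>C\<^sub>L 'a"
    using that zw(2) by (simp add: scaleC_scaleC mult.commute)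
  ultimately show "resolvent T z o\<^sub>C\<^sub>L T = w *\<^sub>C (resolvent T z - id_cblinfun)"
    "T o\<^sub>C\<^sub>L resolvent T z = w *\<^sub>C (resolvent T z - id_cblinfun)"
    by blast+
qed

lemma circle_resolvent:
  fixes T :: "'a :: complex_hilbert \<Rightarrow>\<^sub>C\<^sub>L 'a"
  assumes T: "disc_stable T" and r: "r \<ge> 1"
  shows "norm \<zeta> = r \<Longrightarrow> cblinfun_invertible (\<zeta> *\<^sub>C id_cblinfun - T)"
    and "(\<lambda>\<zeta>. cblinfun_inv (\<zeta> *\<^sub>C id_cblinfun - T)) op_holomorphic_on sphere 0 r"
proof -
  show inv: "cblinfun_invertible (\<zeta> *\<^sub>C id_cblinfun - T)" if "norm \<zeta> = r" for \<zeta>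
  proof -
    have "\<zeta> \<noteq> 0" "norm (inverse \<zeta>) \<le> 1" using that r by (auto simp: norm_inverse inverse_le_1_iff)
    then have "cblinfun_invertible (\<zeta> *\<^sub>C (id_cblinfun - inverse \<zeta> *\<^sub>C T))"
      using T by (intro invertible_scaleC) (auto simp: disc_stable_def)
    then show ?thesis using \<open>\<zeta> \<noteq> 0\<close> by (simp add: compose_expand)
  qed
  have "(\<lambda>\<zeta>. \<zeta> *\<^sub>C id_cblinfun + - T) op_holomorphic_on sphere 0 r"
    by (intro op_holomorphic_on_add op_holomorphic_on_scaleC op_holomorphic_on_const holomorphic_on_ident)
  then show "(\<lambda>\<zeta>. cblinfun_inv (\<zeta> *\<^sub>C id_cblinfun - T)) op_holomorphic_on sphere 0 r"
    by (intro op_holomorphic_on_inv inv) auto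
qed

text \<open>The decomposition of \<open>F(z) (I - z\<^sup>-\<^sup>1 \<alpha>)\<^sup>-\<^sup>1\<close> on the unit circle into its part \<open>z K(z)\<close> analytic
  inside and its part analytic outside. The second part again has the realization given by \<open>\<alpha>\<close>,
  with constant output operator \<open>H\<close>.\<close>

lemma split_right:
  fixes F :: "complex \<Rightarrow> 'm :: complex_hilbert \<Rightarrow>\<^sub>C\<^sub>L 'u :: complex_hilbert"
  assumes F: "disc_analytic F" and \<alpha>: "disc_stable \<alpha>"
  obtains H K where "disc_analytic K"
    "\<And>z w. norm z = 1 \<Longrightarrow> z * w = 1 \<Longrightarrow> F z o\<^sub>C\<^sub>L resolvent \<alpha> w = H o\<^sub>C\<^sub>L resolvent \<alpha> w + z *\<^sub>C K z"
proof -
  obtain N where N: "open N" "cball 0 1 \<subseteq> N" "F op_holomorphic_on N"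
    using F unfolding disc_analytic_def by blast
  obtain r where r: "r > 1" "cball 0 r \<subseteq> N"
    using open_cball_enlarge[OF N(1,2)] .
  define \<Phi> where "\<Phi> \<zeta> = F \<zeta> o\<^sub>C\<^sub>L cblinfun_inv (\<zeta> *\<^sub>C id_cblinfun - \<alpha>)" for \<zeta>
  note res = circle_resolvent[OF \<alpha> less_imp_le[OF r(1)]]
  have "\<Phi> op_holomorphic_on sphere 0 r"
    unfolding \<Phi>_def
    by (intro op_holomorphic_on_compose res op_holomorphic_on_subset[OF N(3)]) (use r in auto)
  then have cont: "continuous_on (sphere 0 r) \<Phi>" by (rule op_holomorphic_on_imp_continuous_on)
  have eq: "\<Phi> \<zeta> o\<^sub>C\<^sub>L \<alpha> = \<zeta> *\<^sub>C \<Phi> \<zeta> - F \<zeta>" if "norm \<zeta> = r" for \<zeta>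
  proof -
    have "\<Phi> \<zeta> o\<^sub>C\<^sub>L (\<zeta> *\<^sub>C id_cblinfun - \<alpha>) = F \<zeta>"
      unfolding \<Phi>_def compose_assoc by (simp add: cblinfun_inv_works res that)
    then show ?thesis by (simp add: compose_expand algebra_simps)
  qed
  have F': "F op_holomorphic_on cball 0 r" using N(3) r(2) by (rule op_holomorphic_on_subset)
  have r0: "r > 0" using r by simp
  obtain H K where K: "K op_holomorphic_on ball 0 r"
    and HK: "\<And>z. norm z < r \<Longrightarrow> z *\<^sub>C K z - K z o\<^sub>C\<^sub>L \<alpha> = F z - H"
    using cauchy_split[OF F' r0 cont compose.bounded_linear_left[of \<alpha>] compose_scaleC(1) eq] by blast
  show ?thesis
  proof (rule that)
    show "disc_analytic K"
      unfolding disc_analytic_def using r K by (intro exI[of _ "ball 0 r"]) auto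
    fix z w :: complex assume z: "norm z = 1" and zw: "z * w = 1"
    have wz: "w * z = 1" using zw by (simp add: mult.commute)
    have "norm w \<le> 1" using z zw by (metis mult_1 norm_mult norm_one order_refl)
    have "z *\<^sub>C K z = z *\<^sub>C K z o\<^sub>C\<^sub>L ((id_cblinfun - w *\<^sub>C \<alpha>) o\<^sub>C\<^sub>L resolvent \<alpha> w)"
      using resolvent_works[OF \<alpha> \<open>norm w \<le> 1\<close>] by simp
    also have "\<dots> = (z *\<^sub>C K z - K z o\<^sub>C\<^sub>L \<alpha>) o\<^sub>C\<^sub>L resolvent \<alpha> w"
      by (simp add: compose_expand zw wz)
    also have "\<dots> = (F z - H) o\<^sub>C\<^sub>L resolvent \<alpha> w" using HK[of z] z r by simp
    finally show "F z o\<^sub>C\<^sub>L resolvent \<alpha> w = H o\<^sub>C\<^sub>L resolvent \<alpha> w + z *\<^sub>C K z"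
      by (simp add: compose_expand)
  qed
qed

text \<open>The mirror image of \<open>split_right\<close>.\<close>

lemma split_left:
  fixes F :: "complex \<Rightarrow> 'u :: complex_hilbert \<Rightarrow>\<^sub>C\<^sub>L 'm :: complex_hilbert"
  assumes F: "disc_analytic F" and \<alpha>: "disc_stable \<alpha>"
  obtains H K where "disc_analytic K"
    "\<And>z w. norm z = 1 \<Longrightarrow> z * w = 1 \<Longrightarrow> resolvent \<alpha> w o\<^sub>C\<^sub>L F z = resolvent \<alpha> w o\<^sub>C\<^sub>L H + z *\<^sub>C K z"
proof -
  obtain N where N: "open N" "cball 0 1 \<subseteq> N" "F op_holomorphic_on N"
    using F unfolding disc_analytic_def by blast
  obtain r where r: "r > 1" "cball 0 r \<subseteq> N"
    using open_cball_enlarge[OF N(1,2)] .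
  define \<Phi> where "\<Phi> \<zeta> = cblinfun_inv (\<zeta> *\<^sub>C id_cblinfun - \<alpha>) o\<^sub>C\<^sub>L F \<zeta>" for \<zeta>
  note res = circle_resolvent[OF \<alpha> less_imp_le[OF r(1)]]
  have "\<Phi> op_holomorphic_on sphere 0 r"
    unfolding \<Phi>_def
    by (intro op_holomorphic_on_compose res op_holomorphic_on_subset[OF N(3)]) (use r in auto)
  then have cont: "continuous_on (sphere 0 r) \<Phi>" by (rule op_holomorphic_on_imp_continuous_on)
  have eq: "\<alpha> o\<^sub>C\<^sub>L \<Phi> \<zeta> = \<zeta> *\<^sub>C \<Phi> \<zeta> - F \<zeta>" if "norm \<zeta> = r" for \<zeta>
  proof -
    have "(\<zeta> *\<^sub>C id_cblinfun - \<alpha>) o\<^sub>C\<^sub>L \<Phi> \<zeta> = F \<zeta>"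
      unfolding \<Phi>_def by (simp add: inv_cancel res that)
    then show ?thesis by (simp add: compose_expand algebra_simps)
  qed
  have F': "F op_holomorphic_on cball 0 r" using N(3) r(2) by (rule op_holomorphic_on_subset)
  have r0: "r > 0" using r by simp
  obtain H K where K: "K op_holomorphic_on ball 0 r"
    and HK: "\<And>z. norm z < r \<Longrightarrow> z *\<^sub>C K z - \<alpha> o\<^sub>C\<^sub>L K z = F z - H"
    using cauchy_split[OF F' r0 cont compose.bounded_linear_right[of \<alpha>] compose_scaleC(2) eq] by blast
  show ?thesis
  proof (rule that)
    show "disc_analytic K"
      unfolding disc_analytic_def using r K by (intro exI[of _ "ball 0 r"]) auto
    fix z w :: complex assume z: "norm z = 1" and zw: "z * w = 1"
    have wz: "w * z = 1" using zw by (simp add: mult.commute)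
    have "norm w \<le> 1" using z zw by (metis mult_1 norm_mult norm_one order_refl)
    have "z *\<^sub>C K z = resolvent \<alpha> w o\<^sub>C\<^sub>L (id_cblinfun - w *\<^sub>C \<alpha>) o\<^sub>C\<^sub>L z *\<^sub>C K z"
      using resolvent_works[OF \<alpha> \<open>norm w \<le> 1\<close>] by simp
    also have "\<dots> = resolvent \<alpha> w o\<^sub>C\<^sub>L (z *\<^sub>C K z - \<alpha> o\<^sub>C\<^sub>L K z)"
      by (simp add: compose_expand zw wz)
    also have "\<dots> = resolvent \<alpha> w o\<^sub>C\<^sub>L (F z - H)" using HK[of z] z r by simp
    finally show "resolvent \<alpha> w o\<^sub>C\<^sub>L F z = resolvent \<alpha> w o\<^sub>C\<^sub>L H + z *\<^sub>C K z"
      by (simp add: compose_expand)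
  qed
qed

section \<open>Operator identities\<close>

text \<open>The operators of the theorem with the relations between them, the spectral conditions left
  aside: \<open>E\<close> is the inverse of \<open>\<delta> - \<gamma>\<^sub>m Q \<beta>\<^sub>p\<close>, \<open>a\<close> and \<open>b\<close> are the closed-loop operators on the plus
  and on the minus side, and \<open>\<beta>\<close> and \<open>\<gamma>\<close> abbreviate the recurring factors of the Riccati
  equation. The Lyapunov equation appears in Stein form, without inverses.\<close>

locale riccati_lyapunov =
  fixes \<delta> E :: "'u :: complex_hilbert \<Rightarrow>\<^sub>C\<^sub>L 'u"
    and \<alpha>\<^sub>p a :: "'p :: complex_hilbert \<Rightarrow>\<^sub>C\<^sub>L 'p" and \<beta>\<^sub>p :: "'u \<Rightarrow>\<^sub>C\<^sub>L 'p" and \<gamma>\<^sub>p :: "'p \<Rightarrow>\<^sub>C\<^sub>L 'u"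
    and \<alpha>\<^sub>m b :: "'m :: complex_hilbert \<Rightarrow>\<^sub>C\<^sub>L 'm" and \<beta>\<^sub>m :: "'u \<Rightarrow>\<^sub>C\<^sub>L 'm" and \<gamma>\<^sub>m :: "'m \<Rightarrow>\<^sub>C\<^sub>L 'u"
    and Q :: "'p \<Rightarrow>\<^sub>C\<^sub>L 'm" and Z :: "'m \<Rightarrow>\<^sub>C\<^sub>L 'p"
    and \<beta> :: "'u \<Rightarrow>\<^sub>C\<^sub>L 'm" and \<gamma> :: "'p \<Rightarrow>\<^sub>C\<^sub>L 'u"
  assumes \<beta>_def: "\<beta> = \<beta>\<^sub>m - \<alpha>\<^sub>m o\<^sub>C\<^sub>L Q o\<^sub>C\<^sub>L \<beta>\<^sub>p"
    and \<gamma>_def: "\<gamma> = \<gamma>\<^sub>p - \<gamma>\<^sub>m o\<^sub>C\<^sub>L Q o\<^sub>C\<^sub>L \<alpha>\<^sub>p"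
    and E_right: "(\<delta> - \<gamma>\<^sub>m o\<^sub>C\<^sub>L Q o\<^sub>C\<^sub>L \<beta>\<^sub>p) o\<^sub>C\<^sub>L E = id_cblinfun"
    and E_left: "E o\<^sub>C\<^sub>L (\<delta> - \<gamma>\<^sub>m o\<^sub>C\<^sub>L Q o\<^sub>C\<^sub>L \<beta>\<^sub>p) = id_cblinfun"
    and riccati: "Q = \<alpha>\<^sub>m o\<^sub>C\<^sub>L Q o\<^sub>C\<^sub>L \<alpha>\<^sub>p + \<beta> o\<^sub>C\<^sub>L E o\<^sub>C\<^sub>L \<gamma>"
    and a_def: "a = \<alpha>\<^sub>p - \<beta>\<^sub>p o\<^sub>C\<^sub>L E o\<^sub>C\<^sub>L \<gamma>"
    and b_def: "b = \<alpha>\<^sub>m - \<beta> o\<^sub>C\<^sub>L E o\<^sub>C\<^sub>L \<gamma>\<^sub>m"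
    and stein: "Z = a o\<^sub>C\<^sub>L Z o\<^sub>C\<^sub>L b - \<beta>\<^sub>p o\<^sub>C\<^sub>L E o\<^sub>C\<^sub>L \<gamma>\<^sub>m"
begin

text \<open>\<open>\<beta>'\<close> and \<open>\<gamma>'\<close> are the input operator of the plus part (state operator \<open>a\<close>) and the output
  operator of the minus part (state operator \<open>b\<close>) of the stable representation of the inverse
  of \<open>R\<close>.\<close>

definition "M = id_cblinfun - Q o\<^sub>C\<^sub>L Z"
definition "N = id_cblinfun - Z o\<^sub>C\<^sub>L Q"
definition "\<beta>' = \<beta>\<^sub>p o\<^sub>C\<^sub>L E + a o\<^sub>C\<^sub>L Z o\<^sub>C\<^sub>L \<beta> o\<^sub>C\<^sub>L E"
definition "\<gamma>' = - (E o\<^sub>C\<^sub>L \<gamma>\<^sub>m + E o\<^sub>C\<^sub>L \<gamma> o\<^sub>C\<^sub>L Z o\<^sub>C\<^sub>L b)"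

text \<open>The hypotheses in the form "expression = 0". In the proofs below, the difference of the two
  sides of a claim is written as a combination of such expressions; the combination itself is
  checked by expanding it.\<close>

lemma residuals:
  "\<beta> - \<beta>\<^sub>m + \<alpha>\<^sub>m o\<^sub>C\<^sub>L Q o\<^sub>C\<^sub>L \<beta>\<^sub>p = 0"
  "\<gamma> - \<gamma>\<^sub>p + \<gamma>\<^sub>m o\<^sub>C\<^sub>L Q o\<^sub>C\<^sub>L \<alpha>\<^sub>p = 0"
  "(\<delta> - \<gamma>\<^sub>m o\<^sub>C\<^sub>L Q o\<^sub>C\<^sub>L \<beta>\<^sub>p) o\<^sub>C\<^sub>L E - id_cblinfun = 0"
  "E o\<^sub>C\<^sub>L (\<delta> - \<gamma>\<^sub>m o\<^sub>C\<^sub>L Q o\<^sub>C\<^sub>L \<beta>\<^sub>p) - id_cblinfun = 0"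
  "Q - \<alpha>\<^sub>m o\<^sub>C\<^sub>L Q o\<^sub>C\<^sub>L \<alpha>\<^sub>p - \<beta> o\<^sub>C\<^sub>L E o\<^sub>C\<^sub>L \<gamma> = 0"
  "a - \<alpha>\<^sub>p + \<beta>\<^sub>p o\<^sub>C\<^sub>L E o\<^sub>C\<^sub>L \<gamma> = 0"
  "b - \<alpha>\<^sub>m + \<beta> o\<^sub>C\<^sub>L E o\<^sub>C\<^sub>L \<gamma>\<^sub>m = 0"
  "Z - a o\<^sub>C\<^sub>L Z o\<^sub>C\<^sub>L b + \<beta>\<^sub>p o\<^sub>C\<^sub>L E o\<^sub>C\<^sub>L \<gamma>\<^sub>m = 0"
  by (simp add: \<beta>_def, simp add: \<gamma>_def, simp add: E_right, simp add: E_left,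
      subst riccati, simp, simp add: a_def, simp add: b_def, subst stein, simp)

lemmas zero_simps = compose.zero_left compose.zero_right add_0_left add_0_right diff_0_right
  diff_0 minus_zero

lemma Q_eqs:
  "Q - \<alpha>\<^sub>m o\<^sub>C\<^sub>L Q o\<^sub>C\<^sub>L a - \<beta>\<^sub>m o\<^sub>C\<^sub>L E o\<^sub>C\<^sub>L \<gamma> = 0"
  "Q - b o\<^sub>C\<^sub>L Q o\<^sub>C\<^sub>L \<alpha>\<^sub>p - \<beta> o\<^sub>C\<^sub>L E o\<^sub>C\<^sub>L \<gamma>\<^sub>p = 0"
proof -
  have "Q - \<alpha>\<^sub>m o\<^sub>C\<^sub>L Q o\<^sub>C\<^sub>L a - \<beta>\<^sub>m o\<^sub>C\<^sub>L E o\<^sub>C\<^sub>L \<gamma>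
    = (Q - \<alpha>\<^sub>m o\<^sub>C\<^sub>L Q o\<^sub>C\<^sub>L \<alpha>\<^sub>p - \<beta> o\<^sub>C\<^sub>L E o\<^sub>C\<^sub>L \<gamma>) - \<alpha>\<^sub>m o\<^sub>C\<^sub>L Q o\<^sub>C\<^sub>L (a - \<alpha>\<^sub>p + \<beta>\<^sub>p o\<^sub>C\<^sub>L E o\<^sub>C\<^sub>L \<gamma>)
      + (\<beta> - \<beta>\<^sub>m + \<alpha>\<^sub>m o\<^sub>C\<^sub>L Q o\<^sub>C\<^sub>L \<beta>\<^sub>p) o\<^sub>C\<^sub>L E o\<^sub>C\<^sub>L \<gamma>"
    by (simp add: compose_expand algebra_simps)
  then show "Q - \<alpha>\<^sub>m o\<^sub>C\<^sub>L Q o\<^sub>C\<^sub>L a - \<beta>\<^sub>m o\<^sub>C\<^sub>L E o\<^sub>C\<^sub>L \<gamma> = 0"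
    by (simp only: residuals zero_simps)
  have "Q - b o\<^sub>C\<^sub>L Q o\<^sub>C\<^sub>L \<alpha>\<^sub>p - \<beta> o\<^sub>C\<^sub>L E o\<^sub>C\<^sub>L \<gamma>\<^sub>p
    = (Q - \<alpha>\<^sub>m o\<^sub>C\<^sub>L Q o\<^sub>C\<^sub>L \<alpha>\<^sub>p - \<beta> o\<^sub>C\<^sub>L E o\<^sub>C\<^sub>L \<gamma>) - (b - \<alpha>\<^sub>m + \<beta> o\<^sub>C\<^sub>L E o\<^sub>C\<^sub>L \<gamma>\<^sub>m) o\<^sub>C\<^sub>L Q o\<^sub>C\<^sub>L \<alpha>\<^sub>p
      + \<beta> o\<^sub>C\<^sub>L E o\<^sub>C\<^sub>L (\<gamma> - \<gamma>\<^sub>p + \<gamma>\<^sub>m o\<^sub>C\<^sub>L Q o\<^sub>C\<^sub>L \<alpha>\<^sub>p)"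
    by (simp add: compose_expand algebra_simps)
  then show "Q - b o\<^sub>C\<^sub>L Q o\<^sub>C\<^sub>L \<alpha>\<^sub>p - \<beta> o\<^sub>C\<^sub>L E o\<^sub>C\<^sub>L \<gamma>\<^sub>p = 0"
    by (simp only: residuals zero_simps)
qed

text \<open>The next two identities show that \<open>M\<close> intertwines \<open>b\<close> with \<open>\<alpha>\<^sub>m\<close>, and \<open>N\<close> intertwines \<open>\<alpha>\<^sub>p\<close> with
  \<open>a\<close>, up to feedback terms. If \<open>M\<close> is invertible, they turn the stability of \<open>a\<close> and \<open>b\<close> into
  the invertibility of the left factors.\<close>

lemma M_b: "M o\<^sub>C\<^sub>L b = \<alpha>\<^sub>m o\<^sub>C\<^sub>L M + \<beta>\<^sub>m o\<^sub>C\<^sub>L \<gamma>'"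
proof -
  have "M o\<^sub>C\<^sub>L b - (\<alpha>\<^sub>m o\<^sub>C\<^sub>L M + \<beta>\<^sub>m o\<^sub>C\<^sub>L \<gamma>')
    = (b - \<alpha>\<^sub>m + \<beta> o\<^sub>C\<^sub>L E o\<^sub>C\<^sub>L \<gamma>\<^sub>m) - (\<beta> - \<beta>\<^sub>m + \<alpha>\<^sub>m o\<^sub>C\<^sub>L Q o\<^sub>C\<^sub>L \<beta>\<^sub>p) o\<^sub>C\<^sub>L E o\<^sub>C\<^sub>L \<gamma>\<^sub>m
      + \<alpha>\<^sub>m o\<^sub>C\<^sub>L Q o\<^sub>C\<^sub>L (Z - a o\<^sub>C\<^sub>L Z o\<^sub>C\<^sub>L b + \<beta>\<^sub>p o\<^sub>C\<^sub>L E o\<^sub>C\<^sub>L \<gamma>\<^sub>m)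
      - (Q - \<alpha>\<^sub>m o\<^sub>C\<^sub>L Q o\<^sub>C\<^sub>L a - \<beta>\<^sub>m o\<^sub>C\<^sub>L E o\<^sub>C\<^sub>L \<gamma>) o\<^sub>C\<^sub>L Z o\<^sub>C\<^sub>L b"
    by (simp add: M_def \<gamma>'_def compose_expand algebra_simps)
  also have "\<dots> = 0" by (simp only: residuals Q_eqs zero_simps)
  finally show ?thesis by (simp only: right_minus_eq)
qed

lemma a_N: "a o\<^sub>C\<^sub>L N = N o\<^sub>C\<^sub>L \<alpha>\<^sub>p - \<beta>' o\<^sub>C\<^sub>L \<gamma>\<^sub>p"
proof -
  have "a o\<^sub>C\<^sub>L N - (N o\<^sub>C\<^sub>L \<alpha>\<^sub>p - \<beta>' o\<^sub>C\<^sub>L \<gamma>\<^sub>p)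
    = (a - \<alpha>\<^sub>p + \<beta>\<^sub>p o\<^sub>C\<^sub>L E o\<^sub>C\<^sub>L \<gamma>) - \<beta>\<^sub>p o\<^sub>C\<^sub>L E o\<^sub>C\<^sub>L (\<gamma> - \<gamma>\<^sub>p + \<gamma>\<^sub>m o\<^sub>C\<^sub>L Q o\<^sub>C\<^sub>L \<alpha>\<^sub>p)
      - a o\<^sub>C\<^sub>L Z o\<^sub>C\<^sub>L (Q - b o\<^sub>C\<^sub>L Q o\<^sub>C\<^sub>L \<alpha>\<^sub>p - \<beta> o\<^sub>C\<^sub>L E o\<^sub>C\<^sub>L \<gamma>\<^sub>p)
      + (Z - a o\<^sub>C\<^sub>L Z o\<^sub>C\<^sub>L b + \<beta>\<^sub>p o\<^sub>C\<^sub>L E o\<^sub>C\<^sub>L \<gamma>\<^sub>m) o\<^sub>C\<^sub>L Q o\<^sub>C\<^sub>L \<alpha>\<^sub>p"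
    by (simp add: N_def \<beta>'_def compose_expand algebra_simps)
  also have "\<dots> = 0" by (simp only: residuals Q_eqs zero_simps)
  finally show ?thesis by (simp only: right_minus_eq)
qed

lemma \<beta>'_\<delta>: "\<beta>' o\<^sub>C\<^sub>L \<delta> = N o\<^sub>C\<^sub>L \<beta>\<^sub>p + a o\<^sub>C\<^sub>L Z o\<^sub>C\<^sub>L \<beta>\<^sub>m"
proof -
  have "\<beta>' o\<^sub>C\<^sub>L \<delta> - (N o\<^sub>C\<^sub>L \<beta>\<^sub>p + a o\<^sub>C\<^sub>L Z o\<^sub>C\<^sub>L \<beta>\<^sub>m)
    = (\<beta>\<^sub>p + a o\<^sub>C\<^sub>L Z o\<^sub>C\<^sub>L \<beta>) o\<^sub>C\<^sub>L (E o\<^sub>C\<^sub>L (\<delta> - \<gamma>\<^sub>m o\<^sub>C\<^sub>L Q o\<^sub>C\<^sub>L \<beta>\<^sub>p) - id_cblinfun)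
      + a o\<^sub>C\<^sub>L Z o\<^sub>C\<^sub>L (\<beta> - \<beta>\<^sub>m + \<alpha>\<^sub>m o\<^sub>C\<^sub>L Q o\<^sub>C\<^sub>L \<beta>\<^sub>p)
      + a o\<^sub>C\<^sub>L Z o\<^sub>C\<^sub>L (b - \<alpha>\<^sub>m + \<beta> o\<^sub>C\<^sub>L E o\<^sub>C\<^sub>L \<gamma>\<^sub>m) o\<^sub>C\<^sub>L Q o\<^sub>C\<^sub>L \<beta>\<^sub>p
      + (Z - a o\<^sub>C\<^sub>L Z o\<^sub>C\<^sub>L b + \<beta>\<^sub>p o\<^sub>C\<^sub>L E o\<^sub>C\<^sub>L \<gamma>\<^sub>m) o\<^sub>C\<^sub>L Q o\<^sub>C\<^sub>L \<beta>\<^sub>p"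
    by (simp add: N_def \<beta>'_def compose_expand algebra_simps)
  also have "\<dots> = 0" by (simp only: residuals Q_eqs zero_simps)
  finally show ?thesis by (simp only: right_minus_eq)
qed

lemma \<delta>_\<gamma>': "\<gamma>\<^sub>m o\<^sub>C\<^sub>L M + \<delta> o\<^sub>C\<^sub>L \<gamma>' = - (\<gamma>\<^sub>p o\<^sub>C\<^sub>L Z o\<^sub>C\<^sub>L b)"
proof -
  have "\<gamma>\<^sub>m o\<^sub>C\<^sub>L M + \<delta> o\<^sub>C\<^sub>L \<gamma>' - (- (\<gamma>\<^sub>p o\<^sub>C\<^sub>L Z o\<^sub>C\<^sub>L b))
    = - (((\<delta> - \<gamma>\<^sub>m o\<^sub>C\<^sub>L Q o\<^sub>C\<^sub>L \<beta>\<^sub>p) o\<^sub>C\<^sub>L E - id_cblinfun) o\<^sub>C\<^sub>L (\<gamma>\<^sub>m + \<gamma> o\<^sub>C\<^sub>L Z o\<^sub>C\<^sub>L b))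
      - (\<gamma> - \<gamma>\<^sub>p + \<gamma>\<^sub>m o\<^sub>C\<^sub>L Q o\<^sub>C\<^sub>L \<alpha>\<^sub>p) o\<^sub>C\<^sub>L Z o\<^sub>C\<^sub>L b
      - \<gamma>\<^sub>m o\<^sub>C\<^sub>L Q o\<^sub>C\<^sub>L (Z - a o\<^sub>C\<^sub>L Z o\<^sub>C\<^sub>L b + \<beta>\<^sub>p o\<^sub>C\<^sub>L E o\<^sub>C\<^sub>L \<gamma>\<^sub>m)
      - \<gamma>\<^sub>m o\<^sub>C\<^sub>L Q o\<^sub>C\<^sub>L (a - \<alpha>\<^sub>p + \<beta>\<^sub>p o\<^sub>C\<^sub>L E o\<^sub>C\<^sub>L \<gamma>) o\<^sub>C\<^sub>L Z o\<^sub>C\<^sub>L b"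
    by (simp add: M_def \<gamma>'_def compose_expand algebra_simps)
  also have "\<dots> = 0" by (simp only: residuals Q_eqs zero_simps)
  finally show ?thesis by (simp only: right_minus_eq)
qed

lemma \<alpha>\<^sub>p_Z_b: "\<alpha>\<^sub>p o\<^sub>C\<^sub>L Z o\<^sub>C\<^sub>L b = Z - \<beta>\<^sub>p o\<^sub>C\<^sub>L \<gamma>'"
proof -
  have "\<alpha>\<^sub>p o\<^sub>C\<^sub>L Z o\<^sub>C\<^sub>L b - (Z - \<beta>\<^sub>p o\<^sub>C\<^sub>L \<gamma>')
    = - ((a - \<alpha>\<^sub>p + \<beta>\<^sub>p o\<^sub>C\<^sub>L E o\<^sub>C\<^sub>L \<gamma>) o\<^sub>C\<^sub>L Z o\<^sub>C\<^sub>L b) - (Z - a o\<^sub>C\<^sub>L Z o\<^sub>C\<^sub>L b + \<beta>\<^sub>p o\<^sub>C\<^sub>L E o\<^sub>C\<^sub>L \<gamma>\<^sub>m)"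
    by (simp add: \<gamma>'_def compose_expand algebra_simps)
  also have "\<dots> = 0" by (simp only: residuals Q_eqs zero_simps)
  finally show ?thesis by (simp only: right_minus_eq)
qed

lemma a_Z_\<alpha>\<^sub>m: "a o\<^sub>C\<^sub>L Z o\<^sub>C\<^sub>L \<alpha>\<^sub>m = Z + \<beta>' o\<^sub>C\<^sub>L \<gamma>\<^sub>m"
proof -
  have "a o\<^sub>C\<^sub>L Z o\<^sub>C\<^sub>L \<alpha>\<^sub>m - (Z + \<beta>' o\<^sub>C\<^sub>L \<gamma>\<^sub>m)
    = - (a o\<^sub>C\<^sub>L Z o\<^sub>C\<^sub>L (b - \<alpha>\<^sub>m + \<beta> o\<^sub>C\<^sub>L E o\<^sub>C\<^sub>L \<gamma>\<^sub>m)) - (Z - a o\<^sub>C\<^sub>L Z o\<^sub>C\<^sub>L b + \<beta>\<^sub>p o\<^sub>C\<^sub>L E o\<^sub>C\<^sub>L \<gamma>\<^sub>m)"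
    by (simp add: \<beta>'_def compose_expand algebra_simps)
  also have "\<dots> = 0" by (simp only: residuals Q_eqs zero_simps)
  finally show ?thesis by (simp only: right_minus_eq)
qed

end

section \<open>Products of realizations\<close>

text \<open>The product of the two resolvents across a Stein expression decouples.\<close>

lemma cross_identity:
  fixes \<alpha>\<^sub>p :: "'p :: complex_hilbert \<Rightarrow>\<^sub>C\<^sub>L 'p" and \<alpha>\<^sub>m :: "'m :: complex_hilbert \<Rightarrow>\<^sub>C\<^sub>L 'm"
  assumes "disc_stable \<alpha>\<^sub>p" "disc_stable \<alpha>\<^sub>m" and z: "norm z = 1" "z * w = 1"
  shows "resolvent \<alpha>\<^sub>p z o\<^sub>C\<^sub>L (P - \<alpha>\<^sub>p o\<^sub>C\<^sub>L P o\<^sub>C\<^sub>L \<alpha>\<^sub>m) o\<^sub>C\<^sub>L resolvent \<alpha>\<^sub>m w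
    = P o\<^sub>C\<^sub>L resolvent \<alpha>\<^sub>m w + resolvent \<alpha>\<^sub>p z o\<^sub>C\<^sub>L P - P"
proof -
  have w: "norm w = 1" "w * z = 1"
    using z by (metis mult_1 norm_mult norm_one, simp add: mult.commute)
  have "resolvent \<alpha>\<^sub>p z o\<^sub>C\<^sub>L (P - \<alpha>\<^sub>p o\<^sub>C\<^sub>L P o\<^sub>C\<^sub>L \<alpha>\<^sub>m) o\<^sub>C\<^sub>L resolvent \<alpha>\<^sub>m w
    = resolvent \<alpha>\<^sub>p z o\<^sub>C\<^sub>L P o\<^sub>C\<^sub>L resolvent \<alpha>\<^sub>m w
      - (resolvent \<alpha>\<^sub>p z o\<^sub>C\<^sub>L \<alpha>\<^sub>p) o\<^sub>C\<^sub>L P o\<^sub>C\<^sub>L (\<alpha>\<^sub>m o\<^sub>C\<^sub>L resolvent \<alpha>\<^sub>m w)"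
    by (simp add: compose_expand)
  also have "\<dots> = P o\<^sub>C\<^sub>L resolvent \<alpha>\<^sub>m w + resolvent \<alpha>\<^sub>p z o\<^sub>C\<^sub>L P - P"
    unfolding resolvent_shift(1)[OF assms(1) z] resolvent_shift(2)[OF assms(2) w]
    by (simp add: compose_expand z w algebra_simps)
  finally show ?thesis .
qed

text \<open>If \<open>X = a X c\<close>, then \<open>cross_identity\<close> says that a function analytic inside the disc and
  vanishing at \<open>0\<close> agrees on the circle with one analytic outside and equal to \<open>X\<close> at \<open>\<infinity>\<close>.\<close>

lemma stein_unique:
  fixes a :: "'p :: complex_hilbert \<Rightarrow>\<^sub>C\<^sub>L 'p" and c :: "'m :: complex_hilbert \<Rightarrow>\<^sub>C\<^sub>L 'm"
  assumes a: "disc_stable a" and c: "disc_stable c" and X: "X = a o\<^sub>C\<^sub>L X o\<^sub>C\<^sub>L c"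
  shows "X = 0"
proof -
  let ?F = "\<lambda>z. X - resolvent a z o\<^sub>C\<^sub>L X" and ?G = "\<lambda>w. X o\<^sub>C\<^sub>L resolvent c w"
  have "?F 0 = ?G 0"
  proof (rule disc_analytic_Liouville[where F = ?F and G = ?G])
    fix z w :: complex assume z: "norm z = 1" "z * w = 1"
    from cross_identity[OF a c z, of X] X
    show "?F z = ?G w" by (simp add: compose.zero_left compose.zero_right algebra_simps)
  qed (simp_all add: disc_analytic_intros disc_analytic_resolvent a c)
  then show ?thesis by simp
qed

text \<open>A plus realization times a minus realization has a stable representation, whose coefficients
  are determined by the solution \<open>P\<close> of a Stein equation.\<close>

lemma product_of_realizations:
  fixes \<alpha>\<^sub>p :: "'p :: complex_hilbert \<Rightarrow>\<^sub>C\<^sub>L 'p" and \<alpha>\<^sub>m :: "'m :: complex_hilbert \<Rightarrow>\<^sub>C\<^sub>L 'm"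
  assumes stable: "disc_stable \<alpha>\<^sub>p" "disc_stable \<alpha>\<^sub>m" and z: "norm z = 1" "z * w = 1"
    and c1: "P - \<alpha>\<^sub>p o\<^sub>C\<^sub>L P o\<^sub>C\<^sub>L \<alpha>\<^sub>m - G o\<^sub>C\<^sub>L H = 0"
    and c2: "\<beta>\<^sub>p - G o\<^sub>C\<^sub>L D\<^sub>m - \<alpha>\<^sub>p o\<^sub>C\<^sub>L P o\<^sub>C\<^sub>L \<beta>\<^sub>m = 0"
    and c3: "\<gamma>\<^sub>m - D\<^sub>p o\<^sub>C\<^sub>L H - \<gamma>\<^sub>p o\<^sub>C\<^sub>L P o\<^sub>C\<^sub>L \<alpha>\<^sub>m = 0"
  shows "(D\<^sub>p + z *\<^sub>C (\<gamma>\<^sub>p o\<^sub>C\<^sub>L resolvent \<alpha>\<^sub>p z o\<^sub>C\<^sub>L G)) o\<^sub>C\<^sub>L (D\<^sub>m + w *\<^sub>C (H o\<^sub>C\<^sub>L resolvent \<alpha>\<^sub>m w o\<^sub>C\<^sub>L \<beta>\<^sub>m))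
    = D\<^sub>p o\<^sub>C\<^sub>L D\<^sub>m + \<gamma>\<^sub>p o\<^sub>C\<^sub>L P o\<^sub>C\<^sub>L \<beta>\<^sub>m
      + z *\<^sub>C (\<gamma>\<^sub>p o\<^sub>C\<^sub>L resolvent \<alpha>\<^sub>p z o\<^sub>C\<^sub>L \<beta>\<^sub>p) + w *\<^sub>C (\<gamma>\<^sub>m o\<^sub>C\<^sub>L resolvent \<alpha>\<^sub>m w o\<^sub>C\<^sub>L \<beta>\<^sub>m)"
proof -
  let ?p = "resolvent \<alpha>\<^sub>p z" and ?m = "resolvent \<alpha>\<^sub>m w"
  have w: "norm w = 1" "w * z = 1"
    using z by (metis mult_1 norm_mult norm_one, simp add: mult.commute)
  have "P - \<alpha>\<^sub>p o\<^sub>C\<^sub>L P o\<^sub>C\<^sub>L \<alpha>\<^sub>m = G o\<^sub>C\<^sub>L H"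
    using c1 by simp
  from cross_identity[OF stable z, of P, unfolded this]
  have x: "?p o\<^sub>C\<^sub>L (G o\<^sub>C\<^sub>L H) o\<^sub>C\<^sub>L ?m - (P o\<^sub>C\<^sub>L ?m + ?p o\<^sub>C\<^sub>L P - P) = 0" by simp
  have sp: "?p o\<^sub>C\<^sub>L \<alpha>\<^sub>p - w *\<^sub>C (?p - id_cblinfun) = 0" using resolvent_shift(1)[OF stable(1) z] by simp
  have sm: "\<alpha>\<^sub>m o\<^sub>C\<^sub>L ?m - z *\<^sub>C (?m - id_cblinfun) = 0" using resolvent_shift(2)[OF stable(2) w] by simp
  have "(D\<^sub>p + z *\<^sub>C (\<gamma>\<^sub>p o\<^sub>C\<^sub>L ?p o\<^sub>C\<^sub>L G)) o\<^sub>C\<^sub>L (D\<^sub>m + w *\<^sub>C (H o\<^sub>C\<^sub>L ?m o\<^sub>C\<^sub>L \<beta>\<^sub>m))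
    - (D\<^sub>p o\<^sub>C\<^sub>L D\<^sub>m + \<gamma>\<^sub>p o\<^sub>C\<^sub>L P o\<^sub>C\<^sub>L \<beta>\<^sub>m + z *\<^sub>C (\<gamma>\<^sub>p o\<^sub>C\<^sub>L ?p o\<^sub>C\<^sub>L \<beta>\<^sub>p) + w *\<^sub>C (\<gamma>\<^sub>m o\<^sub>C\<^sub>L ?m o\<^sub>C\<^sub>L \<beta>\<^sub>m))
    = \<gamma>\<^sub>p o\<^sub>C\<^sub>L (?p o\<^sub>C\<^sub>L (G o\<^sub>C\<^sub>L H) o\<^sub>C\<^sub>L ?m - (P o\<^sub>C\<^sub>L ?m + ?p o\<^sub>C\<^sub>L P - P)) o\<^sub>C\<^sub>L \<beta>\<^sub>m
      - z *\<^sub>C (\<gamma>\<^sub>p o\<^sub>C\<^sub>L ?p o\<^sub>C\<^sub>L (\<beta>\<^sub>p - G o\<^sub>C\<^sub>L D\<^sub>m - \<alpha>\<^sub>p o\<^sub>C\<^sub>L P o\<^sub>C\<^sub>L \<beta>\<^sub>m))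
      - w *\<^sub>C ((\<gamma>\<^sub>m - D\<^sub>p o\<^sub>C\<^sub>L H - \<gamma>\<^sub>p o\<^sub>C\<^sub>L P o\<^sub>C\<^sub>L \<alpha>\<^sub>m) o\<^sub>C\<^sub>L ?m o\<^sub>C\<^sub>L \<beta>\<^sub>m)
      - z *\<^sub>C (\<gamma>\<^sub>p o\<^sub>C\<^sub>L (?p o\<^sub>C\<^sub>L \<alpha>\<^sub>p - w *\<^sub>C (?p - id_cblinfun)) o\<^sub>C\<^sub>L P o\<^sub>C\<^sub>L \<beta>\<^sub>m)
      - w *\<^sub>C (\<gamma>\<^sub>p o\<^sub>C\<^sub>L P o\<^sub>C\<^sub>L (\<alpha>\<^sub>m o\<^sub>C\<^sub>L ?m - z *\<^sub>C (?m - id_cblinfun)) o\<^sub>C\<^sub>L \<beta>\<^sub>m)"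
    by (simp add: compose_expand z w algebra_simps)
  also have "\<dots> = 0"
    unfolding x c2 c3 sp sm by (simp add: compose.zero_left compose.zero_right)
  finally show ?thesis by (simp only: right_minus_eq)
qed

lemma invertible_swap:
  assumes "cblinfun_invertible (id_cblinfun - Q o\<^sub>C\<^sub>L Z)"
  shows "cblinfun_invertible (id_cblinfun - Z o\<^sub>C\<^sub>L Q)"
proof -
  let ?M = "id_cblinfun - Q o\<^sub>C\<^sub>L Z"
  have "cblinfun_invertible (id_cblinfun + Z o\<^sub>C\<^sub>L cblinfun_inv id_cblinfun o\<^sub>C\<^sub>L - Q)"
    by (rule invertible_woodbury)
      (use assms in \<open>simp_all add: invertible_id compose_expand cblinfun_inv_unique[of id_cblinfun id_cblinfun]\<close>)
  then show ?thesis by (simp add: compose_expand cblinfun_inv_unique[of id_cblinfun id_cblinfun])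
qed

section \<open>From invertibility to a left factorization and back\<close>

text \<open>The stability conditions are added, and \<open>R\<close> is given on the unit circle.\<close>

locale wiener_hopf_realization = riccati_lyapunov +
  fixes R :: "complex \<Rightarrow> 'a \<Rightarrow>\<^sub>C\<^sub>L 'a"
  assumes stable: "disc_stable \<alpha>\<^sub>p" "disc_stable \<alpha>\<^sub>m" "disc_stable a" "disc_stable b"
    and realization: "\<And>z w. norm z = 1 \<Longrightarrow> z * w = 1 \<Longrightarrow>
      R z = \<delta> + z *\<^sub>C (\<gamma>\<^sub>p o\<^sub>C\<^sub>L resolvent \<alpha>\<^sub>p z o\<^sub>C\<^sub>L \<beta>\<^sub>p) + w *\<^sub>C (\<gamma>\<^sub>m o\<^sub>C\<^sub>L resolvent \<alpha>\<^sub>m w o\<^sub>C\<^sub>L \<beta>\<^sub>m)"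
begin

lemma identities:
  "M o\<^sub>C\<^sub>L b - \<alpha>\<^sub>m o\<^sub>C\<^sub>L M - \<beta>\<^sub>m o\<^sub>C\<^sub>L \<gamma>' = 0"
  "a o\<^sub>C\<^sub>L N - N o\<^sub>C\<^sub>L \<alpha>\<^sub>p + \<beta>' o\<^sub>C\<^sub>L \<gamma>\<^sub>p = 0"
  "\<beta>' o\<^sub>C\<^sub>L \<delta> - N o\<^sub>C\<^sub>L \<beta>\<^sub>p - a o\<^sub>C\<^sub>L Z o\<^sub>C\<^sub>L \<beta>\<^sub>m = 0"
  "\<gamma>\<^sub>m o\<^sub>C\<^sub>L M + \<delta> o\<^sub>C\<^sub>L \<gamma>' + \<gamma>\<^sub>p o\<^sub>C\<^sub>L Z o\<^sub>C\<^sub>L b = 0"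
  "\<alpha>\<^sub>p o\<^sub>C\<^sub>L Z o\<^sub>C\<^sub>L b - Z + \<beta>\<^sub>p o\<^sub>C\<^sub>L \<gamma>' = 0"
  "a o\<^sub>C\<^sub>L Z o\<^sub>C\<^sub>L \<alpha>\<^sub>m - Z - \<beta>' o\<^sub>C\<^sub>L \<gamma>\<^sub>m = 0"
  by (simp_all add: M_b a_N \<beta>'_\<delta> \<delta>_\<gamma>' \<alpha>\<^sub>p_Z_b a_Z_\<alpha>\<^sub>m)

text \<open>The left factors have the input operator \<open>G\<close> and the output operator \<open>H\<close>, and the Stein
  operator that couples them is \<open>P = - Z M\<^sup>-\<^sup>1 = - N\<^sup>-\<^sup>1 Z\<close>.\<close>

lemma left_factorization:
  assumes M: "cblinfun_invertible M" and R1: "cblinfun_invertible (R 1)"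
  shows "left_canonical_WH R"
proof -
  have N: "cblinfun_invertible N"
    using M unfolding M_def N_def by (rule invertible_swap)
  define Mi where "Mi = cblinfun_inv M"
  define Ni where "Ni = cblinfun_inv N"
  have Mi: "M o\<^sub>C\<^sub>L Mi = id_cblinfun" "Mi o\<^sub>C\<^sub>L M = id_cblinfun"
    and Ni: "N o\<^sub>C\<^sub>L Ni = id_cblinfun" "Ni o\<^sub>C\<^sub>L N = id_cblinfun"
    using M N cblinfun_inv_works unfolding Mi_def Ni_def by blast+
  have Ni': "Ni o\<^sub>C\<^sub>L (N o\<^sub>C\<^sub>L A) = A" "N o\<^sub>C\<^sub>L (Ni o\<^sub>C\<^sub>L A) = A" for A :: "'x :: complex_hilbert \<Rightarrow>\<^sub>C\<^sub>L 'b"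
    using inv_cancel[OF N] unfolding Ni_def by blast+
  define P where "P = - (Z o\<^sub>C\<^sub>L Mi)"
  define D where "D = \<delta> - \<gamma>\<^sub>p o\<^sub>C\<^sub>L P o\<^sub>C\<^sub>L \<beta>\<^sub>m"
  define G where "G = Ni o\<^sub>C\<^sub>L \<beta>'"
  define H where "H = - (D o\<^sub>C\<^sub>L \<gamma>' o\<^sub>C\<^sub>L Mi)"
  have "N o\<^sub>C\<^sub>L Z = Z o\<^sub>C\<^sub>L M" by (simp add: N_def M_def compose_expand)
  then have "N o\<^sub>C\<^sub>L P = - (Z o\<^sub>C\<^sub>L M o\<^sub>C\<^sub>L Mi)" by (simp add: P_def compose_expand flip: compose_assoc)
  then have fNP: "N o\<^sub>C\<^sub>L P + Z = 0" by (simp add: compose_expand Mi)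
  have fPM: "P o\<^sub>C\<^sub>L M + Z = 0" by (simp add: P_def compose_expand Mi)
  have fG: "N o\<^sub>C\<^sub>L G - \<beta>' = 0" by (simp add: G_def Ni')
  have fH: "H o\<^sub>C\<^sub>L M + D o\<^sub>C\<^sub>L \<gamma>' = 0" by (simp add: H_def compose_expand Mi)
  have fD: "D - \<delta> + \<gamma>\<^sub>p o\<^sub>C\<^sub>L P o\<^sub>C\<^sub>L \<beta>\<^sub>m = 0" by (simp add: D_def)
  note zeros = identities fNP fPM fG fH fD
  have "N o\<^sub>C\<^sub>L (P - \<alpha>\<^sub>p o\<^sub>C\<^sub>L P o\<^sub>C\<^sub>L \<alpha>\<^sub>m - G o\<^sub>C\<^sub>L H) o\<^sub>C\<^sub>L M
    = (N o\<^sub>C\<^sub>L P + Z) o\<^sub>C\<^sub>L M - a o\<^sub>C\<^sub>L (N o\<^sub>C\<^sub>L P + Z) o\<^sub>C\<^sub>L \<alpha>\<^sub>m o\<^sub>C\<^sub>L M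
      + (a o\<^sub>C\<^sub>L Z o\<^sub>C\<^sub>L \<alpha>\<^sub>m - Z - \<beta>' o\<^sub>C\<^sub>L \<gamma>\<^sub>m) o\<^sub>C\<^sub>L M
      + (a o\<^sub>C\<^sub>L N - N o\<^sub>C\<^sub>L \<alpha>\<^sub>p + \<beta>' o\<^sub>C\<^sub>L \<gamma>\<^sub>p) o\<^sub>C\<^sub>L P o\<^sub>C\<^sub>L \<alpha>\<^sub>m o\<^sub>C\<^sub>L M
      - \<beta>' o\<^sub>C\<^sub>L \<gamma>\<^sub>p o\<^sub>C\<^sub>L (P o\<^sub>C\<^sub>L M + Z) o\<^sub>C\<^sub>L b
      + \<beta>' o\<^sub>C\<^sub>L \<gamma>\<^sub>p o\<^sub>C\<^sub>L P o\<^sub>C\<^sub>L (M o\<^sub>C\<^sub>L b - \<alpha>\<^sub>m o\<^sub>C\<^sub>L M - \<beta>\<^sub>m o\<^sub>C\<^sub>L \<gamma>')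
      - (N o\<^sub>C\<^sub>L G - \<beta>') o\<^sub>C\<^sub>L H o\<^sub>C\<^sub>L M - \<beta>' o\<^sub>C\<^sub>L (H o\<^sub>C\<^sub>L M + D o\<^sub>C\<^sub>L \<gamma>')
      + \<beta>' o\<^sub>C\<^sub>L (D - \<delta> + \<gamma>\<^sub>p o\<^sub>C\<^sub>L P o\<^sub>C\<^sub>L \<beta>\<^sub>m) o\<^sub>C\<^sub>L \<gamma>'
      + \<beta>' o\<^sub>C\<^sub>L (\<gamma>\<^sub>m o\<^sub>C\<^sub>L M + \<delta> o\<^sub>C\<^sub>L \<gamma>' + \<gamma>\<^sub>p o\<^sub>C\<^sub>L Z o\<^sub>C\<^sub>L b)"
    by (simp add: compose_expand algebra_simps)
  also have "\<dots> = 0" by (simp only: zeros zero_simps)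
  finally have "Ni o\<^sub>C\<^sub>L (N o\<^sub>C\<^sub>L (P - \<alpha>\<^sub>p o\<^sub>C\<^sub>L P o\<^sub>C\<^sub>L \<alpha>\<^sub>m - G o\<^sub>C\<^sub>L H) o\<^sub>C\<^sub>L M) o\<^sub>C\<^sub>L Mi = 0"
    by (simp only: zero_simps)
  then have c1: "P - \<alpha>\<^sub>p o\<^sub>C\<^sub>L P o\<^sub>C\<^sub>L \<alpha>\<^sub>m - G o\<^sub>C\<^sub>L H = 0"
    by (simp only: compose_assoc Ni' Mi compose_id)
  have "N o\<^sub>C\<^sub>L (\<beta>\<^sub>p - G o\<^sub>C\<^sub>L D - \<alpha>\<^sub>p o\<^sub>C\<^sub>L P o\<^sub>C\<^sub>L \<beta>\<^sub>m)
    = - (\<beta>' o\<^sub>C\<^sub>L \<delta> - N o\<^sub>C\<^sub>L \<beta>\<^sub>p - a o\<^sub>C\<^sub>L Z o\<^sub>C\<^sub>L \<beta>\<^sub>m) - (N o\<^sub>C\<^sub>L G - \<beta>') o\<^sub>C\<^sub>L D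
      - \<beta>' o\<^sub>C\<^sub>L (D - \<delta> + \<gamma>\<^sub>p o\<^sub>C\<^sub>L P o\<^sub>C\<^sub>L \<beta>\<^sub>m) - a o\<^sub>C\<^sub>L (N o\<^sub>C\<^sub>L P + Z) o\<^sub>C\<^sub>L \<beta>\<^sub>m
      + (a o\<^sub>C\<^sub>L N - N o\<^sub>C\<^sub>L \<alpha>\<^sub>p + \<beta>' o\<^sub>C\<^sub>L \<gamma>\<^sub>p) o\<^sub>C\<^sub>L P o\<^sub>C\<^sub>L \<beta>\<^sub>m"
    by (simp add: compose_expand algebra_simps)
  also have "\<dots> = 0" by (simp only: zeros zero_simps)
  finally have "Ni o\<^sub>C\<^sub>L (N o\<^sub>C\<^sub>L (\<beta>\<^sub>p - G o\<^sub>C\<^sub>L D - \<alpha>\<^sub>p o\<^sub>C\<^sub>L P o\<^sub>C\<^sub>L \<beta>\<^sub>m)) = 0"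
    by (simp only: zero_simps)
  then have c2: "\<beta>\<^sub>p - G o\<^sub>C\<^sub>L D - \<alpha>\<^sub>p o\<^sub>C\<^sub>L P o\<^sub>C\<^sub>L \<beta>\<^sub>m = 0"
    by (simp only: Ni')
  have "(\<gamma>\<^sub>m - id_cblinfun o\<^sub>C\<^sub>L H - \<gamma>\<^sub>p o\<^sub>C\<^sub>L P o\<^sub>C\<^sub>L \<alpha>\<^sub>m) o\<^sub>C\<^sub>L M
    = (\<gamma>\<^sub>m o\<^sub>C\<^sub>L M + \<delta> o\<^sub>C\<^sub>L \<gamma>' + \<gamma>\<^sub>p o\<^sub>C\<^sub>L Z o\<^sub>C\<^sub>L b) - (H o\<^sub>C\<^sub>L M + D o\<^sub>C\<^sub>L \<gamma>')
      + (D - \<delta> + \<gamma>\<^sub>p o\<^sub>C\<^sub>L P o\<^sub>C\<^sub>L \<beta>\<^sub>m) o\<^sub>C\<^sub>L \<gamma>' - \<gamma>\<^sub>p o\<^sub>C\<^sub>L (P o\<^sub>C\<^sub>L M + Z) o\<^sub>C\<^sub>L b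
      + \<gamma>\<^sub>p o\<^sub>C\<^sub>L P o\<^sub>C\<^sub>L (M o\<^sub>C\<^sub>L b - \<alpha>\<^sub>m o\<^sub>C\<^sub>L M - \<beta>\<^sub>m o\<^sub>C\<^sub>L \<gamma>')"
    by (simp add: compose_expand algebra_simps)
  also have "\<dots> = 0" by (simp only: zeros zero_simps)
  finally have "(\<gamma>\<^sub>m - id_cblinfun o\<^sub>C\<^sub>L H - \<gamma>\<^sub>p o\<^sub>C\<^sub>L P o\<^sub>C\<^sub>L \<alpha>\<^sub>m) o\<^sub>C\<^sub>L M o\<^sub>C\<^sub>L Mi = 0"
    by (simp only: zero_simps)
  then have c3: "\<gamma>\<^sub>m - id_cblinfun o\<^sub>C\<^sub>L H - \<gamma>\<^sub>p o\<^sub>C\<^sub>L P o\<^sub>C\<^sub>L \<alpha>\<^sub>m = 0"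
    by (simp only: compose_assoc Mi compose_id)
  define W\<^sub>p where "W\<^sub>p z = id_cblinfun + z *\<^sub>C (\<gamma>\<^sub>p o\<^sub>C\<^sub>L resolvent \<alpha>\<^sub>p z o\<^sub>C\<^sub>L G)" for z
  define W where "W w = D + w *\<^sub>C (H o\<^sub>C\<^sub>L resolvent \<alpha>\<^sub>m w o\<^sub>C\<^sub>L \<beta>\<^sub>m)" for w
  have R_eq: "R z = W\<^sub>p z o\<^sub>C\<^sub>L W w" if "norm z = 1" "z * w = 1" for z w
    unfolding W\<^sub>p_def W_def product_of_realizations[OF stable(1,2) that c1 c2 c3] realization[OF that]
    by (simp add: D_def)
  have id_inv: "cblinfun_inv id_cblinfun = (id_cblinfun :: 'x :: complex_hilbert \<Rightarrow>\<^sub>C\<^sub>L 'x)"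
    by (rule cblinfun_inv_unique) simp_all
  have W\<^sub>p_inv: "cblinfun_invertible (W\<^sub>p z)" if "norm z \<le> 1" for z
  proof -
    have "Ni o\<^sub>C\<^sub>L (id_cblinfun - z *\<^sub>C a) o\<^sub>C\<^sub>L N
      = id_cblinfun - z *\<^sub>C \<alpha>\<^sub>p + G o\<^sub>C\<^sub>L cblinfun_inv id_cblinfun o\<^sub>C\<^sub>L z *\<^sub>C \<gamma>\<^sub>p"
      by (simp add: compose_expand id_inv a_N Ni Ni' G_def)
    moreover have "cblinfun_invertible (Ni o\<^sub>C\<^sub>L (id_cblinfun - z *\<^sub>C a) o\<^sub>C\<^sub>L N)"
      using stable(3) that N by (auto intro!: invertible_comp invertible_inv simp: Ni_def disc_stable_def)
    ultimately have S: "cblinfun_invertible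
        (id_cblinfun - z *\<^sub>C \<alpha>\<^sub>p + G o\<^sub>C\<^sub>L cblinfun_inv id_cblinfun o\<^sub>C\<^sub>L z *\<^sub>C \<gamma>\<^sub>p)"
      by (simp only:)
    have "cblinfun_invertible
        (id_cblinfun + z *\<^sub>C \<gamma>\<^sub>p o\<^sub>C\<^sub>L cblinfun_inv (id_cblinfun - z *\<^sub>C \<alpha>\<^sub>p) o\<^sub>C\<^sub>L G)"
      by (rule invertible_woodbury[OF invertible_id _ S]) (use stable(1) that in \<open>simp add: disc_stable_def\<close>)
    then show ?thesis by (simp add: W\<^sub>p_def resolvent_def compose_scaleC)
  qed
  \<comment> \<open>The minus factor is \<open>D U\<close>; the invertibility of \<open>U\<close> is
    needed first, to obtain that of \<open>D\<close>.\<close>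
  define U where "U w = id_cblinfun - w *\<^sub>C (\<gamma>' o\<^sub>C\<^sub>L Mi o\<^sub>C\<^sub>L resolvent \<alpha>\<^sub>m w o\<^sub>C\<^sub>L \<beta>\<^sub>m)" for w
  have U_inv: "cblinfun_invertible (U w)" if "norm w \<le> 1" for w
  proof -
    have "M o\<^sub>C\<^sub>L (id_cblinfun - w *\<^sub>C b) o\<^sub>C\<^sub>L Mi = id_cblinfun - w *\<^sub>C (M o\<^sub>C\<^sub>L b o\<^sub>C\<^sub>L Mi)"
      by (simp add: compose_expand Mi)
    also have "\<dots> = id_cblinfun - w *\<^sub>C \<alpha>\<^sub>m + \<beta>\<^sub>m o\<^sub>C\<^sub>L cblinfun_inv id_cblinfun o\<^sub>C\<^sub>L - (w *\<^sub>C (\<gamma>' o\<^sub>C\<^sub>L Mi))"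
      unfolding M_b by (simp add: compose_expand id_inv Mi)
    finally have "M o\<^sub>C\<^sub>L (id_cblinfun - w *\<^sub>C b) o\<^sub>C\<^sub>L Mi = \<dots>" .
    moreover have "cblinfun_invertible (M o\<^sub>C\<^sub>L (id_cblinfun - w *\<^sub>C b) o\<^sub>C\<^sub>L Mi)"
      using stable(4) that M by (auto intro!: invertible_comp invertible_inv simp: Mi_def disc_stable_def)
    ultimately have S: "cblinfun_invertible
        (id_cblinfun - w *\<^sub>C \<alpha>\<^sub>m + \<beta>\<^sub>m o\<^sub>C\<^sub>L cblinfun_inv id_cblinfun o\<^sub>C\<^sub>L - (w *\<^sub>C (\<gamma>' o\<^sub>C\<^sub>L Mi)))"
      by (simp only:)
    have "cblinfun_invertible
        (id_cblinfun + - (w *\<^sub>C (\<gamma>' o\<^sub>C\<^sub>L Mi)) o\<^sub>C\<^sub>L cblinfun_inv (id_cblinfun - w *\<^sub>C \<alpha>\<^sub>m) o\<^sub>C\<^sub>L \<beta>\<^sub>m)"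
      by (rule invertible_woodbury[OF invertible_id _ S]) (use stable(2) that in \<open>simp add: disc_stable_def\<close>)
    then show ?thesis by (simp add: U_def resolvent_def compose_expand)
  qed
  have W_U: "W w = D o\<^sub>C\<^sub>L U w" for w
    by (simp add: W_def U_def H_def compose_expand)
  have D: "cblinfun_invertible D"
  proof -
    \<comment> \<open>The point \<open>1\<close> is an arbitrary choice on the unit circle.\<close>
    have "D = cblinfun_inv (W\<^sub>p 1) o\<^sub>C\<^sub>L R 1 o\<^sub>C\<^sub>L cblinfun_inv (U 1)"
      using R_eq[of 1 1] W\<^sub>p_inv[of 1] U_inv[of 1]
      by (simp add: W_U compose_assoc inv_cancel cblinfun_inv_works)
    then show ?thesis
      using R1 W\<^sub>p_inv[of 1] U_inv[of 1] by (simp add: invertible_comp invertible_inv)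
  qed
  have "plus_factor W\<^sub>p"
    unfolding W\<^sub>p_def[abs_def]
    by (intro plus_factorI disc_analytic_intros disc_analytic_resolvent stable W\<^sub>p_inv[unfolded W\<^sub>p_def])
  moreover have W_plus: "plus_factor W"
  proof (rule plus_factorI)
    show "disc_analytic W"
      unfolding W_def[abs_def] by (intro disc_analytic_intros disc_analytic_resolvent stable)
    show "cblinfun_invertible (W w)" if "norm w \<le> 1" for w
      unfolding W_U using D U_inv[OF that] by (rule invertible_comp)
  qed
  moreover have "(\<lambda>w. if w = 0 then D else W (inverse (inverse w))) = W"
    by (auto simp: W_def)
  then have "minus_factor (\<lambda>z. W (inverse z))"
    unfolding minus_factor_iff using W_plus by (intro exI[of _ D]) simp
  moreover have "R z = W\<^sub>p z o\<^sub>C\<^sub>L W (inverse z)" if "z \<in> sphere 0 1" for z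
    using that by (intro R_eq right_inverse) auto
  ultimately show ?thesis
    unfolding left_canonical_WH_def by blast
qed

end

context wiener_hopf_realization
begin

text \<open>The operators \<open>G\<close>, \<open>H\<close> and \<open>P\<close> are recovered from a given factorization by splitting, and the
  inverse of \<open>M\<close> is \<open>I - Q P\<close>.\<close>

lemma M_invertible:
  assumes "left_canonical_WH R"
  shows "cblinfun_invertible M"
proof -
  obtain W\<^sub>p W\<^sub>m where W\<^sub>p: "plus_factor W\<^sub>p" and W\<^sub>m: "minus_factor W\<^sub>m"
    and R_eq0: "\<And>z. z \<in> sphere 0 1 \<Longrightarrow> R z = W\<^sub>p z o\<^sub>C\<^sub>L W\<^sub>m z"
    using assms unfolding left_canonical_WH_def by blast
  obtain L where L: "plus_factor (\<lambda>w. if w = 0 then L else W\<^sub>m (inverse w))"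
    using W\<^sub>m unfolding minus_factor_iff by blast
  \<comment> \<open>The minus factor in the chart \<open>w = 1/z\<close>.\<close>
  define W where "W = (\<lambda>w. if w = 0 then L else W\<^sub>m (inverse w))"
  have W: "plus_factor W" using L by (simp add: W_def)
  have R_eq: "R z = W\<^sub>p z o\<^sub>C\<^sub>L W w" if "norm z = 1" "z * w = 1" for z w
  proof -
    have "w \<noteq> 0" "inverse w = z" using that by (auto simp: inverse_unique mult.commute)
    then show ?thesis using R_eq0[of z] that by (simp add: W_def)
  qed
  have norm_w: "norm w = 1" "w * z = 1" if "norm z = 1" "z * w = 1" for z w :: complex
    using that by (metis mult_1 norm_mult norm_one, simp add: mult.commute)
  define Y\<^sub>p where "Y\<^sub>p z = cblinfun_inv (W\<^sub>p z)" for z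
  define Y where "Y w = cblinfun_inv (W w)" for w
  have an: "disc_analytic W\<^sub>p" "disc_analytic W" "disc_analytic Y\<^sub>p" "disc_analytic Y"
    using plus_factorD(1,2)[OF W\<^sub>p] plus_factorD(1,2)[OF W] by (simp_all add: Y\<^sub>p_def[abs_def] Y_def[abs_def])
  note analytic = disc_analytic_intros disc_analytic_resolvent stable an
  have Y\<^sub>p: "W\<^sub>p z o\<^sub>C\<^sub>L Y\<^sub>p z = id_cblinfun" "Y\<^sub>p z o\<^sub>C\<^sub>L W\<^sub>p z = id_cblinfun" if "norm z = 1" for z
    using cblinfun_inv_works[OF plus_factorD(3)[OF W\<^sub>p]] that by (simp_all add: Y\<^sub>p_def)
  have Y: "W w o\<^sub>C\<^sub>L Y w = id_cblinfun" "Y w o\<^sub>C\<^sub>L W w = id_cblinfun" if "norm w = 1" for w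
    using cblinfun_inv_works[OF plus_factorD(3)[OF W]] that by (simp_all add: Y_def)

  obtain H K where K: "disc_analytic K"
    and HK: "\<And>z w. norm z = 1 \<Longrightarrow> z * w = 1 \<Longrightarrow>
      Y\<^sub>p z o\<^sub>C\<^sub>L \<gamma>\<^sub>m o\<^sub>C\<^sub>L resolvent \<alpha>\<^sub>m w = H o\<^sub>C\<^sub>L resolvent \<alpha>\<^sub>m w + z *\<^sub>C K z"
    by (rule split_right[of "\<lambda>z. Y\<^sub>p z o\<^sub>C\<^sub>L \<gamma>\<^sub>m" \<alpha>\<^sub>m]) ((intro analytic; fail)+, rule that)
  obtain G E' where E': "disc_analytic E'"
    and GE: "\<And>z w. norm w = 1 \<Longrightarrow> w * z = 1 \<Longrightarrow>
      resolvent \<alpha>\<^sub>p z o\<^sub>C\<^sub>L (\<beta>\<^sub>p o\<^sub>C\<^sub>L Y w) = resolvent \<alpha>\<^sub>p z o\<^sub>C\<^sub>L G + w *\<^sub>C E' w"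
    by (rule split_left[of "\<lambda>w. \<beta>\<^sub>p o\<^sub>C\<^sub>L Y w" \<alpha>\<^sub>p]) ((intro analytic; fail)+, rule that)
  obtain P K\<^sub>2 where K\<^sub>2: "disc_analytic K\<^sub>2"
    and PK: "\<And>z w. norm z = 1 \<Longrightarrow> z * w = 1 \<Longrightarrow>
      resolvent \<alpha>\<^sub>p z o\<^sub>C\<^sub>L (G o\<^sub>C\<^sub>L H) o\<^sub>C\<^sub>L resolvent \<alpha>\<^sub>m w = P o\<^sub>C\<^sub>L resolvent \<alpha>\<^sub>m w + z *\<^sub>C K\<^sub>2 z"
    by (rule split_right[of "\<lambda>z. resolvent \<alpha>\<^sub>p z o\<^sub>C\<^sub>L (G o\<^sub>C\<^sub>L H)" \<alpha>\<^sub>m]) ((intro analytic; fail)+, rule that)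
  note analytic = analytic K E' K\<^sub>2
  define D\<^sub>p where "D\<^sub>p = W\<^sub>p 0"
  define D\<^sub>m where "D\<^sub>m = W 0"

  \<comment> \<open>On the circle \<open>W\<^sub>p = R W\<^sub>m\<^sup>-\<^sup>1\<close>; apart from
    the stated term, the right side is analytic outside, so the remainder is constant.\<close>
  have W\<^sub>p_eq: "W\<^sub>p z = D\<^sub>p + z *\<^sub>C (\<gamma>\<^sub>p o\<^sub>C\<^sub>L resolvent \<alpha>\<^sub>p z o\<^sub>C\<^sub>L G)" if z: "norm z \<le> 1" for z
  proof -
    let ?F = "\<lambda>z. W\<^sub>p z - z *\<^sub>C (\<gamma>\<^sub>p o\<^sub>C\<^sub>L resolvent \<alpha>\<^sub>p z o\<^sub>C\<^sub>L G)"
    let ?G = "\<lambda>w. \<delta> o\<^sub>C\<^sub>L Y w + w *\<^sub>C (\<gamma>\<^sub>m o\<^sub>C\<^sub>L resolvent \<alpha>\<^sub>m w o\<^sub>C\<^sub>L \<beta>\<^sub>m o\<^sub>C\<^sub>L Y w) + \<gamma>\<^sub>p o\<^sub>C\<^sub>L E' w"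
    have "?F z = ?G 0" if "norm z \<le> 1" for z
    proof (rule disc_analytic_Liouville[where F = ?F and G = ?G])
      fix z w :: complex assume z: "norm z = 1" "z * w = 1"
      note w = norm_w[OF z]
      have "W\<^sub>p z = R z o\<^sub>C\<^sub>L Y w"
        using R_eq[OF z] Y[OF w(1)] by (simp add: compose_assoc)
      also have "\<dots> = \<delta> o\<^sub>C\<^sub>L Y w + z *\<^sub>C (\<gamma>\<^sub>p o\<^sub>C\<^sub>L (resolvent \<alpha>\<^sub>p z o\<^sub>C\<^sub>L (\<beta>\<^sub>p o\<^sub>C\<^sub>L Y w)))
          + w *\<^sub>C (\<gamma>\<^sub>m o\<^sub>C\<^sub>L resolvent \<alpha>\<^sub>m w o\<^sub>C\<^sub>L \<beta>\<^sub>m o\<^sub>C\<^sub>L Y w)"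
        unfolding realization[OF z] by (simp add: compose_expand)
      finally show "?F z = ?G w"
        unfolding GE[OF w] by (simp add: compose_expand z w algebra_simps)
    qed (use that in \<open>auto intro!: analytic\<close>)
    from this[OF z] this[of 0] show ?thesis by (simp add: D\<^sub>p_def algebra_simps)
  qed
  \<comment> \<open>The same argument for \<open>W\<^sub>m = W\<^sub>p\<^sup>-\<^sup>1
    R\<close>.\<close>
  have W_eq: "W w = D\<^sub>m + w *\<^sub>C (H o\<^sub>C\<^sub>L resolvent \<alpha>\<^sub>m w o\<^sub>C\<^sub>L \<beta>\<^sub>m)" if w: "norm w \<le> 1" for w
  proof -
    let ?F = "\<lambda>w. W w - w *\<^sub>C (H o\<^sub>C\<^sub>L resolvent \<alpha>\<^sub>m w o\<^sub>C\<^sub>L \<beta>\<^sub>m)"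
    let ?G = "\<lambda>z. Y\<^sub>p z o\<^sub>C\<^sub>L \<delta> + z *\<^sub>C (Y\<^sub>p z o\<^sub>C\<^sub>L \<gamma>\<^sub>p o\<^sub>C\<^sub>L resolvent \<alpha>\<^sub>p z o\<^sub>C\<^sub>L \<beta>\<^sub>p) + K z o\<^sub>C\<^sub>L \<beta>\<^sub>m"
    have "?F w = ?G 0" if "norm w \<le> 1" for w
    proof (rule disc_analytic_Liouville[where F = ?F and G = ?G])
      fix w z :: complex assume w: "norm w = 1" "w * z = 1"
      note z = norm_w[OF w]
      have "W w = Y\<^sub>p z o\<^sub>C\<^sub>L R z"
        using R_eq[OF z] Y\<^sub>p[OF z(1)] by (simp flip: compose_assoc)
      also have "\<dots> = Y\<^sub>p z o\<^sub>C\<^sub>L \<delta> + z *\<^sub>C (Y\<^sub>p z o\<^sub>C\<^sub>L \<gamma>\<^sub>p o\<^sub>C\<^sub>L resolvent \<alpha>\<^sub>p z o\<^sub>C\<^sub>L \<beta>\<^sub>p)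
          + w *\<^sub>C (Y\<^sub>p z o\<^sub>C\<^sub>L \<gamma>\<^sub>m o\<^sub>C\<^sub>L resolvent \<alpha>\<^sub>m w o\<^sub>C\<^sub>L \<beta>\<^sub>m)"
        unfolding realization[OF z] by (simp add: compose_expand)
      finally show "?F w = ?G z"
        unfolding HK[OF z] by (simp add: compose_expand z w algebra_simps)
    qed (use that in \<open>auto intro!: analytic\<close>)
    from this[OF w] this[of 0] show ?thesis by (simp add: D\<^sub>m_def algebra_simps)
  qed

  \<comment> \<open>Multiplying the splitting by \<open>I - z \<alpha>\<^sub>p\<close> leaves a
    function analytic outside that equals one analytic inside and vanishing at \<open>0\<close>.\<close>
  have c1: "P - \<alpha>\<^sub>p o\<^sub>C\<^sub>L P o\<^sub>C\<^sub>L \<alpha>\<^sub>m - G o\<^sub>C\<^sub>L H = 0"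
  proof -
    let ?F = "\<lambda>w. (G o\<^sub>C\<^sub>L H - P + \<alpha>\<^sub>p o\<^sub>C\<^sub>L P o\<^sub>C\<^sub>L \<alpha>\<^sub>m) o\<^sub>C\<^sub>L resolvent \<alpha>\<^sub>m w"
    let ?G = "\<lambda>z. z *\<^sub>C (K\<^sub>2 z - z *\<^sub>C (\<alpha>\<^sub>p o\<^sub>C\<^sub>L K\<^sub>2 z)) - z *\<^sub>C (\<alpha>\<^sub>p o\<^sub>C\<^sub>L P)"
    have "?F 0 = ?G 0"
    proof (rule disc_analytic_Liouville[where F = ?F and G = ?G])
      fix w z :: complex assume w: "norm w = 1" "w * z = 1"
      note z = norm_w[OF w]
      have "G o\<^sub>C\<^sub>L H o\<^sub>C\<^sub>L resolvent \<alpha>\<^sub>m w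
        = (id_cblinfun - z *\<^sub>C \<alpha>\<^sub>p) o\<^sub>C\<^sub>L resolvent \<alpha>\<^sub>p z o\<^sub>C\<^sub>L (G o\<^sub>C\<^sub>L H o\<^sub>C\<^sub>L resolvent \<alpha>\<^sub>m w)"
        using resolvent_works[OF stable(1), of z] z by simp
      also have "\<dots> = (id_cblinfun - z *\<^sub>C \<alpha>\<^sub>p) o\<^sub>C\<^sub>L (resolvent \<alpha>\<^sub>p z o\<^sub>C\<^sub>L (G o\<^sub>C\<^sub>L H) o\<^sub>C\<^sub>L resolvent \<alpha>\<^sub>m w)"
        by (simp add: compose_assoc)
      finally have GH: "G o\<^sub>C\<^sub>L H o\<^sub>C\<^sub>L resolvent \<alpha>\<^sub>m w
        = (id_cblinfun - z *\<^sub>C \<alpha>\<^sub>p) o\<^sub>C\<^sub>L (P o\<^sub>C\<^sub>L resolvent \<alpha>\<^sub>m w + z *\<^sub>C K\<^sub>2 z)"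
        unfolding PK[OF z] .
      have "?F w = G o\<^sub>C\<^sub>L H o\<^sub>C\<^sub>L resolvent \<alpha>\<^sub>m w - P o\<^sub>C\<^sub>L resolvent \<alpha>\<^sub>m w
          + \<alpha>\<^sub>p o\<^sub>C\<^sub>L P o\<^sub>C\<^sub>L (\<alpha>\<^sub>m o\<^sub>C\<^sub>L resolvent \<alpha>\<^sub>m w)"
        by (simp add: compose_expand)
      then show "?F w = ?G z"
        unfolding GH resolvent_shift(2)[OF stable(2) w] by (simp add: compose_expand z w algebra_simps)
    qed (auto intro!: analytic)
    then show ?thesis by (simp add: algebra_simps)
  qed
  have GH: "G o\<^sub>C\<^sub>L H = P - \<alpha>\<^sub>p o\<^sub>C\<^sub>L P o\<^sub>C\<^sub>L \<alpha>\<^sub>m" using c1 by simp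
  have cross: "resolvent \<alpha>\<^sub>p z o\<^sub>C\<^sub>L (G o\<^sub>C\<^sub>L H) o\<^sub>C\<^sub>L resolvent \<alpha>\<^sub>m w
      = P o\<^sub>C\<^sub>L resolvent \<alpha>\<^sub>m w + resolvent \<alpha>\<^sub>p z o\<^sub>C\<^sub>L P - P" if "norm z = 1" "z * w = 1" for z w
    unfolding GH by (rule cross_identity[OF stable(1,2) that])

  \<comment> \<open>Without minimality of the realization, \<open>c2\<close> and \<open>c3\<close>
    cannot be read off from \<open>R\<close>; they come from the splittings that define \<open>G\<close>
    and \<open>H\<close>.\<close>
  have c2: "\<beta>\<^sub>p - G o\<^sub>C\<^sub>L D\<^sub>m - \<alpha>\<^sub>p o\<^sub>C\<^sub>L P o\<^sub>C\<^sub>L \<beta>\<^sub>m = 0"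
  proof -
    let ?F = "\<lambda>z. resolvent \<alpha>\<^sub>p z o\<^sub>C\<^sub>L (\<beta>\<^sub>p - G o\<^sub>C\<^sub>L D\<^sub>m - \<alpha>\<^sub>p o\<^sub>C\<^sub>L P o\<^sub>C\<^sub>L \<beta>\<^sub>m)"
    let ?G = "\<lambda>w. w *\<^sub>C (P o\<^sub>C\<^sub>L resolvent \<alpha>\<^sub>m w o\<^sub>C\<^sub>L \<beta>\<^sub>m + E' w o\<^sub>C\<^sub>L W w)"
    have "?F 0 = ?G 0"
    proof (rule disc_analytic_Liouville[where F = ?F and G = ?G])
      fix z w :: complex assume z: "norm z = 1" "z * w = 1"
      note w = norm_w[OF z]
      have "resolvent \<alpha>\<^sub>p z o\<^sub>C\<^sub>L \<beta>\<^sub>p = resolvent \<alpha>\<^sub>p z o\<^sub>C\<^sub>L (\<beta>\<^sub>p o\<^sub>C\<^sub>L Y w) o\<^sub>C\<^sub>L W w"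
        using Y[OF w(1)] by (simp add: compose_assoc)
      also have "\<dots> = resolvent \<alpha>\<^sub>p z o\<^sub>C\<^sub>L G o\<^sub>C\<^sub>L W w + w *\<^sub>C (E' w o\<^sub>C\<^sub>L W w)"
        unfolding GE[OF w] by (simp add: compose_expand)
      also have "resolvent \<alpha>\<^sub>p z o\<^sub>C\<^sub>L G o\<^sub>C\<^sub>L W w = resolvent \<alpha>\<^sub>p z o\<^sub>C\<^sub>L G o\<^sub>C\<^sub>L D\<^sub>m
          + w *\<^sub>C (resolvent \<alpha>\<^sub>p z o\<^sub>C\<^sub>L (G o\<^sub>C\<^sub>L H) o\<^sub>C\<^sub>L resolvent \<alpha>\<^sub>m w o\<^sub>C\<^sub>L \<beta>\<^sub>m)"
        unfolding W_eq[OF eq_refl[OF w(1)]] by (simp add: compose_expand)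
      finally have 1: "resolvent \<alpha>\<^sub>p z o\<^sub>C\<^sub>L \<beta>\<^sub>p = resolvent \<alpha>\<^sub>p z o\<^sub>C\<^sub>L G o\<^sub>C\<^sub>L D\<^sub>m
          + w *\<^sub>C ((P o\<^sub>C\<^sub>L resolvent \<alpha>\<^sub>m w + resolvent \<alpha>\<^sub>p z o\<^sub>C\<^sub>L P - P) o\<^sub>C\<^sub>L \<beta>\<^sub>m) + w *\<^sub>C (E' w o\<^sub>C\<^sub>L W w)"
        unfolding cross[OF z] .
      have "?F z = resolvent \<alpha>\<^sub>p z o\<^sub>C\<^sub>L \<beta>\<^sub>p - resolvent \<alpha>\<^sub>p z o\<^sub>C\<^sub>L G o\<^sub>C\<^sub>L D\<^sub>m
          - (resolvent \<alpha>\<^sub>p z o\<^sub>C\<^sub>L \<alpha>\<^sub>p) o\<^sub>C\<^sub>L P o\<^sub>C\<^sub>L \<beta>\<^sub>m"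
        by (simp add: compose_expand)
      then show "?F z = ?G w"
        unfolding 1 resolvent_shift(1)[OF stable(1) z] by (simp add: compose_expand z w algebra_simps)
    qed (auto intro!: analytic)
    then show ?thesis by simp
  qed
  have c3: "\<gamma>\<^sub>m - D\<^sub>p o\<^sub>C\<^sub>L H - \<gamma>\<^sub>p o\<^sub>C\<^sub>L P o\<^sub>C\<^sub>L \<alpha>\<^sub>m = 0"
  proof -
    let ?F = "\<lambda>w. (\<gamma>\<^sub>m - D\<^sub>p o\<^sub>C\<^sub>L H - \<gamma>\<^sub>p o\<^sub>C\<^sub>L P o\<^sub>C\<^sub>L \<alpha>\<^sub>m) o\<^sub>C\<^sub>L resolvent \<alpha>\<^sub>m w"
    let ?G = "\<lambda>z. z *\<^sub>C (\<gamma>\<^sub>p o\<^sub>C\<^sub>L resolvent \<alpha>\<^sub>p z o\<^sub>C\<^sub>L P + W\<^sub>p z o\<^sub>C\<^sub>L K z)"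
    have "?F 0 = ?G 0"
    proof (rule disc_analytic_Liouville[where F = ?F and G = ?G])
      fix w z :: complex assume w: "norm w = 1" "w * z = 1"
      note z = norm_w[OF w]
      have "\<gamma>\<^sub>m o\<^sub>C\<^sub>L resolvent \<alpha>\<^sub>m w = W\<^sub>p z o\<^sub>C\<^sub>L Y\<^sub>p z o\<^sub>C\<^sub>L (\<gamma>\<^sub>m o\<^sub>C\<^sub>L resolvent \<alpha>\<^sub>m w)"
        using Y\<^sub>p[OF z(1)] by simp
      also have "\<dots> = W\<^sub>p z o\<^sub>C\<^sub>L (Y\<^sub>p z o\<^sub>C\<^sub>L \<gamma>\<^sub>m o\<^sub>C\<^sub>L resolvent \<alpha>\<^sub>m w)"
        by (simp add: compose_assoc)
      also have "\<dots> = W\<^sub>p z o\<^sub>C\<^sub>L H o\<^sub>C\<^sub>L resolvent \<alpha>\<^sub>m w + z *\<^sub>C (W\<^sub>p z o\<^sub>C\<^sub>L K z)"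
        unfolding HK[OF z] by (simp add: compose_expand)
      also have "W\<^sub>p z o\<^sub>C\<^sub>L H o\<^sub>C\<^sub>L resolvent \<alpha>\<^sub>m w = D\<^sub>p o\<^sub>C\<^sub>L H o\<^sub>C\<^sub>L resolvent \<alpha>\<^sub>m w
          + z *\<^sub>C (\<gamma>\<^sub>p o\<^sub>C\<^sub>L (resolvent \<alpha>\<^sub>p z o\<^sub>C\<^sub>L (G o\<^sub>C\<^sub>L H) o\<^sub>C\<^sub>L resolvent \<alpha>\<^sub>m w))"
        unfolding W\<^sub>p_eq[OF eq_refl[OF z(1)]] by (simp add: compose_expand)
      finally have 1: "\<gamma>\<^sub>m o\<^sub>C\<^sub>L resolvent \<alpha>\<^sub>m w = D\<^sub>p o\<^sub>C\<^sub>L H o\<^sub>C\<^sub>L resolvent \<alpha>\<^sub>m w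
          + z *\<^sub>C (\<gamma>\<^sub>p o\<^sub>C\<^sub>L (P o\<^sub>C\<^sub>L resolvent \<alpha>\<^sub>m w + resolvent \<alpha>\<^sub>p z o\<^sub>C\<^sub>L P - P)) + z *\<^sub>C (W\<^sub>p z o\<^sub>C\<^sub>L K z)"
        unfolding cross[OF z] .
      have "?F w = \<gamma>\<^sub>m o\<^sub>C\<^sub>L resolvent \<alpha>\<^sub>m w - D\<^sub>p o\<^sub>C\<^sub>L H o\<^sub>C\<^sub>L resolvent \<alpha>\<^sub>m w
          - \<gamma>\<^sub>p o\<^sub>C\<^sub>L P o\<^sub>C\<^sub>L (\<alpha>\<^sub>m o\<^sub>C\<^sub>L resolvent \<alpha>\<^sub>m w)"
        by (simp add: compose_expand)
      then show "?F w = ?G z"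
        unfolding 1 resolvent_shift(2)[OF stable(2) w] by (simp add: compose_expand z w algebra_simps)
    qed (auto intro!: analytic)
    then show ?thesis by simp
  qed
  have c4: "\<delta> - D\<^sub>p o\<^sub>C\<^sub>L D\<^sub>m - \<gamma>\<^sub>p o\<^sub>C\<^sub>L P o\<^sub>C\<^sub>L \<beta>\<^sub>m = 0"
    using R_eq[of 1 1] realization[of 1 1] W\<^sub>p_eq[of 1] W_eq[of 1]
      product_of_realizations[OF stable(1,2) _ _ c1 c2 c3, of 1 1]
    by (simp add: algebra_simps)

  have D\<^sub>p: "cblinfun_invertible D\<^sub>p" and D\<^sub>m: "cblinfun_invertible D\<^sub>m"
    using plus_factorD(3)[OF W\<^sub>p, of 0] plus_factorD(3)[OF W, of 0] by (simp_all add: D\<^sub>p_def D\<^sub>m_def)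
  \<comment> \<open>The state operators of the inverses of the two factors.\<close>
  define c where "c = \<alpha>\<^sub>m - \<beta>\<^sub>m o\<^sub>C\<^sub>L cblinfun_inv D\<^sub>m o\<^sub>C\<^sub>L H"
  define d where "d = \<alpha>\<^sub>p - G o\<^sub>C\<^sub>L cblinfun_inv D\<^sub>p o\<^sub>C\<^sub>L \<gamma>\<^sub>p"
  have c: "disc_stable c"
    unfolding disc_stable_def
  proof safe
    fix w :: complex assume w: "norm w \<le> 1"
    have "cblinfun_invertible ((id_cblinfun - w *\<^sub>C \<alpha>\<^sub>m) + (w *\<^sub>C \<beta>\<^sub>m) o\<^sub>C\<^sub>L cblinfun_inv D\<^sub>m o\<^sub>C\<^sub>L H)"
    proof (rule invertible_woodbury[OF _ D\<^sub>m])
      show "cblinfun_invertible (D\<^sub>m + H o\<^sub>C\<^sub>L cblinfun_inv (id_cblinfun - w *\<^sub>C \<alpha>\<^sub>m) o\<^sub>C\<^sub>L w *\<^sub>C \<beta>\<^sub>m)"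
        using plus_factorD(3)[OF W w] unfolding W_eq[OF w] resolvent_def by (simp add: compose_scaleC)
    qed (use stable(2) w in \<open>auto simp: disc_stable_def\<close>)
    then show "cblinfun_invertible (id_cblinfun - w *\<^sub>C c)" by (simp add: c_def compose_expand diff_diff_eq2 diff_add_eq)
  qed
  have d: "disc_stable d"
    unfolding disc_stable_def
  proof safe
    fix z :: complex assume z: "norm z \<le> 1"
    have "cblinfun_invertible ((id_cblinfun - z *\<^sub>C \<alpha>\<^sub>p) + (z *\<^sub>C G) o\<^sub>C\<^sub>L cblinfun_inv D\<^sub>p o\<^sub>C\<^sub>L \<gamma>\<^sub>p)"
    proof (rule invertible_woodbury[OF _ D\<^sub>p])
      show "cblinfun_invertible (D\<^sub>p + \<gamma>\<^sub>p o\<^sub>C\<^sub>L cblinfun_inv (id_cblinfun - z *\<^sub>C \<alpha>\<^sub>p) o\<^sub>C\<^sub>L z *\<^sub>C G)"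
        using plus_factorD(3)[OF W\<^sub>p z] unfolding W\<^sub>p_eq[OF z] resolvent_def by (simp add: compose_scaleC)
    qed (use stable(1) z in \<open>auto simp: disc_stable_def\<close>)
    then show "cblinfun_invertible (id_cblinfun - z *\<^sub>C d)" by (simp add: d_def compose_expand diff_diff_eq2 diff_add_eq)
  qed
  note zeros = identities c1 c2 c3 c4

  have NP: "N o\<^sub>C\<^sub>L P + Z = 0"
  proof (rule stein_unique[OF stable(3) c])
    \<comment> \<open>The defect solves a homogeneous Stein equation with stable coefficients.\<close>
    let ?X = "N o\<^sub>C\<^sub>L P + Z" and ?V = "\<beta>' o\<^sub>C\<^sub>L D\<^sub>p - N o\<^sub>C\<^sub>L G"
    have "a o\<^sub>C\<^sub>L ?X o\<^sub>C\<^sub>L \<alpha>\<^sub>m - (?X + ?V o\<^sub>C\<^sub>L H)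
      = (a o\<^sub>C\<^sub>L N - N o\<^sub>C\<^sub>L \<alpha>\<^sub>p + \<beta>' o\<^sub>C\<^sub>L \<gamma>\<^sub>p) o\<^sub>C\<^sub>L P o\<^sub>C\<^sub>L \<alpha>\<^sub>m + (a o\<^sub>C\<^sub>L Z o\<^sub>C\<^sub>L \<alpha>\<^sub>m - Z - \<beta>' o\<^sub>C\<^sub>L \<gamma>\<^sub>m)
        - N o\<^sub>C\<^sub>L (P - \<alpha>\<^sub>p o\<^sub>C\<^sub>L P o\<^sub>C\<^sub>L \<alpha>\<^sub>m - G o\<^sub>C\<^sub>L H) + \<beta>' o\<^sub>C\<^sub>L (\<gamma>\<^sub>m - D\<^sub>p o\<^sub>C\<^sub>L H - \<gamma>\<^sub>p o\<^sub>C\<^sub>L P o\<^sub>C\<^sub>L \<alpha>\<^sub>m)"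
      by (simp add: compose_expand algebra_simps)
    also have "\<dots> = 0" by (simp only: zeros zero_simps)
    finally have 1: "a o\<^sub>C\<^sub>L ?X o\<^sub>C\<^sub>L \<alpha>\<^sub>m = ?X + ?V o\<^sub>C\<^sub>L H" by (simp only: right_minus_eq)
    have "a o\<^sub>C\<^sub>L ?X o\<^sub>C\<^sub>L \<beta>\<^sub>m - ?V o\<^sub>C\<^sub>L D\<^sub>m
      = (a o\<^sub>C\<^sub>L N - N o\<^sub>C\<^sub>L \<alpha>\<^sub>p + \<beta>' o\<^sub>C\<^sub>L \<gamma>\<^sub>p) o\<^sub>C\<^sub>L P o\<^sub>C\<^sub>L \<beta>\<^sub>m
        + \<beta>' o\<^sub>C\<^sub>L (\<delta> - D\<^sub>p o\<^sub>C\<^sub>L D\<^sub>m - \<gamma>\<^sub>p o\<^sub>C\<^sub>L P o\<^sub>C\<^sub>L \<beta>\<^sub>m)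
        - (\<beta>' o\<^sub>C\<^sub>L \<delta> - N o\<^sub>C\<^sub>L \<beta>\<^sub>p - a o\<^sub>C\<^sub>L Z o\<^sub>C\<^sub>L \<beta>\<^sub>m)
        - N o\<^sub>C\<^sub>L (\<beta>\<^sub>p - G o\<^sub>C\<^sub>L D\<^sub>m - \<alpha>\<^sub>p o\<^sub>C\<^sub>L P o\<^sub>C\<^sub>L \<beta>\<^sub>m)"
      by (simp add: compose_expand algebra_simps)
    also have "\<dots> = 0" by (simp only: zeros zero_simps)
    finally have 2: "a o\<^sub>C\<^sub>L ?X o\<^sub>C\<^sub>L \<beta>\<^sub>m = ?V o\<^sub>C\<^sub>L D\<^sub>m" by (simp only: right_minus_eq)
    have "a o\<^sub>C\<^sub>L ?X o\<^sub>C\<^sub>L c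
      = (a o\<^sub>C\<^sub>L ?X o\<^sub>C\<^sub>L \<alpha>\<^sub>m) - (a o\<^sub>C\<^sub>L ?X o\<^sub>C\<^sub>L \<beta>\<^sub>m) o\<^sub>C\<^sub>L (cblinfun_inv D\<^sub>m o\<^sub>C\<^sub>L H)"
      unfolding c_def compose.diff_right compose_assoc ..
    also have "\<dots> = ?X"
      unfolding 1 2 by (simp add: compose_assoc inv_cancel D\<^sub>m)
    finally show "?X = a o\<^sub>C\<^sub>L ?X o\<^sub>C\<^sub>L c" ..
  qed
  have PM: "P o\<^sub>C\<^sub>L M + Z = 0"
  proof (rule stein_unique[OF d stable(4)])
    let ?X = "P o\<^sub>C\<^sub>L M + Z" and ?V = "H o\<^sub>C\<^sub>L M + D\<^sub>m o\<^sub>C\<^sub>L \<gamma>'"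
    have "\<alpha>\<^sub>p o\<^sub>C\<^sub>L ?X o\<^sub>C\<^sub>L b - (?X - G o\<^sub>C\<^sub>L ?V)
      = \<alpha>\<^sub>p o\<^sub>C\<^sub>L P o\<^sub>C\<^sub>L (M o\<^sub>C\<^sub>L b - \<alpha>\<^sub>m o\<^sub>C\<^sub>L M - \<beta>\<^sub>m o\<^sub>C\<^sub>L \<gamma>') + (\<alpha>\<^sub>p o\<^sub>C\<^sub>L Z o\<^sub>C\<^sub>L b - Z + \<beta>\<^sub>p o\<^sub>C\<^sub>L \<gamma>')
        - (P - \<alpha>\<^sub>p o\<^sub>C\<^sub>L P o\<^sub>C\<^sub>L \<alpha>\<^sub>m - G o\<^sub>C\<^sub>L H) o\<^sub>C\<^sub>L M - (\<beta>\<^sub>p - G o\<^sub>C\<^sub>L D\<^sub>m - \<alpha>\<^sub>p o\<^sub>C\<^sub>L P o\<^sub>C\<^sub>L \<beta>\<^sub>m) o\<^sub>C\<^sub>L \<gamma>'"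
      by (simp add: compose_expand algebra_simps)
    also have "\<dots> = 0" by (simp only: zeros zero_simps)
    finally have 1: "\<alpha>\<^sub>p o\<^sub>C\<^sub>L ?X o\<^sub>C\<^sub>L b = ?X - G o\<^sub>C\<^sub>L ?V" by (simp only: right_minus_eq)
    have "\<gamma>\<^sub>p o\<^sub>C\<^sub>L ?X o\<^sub>C\<^sub>L b - (- (D\<^sub>p o\<^sub>C\<^sub>L ?V))
      = (\<gamma>\<^sub>m o\<^sub>C\<^sub>L M + \<delta> o\<^sub>C\<^sub>L \<gamma>' + \<gamma>\<^sub>p o\<^sub>C\<^sub>L Z o\<^sub>C\<^sub>L b) - (\<gamma>\<^sub>m - D\<^sub>p o\<^sub>C\<^sub>L H - \<gamma>\<^sub>p o\<^sub>C\<^sub>L P o\<^sub>C\<^sub>L \<alpha>\<^sub>m) o\<^sub>C\<^sub>L M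
        - (\<delta> - D\<^sub>p o\<^sub>C\<^sub>L D\<^sub>m - \<gamma>\<^sub>p o\<^sub>C\<^sub>L P o\<^sub>C\<^sub>L \<beta>\<^sub>m) o\<^sub>C\<^sub>L \<gamma>'
        + \<gamma>\<^sub>p o\<^sub>C\<^sub>L P o\<^sub>C\<^sub>L (M o\<^sub>C\<^sub>L b - \<alpha>\<^sub>m o\<^sub>C\<^sub>L M - \<beta>\<^sub>m o\<^sub>C\<^sub>L \<gamma>')"
      by (simp add: compose_expand algebra_simps)
    also have "\<dots> = 0" by (simp only: zeros zero_simps)
    finally have 2: "\<gamma>\<^sub>p o\<^sub>C\<^sub>L ?X o\<^sub>C\<^sub>L b = - (D\<^sub>p o\<^sub>C\<^sub>L ?V)" by (simp only: right_minus_eq)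
    have "d o\<^sub>C\<^sub>L ?X o\<^sub>C\<^sub>L b
      = (\<alpha>\<^sub>p o\<^sub>C\<^sub>L ?X o\<^sub>C\<^sub>L b) - G o\<^sub>C\<^sub>L cblinfun_inv D\<^sub>p o\<^sub>C\<^sub>L (\<gamma>\<^sub>p o\<^sub>C\<^sub>L ?X o\<^sub>C\<^sub>L b)"
      unfolding d_def compose.diff_left compose_assoc ..
    also have "\<dots> = ?X"
      unfolding 1 2 by (simp add: compose_assoc compose.minus_right inv_cancel D\<^sub>p)
    finally show "?X = d o\<^sub>C\<^sub>L ?X o\<^sub>C\<^sub>L b" ..
  qed
  show ?thesis
  proof (rule invertibleI[of _ "id_cblinfun - Q o\<^sub>C\<^sub>L P"])
    have "M o\<^sub>C\<^sub>L (id_cblinfun - Q o\<^sub>C\<^sub>L P) = id_cblinfun - Q o\<^sub>C\<^sub>L (N o\<^sub>C\<^sub>L P + Z)"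
      by (simp add: M_def N_def compose_expand algebra_simps)
    then show "M o\<^sub>C\<^sub>L (id_cblinfun - Q o\<^sub>C\<^sub>L P) = id_cblinfun" by (simp add: NP compose.zero_right)
    have "(id_cblinfun - Q o\<^sub>C\<^sub>L P) o\<^sub>C\<^sub>L M = id_cblinfun - Q o\<^sub>C\<^sub>L (P o\<^sub>C\<^sub>L M + Z)"
      by (simp add: M_def compose_expand algebra_simps)
    then show "(id_cblinfun - Q o\<^sub>C\<^sub>L P) o\<^sub>C\<^sub>L M = id_cblinfun" by (simp add: PM compose.zero_right)
  qed
qed

end

section \<open>The criterion\<close>

text \<open>The operator \<open>b\<close> is a Schur complement whose counterpart is \<open>R(0)\<close>, so that it is
  invertible, and \<open>\<gamma>\<^sub>m \<alpha>\<^sub>m\<^sup>-\<^sup>1 b = R(0) (\<delta> - \<gamma>\<^sub>m Q \<beta>\<^sub>p)\<^sup>-\<^sup>1 \<gamma>\<^sub>m\<close>. Multiplying the Lyapunov equation by \<open>b\<close> from the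
  right therefore removes the inverses of \<open>\<alpha>\<^sub>m\<close>, \<open>b\<close> and \<open>R(0)\<close>.\<close>

lemma stein_from_lyapunov:
  fixes \<delta> :: "'u :: complex_hilbert \<Rightarrow>\<^sub>C\<^sub>L 'u" and \<alpha>\<^sub>m :: "'m :: complex_hilbert \<Rightarrow>\<^sub>C\<^sub>L 'm"
    and \<beta>\<^sub>p :: "'u \<Rightarrow>\<^sub>C\<^sub>L 'p :: complex_hilbert" and Q :: "'p \<Rightarrow>\<^sub>C\<^sub>L 'm"
  assumes \<Delta>: "cblinfun_invertible (\<delta> - \<gamma>\<^sub>m o\<^sub>C\<^sub>L Q o\<^sub>C\<^sub>L \<beta>\<^sub>p)"
    and \<alpha>: "cblinfun_invertible \<alpha>\<^sub>m"
    and R0: "R0 = \<delta> - \<gamma>\<^sub>m o\<^sub>C\<^sub>L cblinfun_inv \<alpha>\<^sub>m o\<^sub>C\<^sub>L \<beta>\<^sub>m" "cblinfun_invertible R0"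
    and b: "b = \<alpha>\<^sub>m - (\<beta>\<^sub>m - \<alpha>\<^sub>m o\<^sub>C\<^sub>L Q o\<^sub>C\<^sub>L \<beta>\<^sub>p) o\<^sub>C\<^sub>L cblinfun_inv (\<delta> - \<gamma>\<^sub>m o\<^sub>C\<^sub>L Q o\<^sub>C\<^sub>L \<beta>\<^sub>p) o\<^sub>C\<^sub>L \<gamma>\<^sub>m"
    and lyapunov: "Z o\<^sub>C\<^sub>L cblinfun_inv b - a o\<^sub>C\<^sub>L Z
      = - (\<beta>\<^sub>p o\<^sub>C\<^sub>L cblinfun_inv R0 o\<^sub>C\<^sub>L \<gamma>\<^sub>m o\<^sub>C\<^sub>L cblinfun_inv \<alpha>\<^sub>m)"
  shows "Z = a o\<^sub>C\<^sub>L Z o\<^sub>C\<^sub>L b - \<beta>\<^sub>p o\<^sub>C\<^sub>L cblinfun_inv (\<delta> - \<gamma>\<^sub>m o\<^sub>C\<^sub>L Q o\<^sub>C\<^sub>L \<beta>\<^sub>p) o\<^sub>C\<^sub>L \<gamma>\<^sub>m"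
proof -
  define \<Delta> where "\<Delta> = \<delta> - \<gamma>\<^sub>m o\<^sub>C\<^sub>L Q o\<^sub>C\<^sub>L \<beta>\<^sub>p"
  define \<beta> where "\<beta> = \<beta>\<^sub>m - \<alpha>\<^sub>m o\<^sub>C\<^sub>L Q o\<^sub>C\<^sub>L \<beta>\<^sub>p"
  have \<Delta>_inv: "cblinfun_invertible \<Delta>" using \<Delta> by (simp add: \<Delta>_def)
  have b_eq: "b = \<alpha>\<^sub>m - \<beta> o\<^sub>C\<^sub>L cblinfun_inv \<Delta> o\<^sub>C\<^sub>L \<gamma>\<^sub>m"
    by (simp add: b \<beta>_def \<Delta>_def)
  have \<gamma>\<beta>: "\<gamma>\<^sub>m o\<^sub>C\<^sub>L cblinfun_inv \<alpha>\<^sub>m o\<^sub>C\<^sub>L \<beta> = \<Delta> - R0"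
    by (simp add: \<beta>_def \<Delta>_def R0(1) compose_expand inv_cancel \<alpha>)
  have b_inv: "cblinfun_invertible b"
  proof -
    have "cblinfun_invertible (\<alpha>\<^sub>m + - \<beta> o\<^sub>C\<^sub>L cblinfun_inv \<Delta> o\<^sub>C\<^sub>L \<gamma>\<^sub>m)"
      by (rule invertible_woodbury[OF \<alpha> \<Delta>_inv]) (simp add: compose.minus_right \<gamma>\<beta> R0(2))
    then show ?thesis by (simp add: b_eq compose.minus_left)
  qed
  have "\<gamma>\<^sub>m o\<^sub>C\<^sub>L cblinfun_inv \<alpha>\<^sub>m o\<^sub>C\<^sub>L b
    = \<gamma>\<^sub>m - (\<gamma>\<^sub>m o\<^sub>C\<^sub>L cblinfun_inv \<alpha>\<^sub>m o\<^sub>C\<^sub>L \<beta>) o\<^sub>C\<^sub>L cblinfun_inv \<Delta> o\<^sub>C\<^sub>L \<gamma>\<^sub>m"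
    by (simp add: b_eq compose_expand cblinfun_inv_works \<alpha>)
  also have "\<dots> = R0 o\<^sub>C\<^sub>L (cblinfun_inv \<Delta> o\<^sub>C\<^sub>L \<gamma>\<^sub>m)"
    unfolding \<gamma>\<beta> by (simp add: compose_expand inv_cancel \<Delta>_inv)
  finally have \<gamma>b: "\<gamma>\<^sub>m o\<^sub>C\<^sub>L cblinfun_inv \<alpha>\<^sub>m o\<^sub>C\<^sub>L b = R0 o\<^sub>C\<^sub>L (cblinfun_inv \<Delta> o\<^sub>C\<^sub>L \<gamma>\<^sub>m)" .
  have "Z - a o\<^sub>C\<^sub>L Z o\<^sub>C\<^sub>L b = (Z o\<^sub>C\<^sub>L cblinfun_inv b - a o\<^sub>C\<^sub>L Z) o\<^sub>C\<^sub>L b"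
    by (simp add: compose_expand cblinfun_inv_works b_inv)
  also have "\<dots> = - (\<beta>\<^sub>p o\<^sub>C\<^sub>L cblinfun_inv R0 o\<^sub>C\<^sub>L (\<gamma>\<^sub>m o\<^sub>C\<^sub>L cblinfun_inv \<alpha>\<^sub>m o\<^sub>C\<^sub>L b))"
    unfolding lyapunov by (simp add: compose_expand)
  also have "\<dots> = - (\<beta>\<^sub>p o\<^sub>C\<^sub>L cblinfun_inv \<Delta> o\<^sub>C\<^sub>L \<gamma>\<^sub>m)"
    unfolding \<gamma>b by (simp add: compose_assoc inv_cancel R0(2))
  finally show ?thesis by (simp add: \<Delta>_def algebra_simps)
qed

theorem theorem4p1:
  fixes R :: "complex \<Rightarrow> ('u :: complex_hilbert \<Rightarrow>\<^sub>C\<^sub>L 'u)"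
    and \<delta> :: "'u \<Rightarrow>\<^sub>C\<^sub>L 'u"
    and \<alpha>\<^sub>p :: "'p :: complex_hilbert \<Rightarrow>\<^sub>C\<^sub>L 'p"
    and \<beta>\<^sub>p :: "'u \<Rightarrow>\<^sub>C\<^sub>L 'p"
    and \<gamma>\<^sub>p :: "'p \<Rightarrow>\<^sub>C\<^sub>L 'u"
    and \<alpha>\<^sub>m :: "'m :: complex_hilbert \<Rightarrow>\<^sub>C\<^sub>L 'm"
    and \<beta>\<^sub>m :: "'u \<Rightarrow>\<^sub>C\<^sub>L 'm"
    and \<gamma>\<^sub>m :: "'m \<Rightarrow>\<^sub>C\<^sub>L 'u"
    and Q :: "'p \<Rightarrow>\<^sub>C\<^sub>L 'm"
    and Z :: "'m \<Rightarrow>\<^sub>C\<^sub>L 'p"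
  assumes "stable_representation R \<delta> \<alpha>\<^sub>p \<beta>\<^sub>p \<gamma>\<^sub>p \<alpha>\<^sub>m \<beta>\<^sub>m \<gamma>\<^sub>m"
    and "cblinfun_invertible \<alpha>\<^sub>m"
    and "cblinfun_invertible (R 0)"
    and "right_canonical_WH R"
    and "stabilizing_solution \<delta> \<alpha>\<^sub>p \<beta>\<^sub>p \<gamma>\<^sub>p \<alpha>\<^sub>m \<beta>\<^sub>m \<gamma>\<^sub>m Q"
    and "Z o\<^sub>C\<^sub>L cblinfun_inv (alpha_minus_circ \<delta> \<beta>\<^sub>p \<alpha>\<^sub>m \<beta>\<^sub>m \<gamma>\<^sub>m Q)
           - alpha_plus_circ \<delta> \<alpha>\<^sub>p \<beta>\<^sub>p \<gamma>\<^sub>p \<gamma>\<^sub>m Q o\<^sub>C\<^sub>L Z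
         = - (\<beta>\<^sub>p o\<^sub>C\<^sub>L cblinfun_inv (R 0) o\<^sub>C\<^sub>L \<gamma>\<^sub>m o\<^sub>C\<^sub>L cblinfun_inv \<alpha>\<^sub>m)"
  shows "left_canonical_WH R \<longleftrightarrow> cblinfun_invertible (id_cblinfun - Q o\<^sub>C\<^sub>L Z)"
proof -
  define a where "a = alpha_plus_circ \<delta> \<alpha>\<^sub>p \<beta>\<^sub>p \<gamma>\<^sub>p \<gamma>\<^sub>m Q"
  define b where "b = alpha_minus_circ \<delta> \<beta>\<^sub>p \<alpha>\<^sub>m \<beta>\<^sub>m \<gamma>\<^sub>m Q"
  have \<Delta>: "cblinfun_invertible (\<delta> - \<gamma>\<^sub>m o\<^sub>C\<^sub>L Q o\<^sub>C\<^sub>L \<beta>\<^sub>p)"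
    and riccati: "riccati_solution \<delta> \<alpha>\<^sub>p \<beta>\<^sub>p \<gamma>\<^sub>p \<alpha>\<^sub>m \<beta>\<^sub>m \<gamma>\<^sub>m Q"
    and ab: "exponentially_stable a" "exponentially_stable b"
    using assms(5) by (simp_all add: stabilizing_solution_def riccati_solution_def a_def b_def)
  have \<alpha>: "exponentially_stable \<alpha>\<^sub>p" "exponentially_stable \<alpha>\<^sub>m"
    using assms(1) by (simp_all add: stable_representation_def)
  have stable: "disc_stable T" if "exponentially_stable T" for T :: "'x :: complex_hilbert \<Rightarrow>\<^sub>C\<^sub>L 'x"
    using exponentially_stable_invertible[OF that] by (simp add: disc_stable_def)
  interpret wiener_hopf_realization \<delta> "cblinfun_inv (\<delta> - \<gamma>\<^sub>m o\<^sub>C\<^sub>L Q o\<^sub>C\<^sub>L \<beta>\<^sub>p)" \<alpha>\<^sub>p a \<beta>\<^sub>p \<gamma>\<^sub>p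
    \<alpha>\<^sub>m b \<beta>\<^sub>m \<gamma>\<^sub>m Q Z "\<beta>\<^sub>m - \<alpha>\<^sub>m o\<^sub>C\<^sub>L Q o\<^sub>C\<^sub>L \<beta>\<^sub>p" "\<gamma>\<^sub>p - \<gamma>\<^sub>m o\<^sub>C\<^sub>L Q o\<^sub>C\<^sub>L \<alpha>\<^sub>p" R
  proof
    show "Z = a o\<^sub>C\<^sub>L Z o\<^sub>C\<^sub>L b - \<beta>\<^sub>p o\<^sub>C\<^sub>L cblinfun_inv (\<delta> - \<gamma>\<^sub>m o\<^sub>C\<^sub>L Q o\<^sub>C\<^sub>L \<beta>\<^sub>p) o\<^sub>C\<^sub>L \<gamma>\<^sub>m"
      by (rule stein_from_lyapunov[OF \<Delta> assms(2) stable_representation_at_0[OF assms(1,2)] assms(3)])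
        (use assms(6) in \<open>simp_all add: a_def b_def alpha_minus_circ_def\<close>)
    fix z w :: complex assume z: "norm z = 1" "z * w = 1"
    have "norm w = 1" using z by (metis mult_1 norm_mult norm_one)
    then have inv: "cblinfun_invertible (id_cblinfun - w *\<^sub>C \<alpha>\<^sub>m)" "cblinfun_invertible (id_cblinfun - z *\<^sub>C \<alpha>\<^sub>p)"
      using stable[OF \<alpha>(1)] stable[OF \<alpha>(2)] z by (simp_all add: disc_stable_def)
    have "z *\<^sub>C id_cblinfun - \<alpha>\<^sub>m = z *\<^sub>C (id_cblinfun - w *\<^sub>C \<alpha>\<^sub>m)"
      using z by (simp add: compose_expand)
    then have "(z *\<^sub>C id_cblinfun - \<alpha>\<^sub>m) o\<^sub>C\<^sub>L (w *\<^sub>C resolvent \<alpha>\<^sub>m w) = id_cblinfun"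
      "(w *\<^sub>C resolvent \<alpha>\<^sub>m w) o\<^sub>C\<^sub>L (z *\<^sub>C id_cblinfun - \<alpha>\<^sub>m) = id_cblinfun"
      using z cblinfun_inv_works[OF inv(1)]
      by (simp_all add: compose_scaleC scaleC_scaleC resolvent_def mult.commute[of w])
    note res = this cblinfun_inv_unique[OF this]
    have "cblinfun_invertible (z *\<^sub>C id_cblinfun - \<alpha>\<^sub>m)"
      using res(1,2) by (rule invertibleI)
    then show "R z = \<delta> + z *\<^sub>C (\<gamma>\<^sub>p o\<^sub>C\<^sub>L resolvent \<alpha>\<^sub>p z o\<^sub>C\<^sub>L \<beta>\<^sub>p) + w *\<^sub>C (\<gamma>\<^sub>m o\<^sub>C\<^sub>L resolvent \<alpha>\<^sub>m w o\<^sub>C\<^sub>L \<beta>\<^sub>m)"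
      using assms(1) inv(2) unfolding stable_representation_def
      by (simp add: res(3) compose_scaleC resolvent_def)
  qed (use \<Delta> riccati ab \<alpha> in \<open>simp_all add: cblinfun_inv_works stable riccati_solution_def
      a_def alpha_plus_circ_def b_def alpha_minus_circ_def\<close>)
  obtain V\<^sub>m V\<^sub>p where V: "minus_factor V\<^sub>m" "plus_factor V\<^sub>p" "R 1 = V\<^sub>m 1 o\<^sub>C\<^sub>L V\<^sub>p 1"
    using assms(4) unfolding right_canonical_WH_def by (metis mem_sphere_0 norm_one)
  obtain L where "plus_factor (\<lambda>w. if w = 0 then L else V\<^sub>m (inverse w))"
    using V(1) unfolding minus_factor_iff by blast
  from plus_factorD(3)[OF this, of 1] plus_factorD(3)[OF V(2), of 1]
  have "cblinfun_invertible (R 1)"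
    by (simp add: V(3) invertible_comp)
  then show ?thesis
    using left_factorization M_invertible by (auto simp: M_def)
qed

end
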